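(* Let $k$ be a field, $X$ transcendental over $k$, and let $K = k(X)(\sqrt[p]{aX^p+bX+c})$, where $p$ is an odd prime with $p\neq \operatorname{char} k$, $a,b,c\in k$ and $a\neq 0$. Assume that $k$ contains a primitive $p$-th root of unity. Let $v$ be a valuation of $k$ with $p\neq \operatorname{char} kv$, and assume that \[ \frac{1}{p-1}\,v\!\left(\frac ba\right)>\frac1p\, v\!\left(\frac ca\right). \] Take the Gauss extension of $v$ to $K$ with $vX=\frac1p v\left(\frac ca\right)$. Then $Kv|kv$ is non-ruled if and only if both of the following conditions hold: (i) $vk+\mathbb{Z}\,\frac1p v\left(\frac ca\right)=vk+\mathbb{Z}\,\frac1p vc$; (ii) $\frac1p v\left(\frac ca\right)-\frac1p vc\notin vk$ whenever $\frac1p v\left(\frac ca\right)\notin vk$.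
   Context: Valuations are Krull valuations, written additively, with $v0=\infty$. $vk$ denotes the value group and $kv$ the residue field of $(k,v)$. Multiples $\frac1n vx$ are taken in the divisible hull of $vk$. A finitely generated field extension of transcendence degree one $K|k$ is called ruled if $K$ is purely transcendental over a finite extension of $k$. For $\gamma$ in the divisible hull of $vk$, the Gauss extension of $v$ to $k(X)$ with $vX=\gamma$ is the valuation given by $v\left(\sum_i c_iX^i\right)=\min_i\{vc_i+i\gamma\}$ for $\sum_i c_iX^i\in k[X]$. A Gauss extension of $v$ to $K$ with $vX=\gamma$ is an extension to $K$ of this valuation of $k(X)$. *)

theory Defs
  imports "HOL-Algebra.Algebra" "HOL-Computational_Algebra.Primes"
begin

section \<open>Multiples in an abelian group\<close>

primrec nmul :: "nat \<Rightarrow> 'g::monoid_add \<Rightarrow> 'g" where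
  "nmul 0 x = 0"
| "nmul (Suc n) x = x + nmul n x"

definition zmul :: "int \<Rightarrow> 'g::ab_group_add \<Rightarrow> 'g" where
  "zmul m x = (if 0 \<le> m then nmul (nat m) x else - nmul (nat (- m)) x)"

lemma nmul_1 [simp]: "nmul (Suc 0) x = x"
  by simp

lemma nmul_zero [simp]: "nmul n 0 = 0"
  by (induction n) auto

lemma nmul_plus: "nmul (m + n) x = nmul m x + nmul n x"
  by (induction m) (auto simp: add.assoc)

lemma nmul_mult: "nmul (m * n) x = nmul m (nmul n x)"
  by (induction m) (auto simp: nmul_plus)

lemma nmul_commute: "nmul m (nmul n x) = nmul n (nmul m x)"
  by (metis nmul_mult mult.commute)

lemma nmul_add: "nmul n (x + y) = nmul n x + nmul n (y :: 'g::comm_monoid_add)"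
  by (induction n) (auto simp: ac_simps)

lemma nmul_uminus: "nmul n (- x) = - nmul n (x :: 'g::ab_group_add)"
  by (induction n) auto

lemma nmul_strict_mono:
  fixes x y :: "'g::linordered_ab_group_add"
  assumes "0 < n" "x < y"
  shows "nmul n x < nmul n y"
  using assms
proof (induction n)
  case (Suc n)
  then show ?case by (cases "n = 0") (auto intro: add_strict_mono)
qed simp

lemma nmul_less_iff [simp]:
  fixes x y :: "'g::linordered_ab_group_add"
  assumes "0 < n"
  shows "nmul n x < nmul n y \<longleftrightarrow> x < y"
  using nmul_strict_mono[OF assms] by (metis not_less_iff_gr_or_eq)

lemma nmul_le_iff [simp]:
  fixes x y :: "'g::linordered_ab_group_add"
  assumes "0 < n"
  shows "nmul n x \<le> nmul n y \<longleftrightarrow> x \<le> y"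
  using assms by (simp flip: not_less)

lemma nmul_eq_iff [simp]:
  fixes x y :: "'g::linordered_ab_group_add"
  assumes "0 < n"
  shows "nmul n x = nmul n y \<longleftrightarrow> x = y"
  using assms by (simp add: order_eq_iff)


section \<open>The divisible hull of an ordered abelian group\<close>

text \<open>A pair \<open>(x, n)\<close> with \<open>n > 0\<close> represents the element \<open>x / n\<close>.\<close>

definition dhrel :: "'g::linordered_ab_group_add \<times> nat \<Rightarrow> 'g \<times> nat \<Rightarrow> bool" where
  "dhrel r s \<longleftrightarrow> 0 < snd r \<and> 0 < snd s \<and> nmul (snd s) (fst r) = nmul (snd r) (fst s)"

lemma part_equivp_dhrel:
  "part_equivp (dhrel :: 'g::linordered_ab_group_add \<times> nat \<Rightarrow> _)"
proof (rule part_equivpI)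
  show "\<exists>r :: 'g \<times> nat. dhrel r r"
    by (rule exI[of _ "(0, 1)"]) (simp add: dhrel_def)
  show "symp (dhrel :: 'g \<times> nat \<Rightarrow> _)"
    by (auto simp: symp_def dhrel_def)
  show "transp (dhrel :: 'g \<times> nat \<Rightarrow> _)"
  proof (rule transpI)
    fix r s t :: "'g \<times> nat"
    assume a: "dhrel r s" "dhrel s t"
    then have pos: "0 < snd r" "0 < snd s" "0 < snd t"
      by (auto simp: dhrel_def)
    have "nmul (snd s) (nmul (snd t) (fst r)) = nmul (snd t) (nmul (snd r) (fst s))"
      using a by (metis dhrel_def nmul_commute)
    also have "\<dots> = nmul (snd s) (nmul (snd r) (fst t))"
      using a by (metis dhrel_def nmul_commute)
    finally show "dhrel r t"
      using pos by (simp add: dhrel_def)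
  qed
qed

lemma dhrel_scale:
  assumes "dhrel r s"
  shows "nmul (snd s * m) (fst r) = nmul (snd r * m) (fst s)"
proof -
  have "nmul m (nmul (snd s) (fst r)) = nmul m (nmul (snd r) (fst s))"
    using assms by (simp add: dhrel_def)
  then show ?thesis
    by (simp flip: nmul_mult add: mult.commute)
qed

quotient_type (overloaded) 'g divhull = "'g::linordered_ab_group_add \<times> nat" / partial: dhrel
  by (rule part_equivp_dhrel)

text \<open>\<open>dh_frac x n\<close> is \<open>x / n\<close>; as with division in HOL, \<open>n = 0\<close> gives \<open>0\<close>.\<close>

lift_definition dh_frac :: "'g::linordered_ab_group_add \<Rightarrow> nat \<Rightarrow> 'g divhull"
  is "\<lambda>x n. if n = 0 then (0, 1) else (x, n)"
  by (simp add: dhrel_def)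

definition dh_of :: "'g::linordered_ab_group_add \<Rightarrow> 'g divhull" where
  "dh_of x = dh_frac x 1"

instantiation divhull :: (linordered_ab_group_add) linordered_ab_group_add
begin

lift_definition zero_divhull :: "'a divhull" is "(0, 1)"
  by (simp add: dhrel_def)

lift_definition plus_divhull :: "'a divhull \<Rightarrow> 'a divhull \<Rightarrow> 'a divhull"
  is "\<lambda>r s. (nmul (snd s) (fst r) + nmul (snd r) (fst s), snd r * snd s)"
proof -
  fix r r' s s' :: "'a \<times> nat"
  assume a: "dhrel r r'" "dhrel s s'"
  have 1: "nmul (snd r' * snd s') (nmul (snd s) (fst r)) = nmul (snd r * snd s) (nmul (snd s') (fst r'))"
    using dhrel_scale[OF a(1), of "snd s' * snd s"] by (simp flip: nmul_mult add: ac_simps)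
  have 2: "nmul (snd r' * snd s') (nmul (snd r) (fst s)) = nmul (snd r * snd s) (nmul (snd r') (fst s'))"
    using dhrel_scale[OF a(2), of "snd r' * snd r"] by (simp flip: nmul_mult add: ac_simps)
  show "dhrel (nmul (snd s) (fst r) + nmul (snd r) (fst s), snd r * snd s)
          (nmul (snd s') (fst r') + nmul (snd r') (fst s'), snd r' * snd s')"
    using a 1 2 by (simp add: dhrel_def nmul_add)
qed

lift_definition uminus_divhull :: "'a divhull \<Rightarrow> 'a divhull" is "\<lambda>r. (- fst r, snd r)"
  by (simp add: dhrel_def nmul_uminus)

definition minus_divhull :: "'a divhull \<Rightarrow> 'a divhull \<Rightarrow> 'a divhull" where
  "minus_divhull r s = r + - s"

lift_definition less_eq_divhull :: "'a divhull \<Rightarrow> 'a divhull \<Rightarrow> bool"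
  is "\<lambda>r s. nmul (snd s) (fst r) \<le> nmul (snd r) (fst s)"
proof -
  fix r r' s s' :: "'a \<times> nat"
  assume a: "dhrel r r'" "dhrel s s'"
  then have pos: "0 < snd r" "0 < snd r'" "0 < snd s" "0 < snd s'"
    by (auto simp: dhrel_def)
  have 1: "nmul (snd r' * snd s') (nmul (snd s) (fst r)) = nmul (snd r * snd s) (nmul (snd s') (fst r'))"
    using dhrel_scale[OF a(1), of "snd s' * snd s"] by (simp flip: nmul_mult add: ac_simps)
  have 2: "nmul (snd r' * snd s') (nmul (snd r) (fst s)) = nmul (snd r * snd s) (nmul (snd r') (fst s'))"
    using dhrel_scale[OF a(2), of "snd r' * snd r"] by (simp flip: nmul_mult add: ac_simps)
  have "nmul (snd s) (fst r) \<le> nmul (snd r) (fst s) \<longleftrightarrow>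
      nmul (snd r' * snd s') (nmul (snd s) (fst r)) \<le> nmul (snd r' * snd s') (nmul (snd r) (fst s))"
    using pos by simp
  also have "\<dots> \<longleftrightarrow> nmul (snd s') (fst r') \<le> nmul (snd r') (fst s')"
    unfolding 1 2 using pos by simp
  finally show "(nmul (snd s) (fst r) \<le> nmul (snd r) (fst s)) =
      (nmul (snd s') (fst r') \<le> nmul (snd r') (fst s'))" .
qed

definition less_divhull :: "'a divhull \<Rightarrow> 'a divhull \<Rightarrow> bool" where
  "less_divhull r s \<longleftrightarrow> r \<le> s \<and> \<not> s \<le> r"

instance
proof
  fix r s t :: "'a divhull"
  show "r + s + t = r + (s + t)"
    by transfer (auto simp: dhrel_def nmul_add ac_simps simp flip: nmul_mult)
  show "r + s = s + r"
    by transfer (auto simp: dhrel_def nmul_add ac_simps simp flip: nmul_mult)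
  show "0 + r = r"
    by transfer (auto simp: dhrel_def)
  show "- r + r = 0"
    by transfer (auto simp: dhrel_def nmul_uminus)
  show "r - s = r + - s"
    by (rule minus_divhull_def)
  show "r < s \<longleftrightarrow> r \<le> s \<and> \<not> s \<le> r"
    by (rule less_divhull_def)
  show "r \<le> r"
    by transfer simp
  show "r \<le> s \<or> s \<le> r"
    by transfer auto
  show "r \<le> s \<Longrightarrow> s \<le> r \<Longrightarrow> r = s"
    by transfer (auto simp: dhrel_def)
  show "r \<le> t" if "r \<le> s" "s \<le> t"
    using that
  proof transfer
    fix r s t :: "'a \<times> nat"
    assume d: "dhrel r r" "dhrel s s" "dhrel t t"
      and le: "nmul (snd s) (fst r) \<le> nmul (snd r) (fst s)"
        "nmul (snd t) (fst s) \<le> nmul (snd s) (fst t)"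
    from d have pos: "0 < snd r" "0 < snd s" "0 < snd t"
      by (auto simp: dhrel_def)
    have "nmul (snd s) (nmul (snd t) (fst r)) = nmul (snd t) (nmul (snd s) (fst r))"
      by (rule nmul_commute)
    also have "\<dots> \<le> nmul (snd t) (nmul (snd r) (fst s))"
      using pos le(1) by simp
    also have "\<dots> = nmul (snd r) (nmul (snd t) (fst s))"
      by (rule nmul_commute)
    also have "\<dots> \<le> nmul (snd r) (nmul (snd s) (fst t))"
      using pos le(2) by simp
    also have "\<dots> = nmul (snd s) (nmul (snd r) (fst t))"
      by (rule nmul_commute)
    finally have "nmul (snd s) (nmul (snd t) (fst r)) \<le> nmul (snd s) (nmul (snd r) (fst t))" .
    then show "nmul (snd t) (fst r) \<le> nmul (snd r) (fst t)"
      using pos by simp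
  qed
  show "t + r \<le> t + s" if "r \<le> s"
    using that
  proof transfer
    fix r s t :: "'a \<times> nat"
    assume d: "dhrel r r" "dhrel s s" "dhrel t t"
      and le: "nmul (snd s) (fst r) \<le> nmul (snd r) (fst s)"
    from d have pos: "0 < snd t"
      by (auto simp: dhrel_def)
    then have "nmul (snd t * snd t) (nmul (snd s) (fst r)) \<le> nmul (snd t * snd t) (nmul (snd r) (fst s))"
      using le by simp
    then have "nmul (snd t * snd t * snd s) (fst r) \<le> nmul (snd t * snd t * snd r) (fst s)"
      by (simp only: nmul_mult)
    then show "nmul (snd (nmul (snd s) (fst t) + nmul (snd t) (fst s), snd t * snd s))
          (fst (nmul (snd r) (fst t) + nmul (snd t) (fst r), snd t * snd r))
        \<le> nmul (snd (nmul (snd r) (fst t) + nmul (snd t) (fst r), snd t * snd r))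
          (fst (nmul (snd s) (fst t) + nmul (snd t) (fst s), snd t * snd s))"
      by (simp only: fst_conv snd_conv nmul_add nmul_mult[symmetric] mult.assoc mult.commute
          mult.left_commute add_le_cancel_left)
  qed
qed

end

lemma dh_of_add: "dh_of (x + y) = dh_of x + dh_of y"
  unfolding dh_of_def by transfer (simp add: dhrel_def)

lemma dh_of_le_iff [simp]: "dh_of x \<le> dh_of y \<longleftrightarrow> x \<le> y"
  unfolding dh_of_def by transfer simp

lemma dh_of_zero [simp]: "dh_of 0 = 0"
  unfolding dh_of_def by transfer (simp add: dhrel_def)

lemma dh_of_nmul: "dh_of (nmul n x) = nmul n (dh_of x)"
  by (induction n) (simp_all add: dh_of_add)

lemma nmul_dh_frac:
  assumes "0 < n"
  shows "nmul n (dh_frac x n) = dh_of x"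
proof -
  have "nmul m (dh_frac x n) = dh_frac (nmul m x) n" for m
  proof (induction m)
    case 0
    show ?case by simp (transfer, simp add: dhrel_def)
  next
    case (Suc m)
    have "dh_frac x n + dh_frac (nmul m x) n = dh_frac (x + nmul m x) n"
      using assms by transfer (simp add: dhrel_def nmul_add nmul_mult)
    with Suc show ?case by simp
  qed
  moreover have "dh_frac (nmul n x) n = dh_of x"
    using assms unfolding dh_of_def by transfer (simp add: dhrel_def)
  ultimately show ?thesis by simp
qed

lemma divhull_cases:
  obtains x n where "0 < n" "q = dh_frac x n"
proof -
  have "\<exists>x n. 0 < n \<and> q = dh_frac x n"
  proof transfer
    fix q :: "'a \<times> nat"
    assume "dhrel q q"
    then show "\<exists>x n. 0 < n \<and> dhrel q (if n = 0 then (0, 1) else (x, n))"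
      by (intro exI[of _ "fst q"] exI[of _ "snd q"]) (simp add: dhrel_def)
  qed
  then show thesis using that by blast
qed


section \<open>Krull valuations\<close>

datatype 'g vext = Fin 'g | Infty

instantiation vext :: (linorder) linorder
begin

fun less_eq_vext :: "'a vext \<Rightarrow> 'a vext \<Rightarrow> bool" where
  "x \<le> Infty \<longleftrightarrow> True"
| "Infty \<le> Fin h \<longleftrightarrow> False"
| "Fin g \<le> Fin h \<longleftrightarrow> g \<le> h"

definition less_vext :: "'a vext \<Rightarrow> 'a vext \<Rightarrow> bool" where
  "less_vext x y \<longleftrightarrow> x \<le> y \<and> \<not> y \<le> x"

instance
proof
  fix x y z :: "'a vext"
  show "x < y \<longleftrightarrow> x \<le> y \<and> \<not> y \<le> x"
    by (rule less_vext_def)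
  show "x \<le> x" by (cases x) auto
  show "x \<le> y \<Longrightarrow> y \<le> z \<Longrightarrow> x \<le> z"
    by (cases x; cases y; cases z) auto
  show "x \<le> y \<Longrightarrow> y \<le> x \<Longrightarrow> x = y"
    by (cases x; cases y) auto
  show "x \<le> y \<or> y \<le> x"
    by (cases x; cases y) auto
qed

end

instantiation vext :: (comm_monoid_add) comm_monoid_add
begin

definition zero_vext :: "'a vext" where
  "zero_vext = Fin 0"

fun plus_vext :: "'a vext \<Rightarrow> 'a vext \<Rightarrow> 'a vext" where
  "Fin g + Fin h = Fin (g + h)"
| "Infty + y = Infty"
| "Fin g + Infty = Infty"

instance
proof
  fix x y z :: "'a vext"
  show "x + y + z = x + (y + z)"
    by (cases x; cases y; cases z) (auto simp: add.assoc)
  show "x + y = y + x"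
    by (cases x; cases y) (auto simp: add.commute)
  show "0 + x = x"
    by (cases x) (auto simp: zero_vext_def)
qed

end

text \<open>A value in the given ordered group, regarded as a value in its divisible hull, and
  \<open>1/n\<close> times such a value (with \<open>1/n\<close> times \<open>\<infinity>\<close> being \<open>\<infinity>\<close>).\<close>

definition vhull :: "'g::linordered_ab_group_add vext \<Rightarrow> 'g divhull vext" where
  "vhull = map_vext dh_of"

definition vdiv :: "nat \<Rightarrow> 'g::linordered_ab_group_add vext \<Rightarrow> 'g divhull vext" where
  "vdiv n = map_vext (\<lambda>g. dh_frac g n)"

text \<open>Valuations of the field \<open>F\<close> take values in an arbitrary ordered abelian group
  containing the value group. A valuation of a subfield \<open>k\<close> of \<open>K\<close> is a valuation of
  \<open>K\<lparr>carrier := k\<rparr>\<close>.\<close>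

definition valuation ::
  "('a, 'm) ring_scheme \<Rightarrow> ('a \<Rightarrow> 'g::linordered_ab_group_add vext) \<Rightarrow> bool" where
  "valuation F v \<longleftrightarrow>
     (\<forall>x\<in>carrier F. v x = Infty \<longleftrightarrow> x = \<zero>\<^bsub>F\<^esub>) \<and>
     (\<forall>x\<in>carrier F. \<forall>y\<in>carrier F. v (x \<otimes>\<^bsub>F\<^esub> y) = v x + v y) \<and>
     (\<forall>x\<in>carrier F. \<forall>y\<in>carrier F. min (v x) (v y) \<le> v (x \<oplus>\<^bsub>F\<^esub> y))"

definition value_group ::
  "('a, 'm) ring_scheme \<Rightarrow> ('a \<Rightarrow> 'g::linordered_ab_group_add vext) \<Rightarrow> 'g set" where
  "value_group F v = {g. \<exists>x\<in>carrier F. v x = Fin g}"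

text \<open>The subgroup \<open>H + \<int>g\<close> for a subgroup \<open>H\<close>.\<close>

definition add_multiples :: "'g::ab_group_add set \<Rightarrow> 'g \<Rightarrow> 'g set" where
  "add_multiples H g = {h + zmul m g | h m. h \<in> H}"

definition val_ring ::
  "('a, 'm) ring_scheme \<Rightarrow> ('a \<Rightarrow> 'g::linordered_ab_group_add vext) \<Rightarrow> ('a, 'm) ring_scheme" where
  "val_ring F v = F\<lparr>carrier := {x \<in> carrier F. 0 \<le> v x}\<rparr>"

definition val_ideal ::
  "('a, 'm) ring_scheme \<Rightarrow> ('a \<Rightarrow> 'g::linordered_ab_group_add vext) \<Rightarrow> 'a set" where
  "val_ideal F v = {x \<in> carrier F. 0 < v x}"

definition residue_field ::
  "('a, 'm) ring_scheme \<Rightarrow> ('a \<Rightarrow> 'g::linordered_ab_group_add vext) \<Rightarrow> 'a set ring" where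
  "residue_field F v = val_ring F v Quot val_ideal F v"

text \<open>For a valuation \<open>w\<close> of \<open>K\<close>, the canonical copy inside \<open>Kw\<close> of the residue field of the
  restriction of \<open>w\<close> to the subfield \<open>k\<close>.\<close>

definition residue_subfield ::
  "('a, 'm) ring_scheme \<Rightarrow> ('a \<Rightarrow> 'g::linordered_ab_group_add vext) \<Rightarrow> 'a set \<Rightarrow> 'a set set" where
  "residue_subfield K w k = {val_ideal K w +>\<^bsub>val_ring K w\<^esub> x | x. x \<in> k \<and> 0 \<le> w x}"

text \<open>The order of \<open>1\<close> in the additive group, which in the library is \<open>0\<close> if infinite.\<close>

definition ring_char :: "('a, 'm) ring_scheme \<Rightarrow> nat" where
  "ring_char R = group.ord (add_monoid R) \<one>\<^bsub>R\<^esub>"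

text \<open>Since a valuation of \<open>k(X)\<close> is determined by its values on \<open>k[X]\<close>, the last two clauses
  (the first of which is implied by the second) say that \<open>w\<close> restricts on \<open>k(X)\<close> to the
  Gauss extension of \<open>v\<close> with \<open>vX = \<gamma>\<close>. The transcendental \<open>X\<close> is written \<open>x\<close> below, because
  HOL-Algebra uses \<open>X\<close> as notation for its polynomial variable. Both \<open>v\<close> and \<open>w\<close> take
  values in the same group, while the formula lives in its divisible hull, which contains that
  of the value group of \<open>v\<close>.\<close>

definition gauss_extension ::
  "('a, 'm) ring_scheme \<Rightarrow> 'a set \<Rightarrow> ('a \<Rightarrow> 'g::linordered_ab_group_add vext) \<Rightarrow> 'a \<Rightarrow>
   'g divhull \<Rightarrow> ('a \<Rightarrow> 'g vext) \<Rightarrow> bool" where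
  "gauss_extension K k v x \<gamma> w \<longleftrightarrow>
     valuation K w \<and>
     (\<forall>u\<in>k. w u = v u) \<and>
     (\<forall>n. \<forall>c \<in> {..n} \<rightarrow> k.
        vhull (w (\<Oplus>\<^bsub>K\<^esub>i\<in>{..n}. c i \<otimes>\<^bsub>K\<^esub> x [^]\<^bsub>K\<^esub> i)) =
        (MIN i\<in>{..n}. vhull (v (c i)) + Fin (nmul i \<gamma>)))"


section \<open>Ruled extensions\<close>

text \<open>Being purely transcendental is spelled out for transcendence degree one only, the case in
  which ruledness is defined.\<close>

definition ruled :: "('a, 'm) ring_scheme \<Rightarrow> 'a set \<Rightarrow> bool" where
  "ruled F k \<longleftrightarrow>
     (\<exists>L t. subfield L F \<and> k \<subseteq> L \<and> ring.finite_dimension F k L \<and>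
        t \<in> carrier F \<and> ring.transcendental F L t \<and>
        generate_field F (insert t L) = carrier F)"

end

theory Submission
  imports
    Defs
    "HOL-Computational_Algebra.Polynomial_Factorial"
    "HOL-Computational_Algebra.Nth_Powers"
    "HOL-Computational_Algebra.Field_as_Ring"
begin

text \<open>
  Write \<open>g = w x\<close>, \<open>h = w y\<close> and let \<open>H\<close> be the value group of \<open>k\<close>. The hypothesis on
  \<open>v (b / a)\<close> says that in \<open>a x\<^sup>p + b x + c\<close> the middle term has larger value than the other two,
  which have equal value. So with \<open>s = a x\<^sup>p / c\<close>, an element of value \<open>0\<close>, the quotient \<open>y\<^sup>p / c\<close> has the
  residue \<open>1 + \<xi>\<close>, where \<open>\<xi>\<close> is the residue of \<open>s\<close>; it is transcendental over \<open>kv\<close> because \<open>w\<close> is a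
  Gauss extension. In particular \<open>p g\<close> and \<open>p h\<close> lie in \<open>H\<close>, and as \<open>p\<close> is prime there are only five
  possible positions of \<open>g\<close> and \<open>h\<close> relative to \<open>H\<close> (lemma \<open>value_cases\<close>). In three of them one of the
  conditions (i), (ii) fails and \<open>Kw\<close> is ruled; in the other two both hold and \<open>Kw\<close> is not ruled.

  Ruled cases. Either no \<open>j h\<close> with \<open>0 < j < p\<close> lies in \<open>H + \<int> g\<close>, or \<open>g \<notin> H\<close> and one of \<open>h\<close>, \<open>h - g\<close> lies in \<open>H\<close>.
  In the first case \<open>K\<close> is generated by \<open>y\<close> over \<open>k(x)\<close>. In the others it is generated by \<open>x\<close> over \<open>k(y)\<close>
  or \<open>k(y/x)\<close>, and a multiple \<open>\<tau>\<close> of \<open>y\<close> or of \<open>y/x\<close> by a constant has value \<open>0\<close> and a residue that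
  is transcendental, because \<open>\<xi>\<close> is a rational function of its \<open>p\<close>-th power. Each time the extension has
  degree at most \<open>p\<close> and its generator has a value of order \<open>p\<close> modulo the values of the base field. Monomials
  in the generator of different degrees below \<open>p\<close> then have different values, so that the residue field
  does not grow (\<open>ramified_extension_residue\<close>). The residue field of the base is generated over
  \<open>kv\<close> by one transcendental element (\<open>residue_subfield_transcendental\<close>); if the base is \<open>k(x)\<close> with \<open>g \<notin> H\<close>, this
  holds because \<open>k(x)\<close> is itself ramified in the same way over \<open>k(x\<^sup>p)\<close>.

  Non-ruled cases. Either \<open>g\<close> and \<open>h\<close> both lie in \<open>H\<close>, or \<open>g \<notin> H\<close> and \<open>h - m g \<in> H\<close> with \<open>2 \<le> m < p\<close>. With \<open>m = 0\<close> in
  the former case, a suitable \<open>z = y / (e x\<^sup>m)\<close>, \<open>e \<in> k\<close>, has a residue \<open>\<zeta>\<close> with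
  \<open>\<zeta>\<^sup>p \<xi>\<^sup>m = \<kappa> (1 + \<xi>)\<close> (\<open>residue_curve\<close>). Suppose that \<open>Kw = L(t)\<close> with \<open>L\<close> finite over \<open>kv\<close>. Write
  \<open>\<xi> = P / Q\<close> with coprime polynomials \<open>P\<close>, \<open>Q\<close> in \<open>t\<close>. If \<open>m \<ge> 2\<close>, unique factorization makes \<open>P\<close>, \<open>Q\<close> and
  \<open>P + Q\<close> constants times \<open>p\<close>-th powers, because \<open>p\<close> divides neither \<open>m\<close> nor \<open>m - 1\<close>. If \<open>m = 0\<close>,
  the same holds as both \<open>\<xi>\<close> and \<open>1 + \<xi>\<close> are constants times \<open>p\<close>-th powers. Both times there is a linear relation
  with nonzero coefficients between the \<open>p\<close>-th powers of three pairwise coprime polynomials, and these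
  are constant as \<open>p \<ge> 3\<close> is not the characteristic (\<open>fermat_poly_constant\<close>). Hence \<open>\<xi>\<close> lies in \<open>L\<close> and
  is algebraic over \<open>kv\<close>, a contradiction.
\<close>

section \<open>Fermat's equation for polynomials\<close>

text \<open>Differentiating the equation and eliminating the term with \<open>H\<close> leaves a proportionality between
  the Wronskians of the pairs \<open>(F, H)\<close> and \<open>(G, H)\<close>. The invertibility of \<open>n\<close> keeps the derivative
  of the equation from being vacuous.\<close>

lemma fermat_wronskian:
  fixes F G H :: "'a::field poly"
  assumes eq: "smult a (F ^ n) + smult b (G ^ n) + smult c (H ^ n) = 0"
    and n: "n = Suc m" and nz: "of_nat n \<noteq> (0::'a)"
  shows "smult a (F ^ m) * (pderiv F * H - F * pderiv H) =
         smult b (G ^ m) * (G * pderiv H - pderiv G * H)"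
proof -
  have pd: "pderiv (smult s (P ^ n)) = smult (of_nat n) (smult s (P ^ m) * pderiv P)" for s and P :: "'a poly"
    unfolding n pderiv_smult pderiv_power_Suc by (simp add: mult.commute del: of_nat_Suc)
  have "pderiv (smult a (F ^ n) + smult b (G ^ n) + smult c (H ^ n)) = 0"
    using eq by simp
  then have "smult (of_nat n) (smult a (F ^ m) * pderiv F + smult b (G ^ m) * pderiv G
      + smult c (H ^ m) * pderiv H) = 0"
    unfolding pderiv_add pd by (simp only: smult_add_right)
  then have d: "smult a (F ^ m) * pderiv F + smult b (G ^ m) * pderiv G
      + smult c (H ^ m) * pderiv H = 0"
    using nz by (simp only: smult_eq_0_iff) simp
  have "smult a (F ^ m) * (pderiv F * H - F * pderiv H) -
         smult b (G ^ m) * (G * pderiv H - pderiv G * H)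
     = H * (smult a (F ^ m) * pderiv F + smult b (G ^ m) * pderiv G + smult c (H ^ m) * pderiv H)
      - pderiv H * (smult a (F ^ n) + smult b (G ^ n) + smult c (H ^ n))"
    unfolding n by (simp add: algebra_simps)
  then show ?thesis unfolding d eq by simp
qed

lemma degree_pderiv_le: "degree (pderiv P) \<le> degree P - 1"
  by (rule degree_le) (auto simp: coeff_pderiv coeff_eq_0)

lemma degree_wronskian_less:
  fixes F G :: "'a::idom poly"
  assumes "pderiv F * G - F * pderiv G \<noteq> 0"
  shows "Suc (degree (pderiv F * G - F * pderiv G)) \<le> degree F + degree G"
proof -
  have *: "degree (pderiv P * Q) < degree P + degree Q" if "pderiv P * Q \<noteq> 0" for P Q :: "'a poly"
  proof -
    have "degree P \<noteq> 0"
      using that by (metis degree_eq_zeroE mult_zero_left pderiv_singleton)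
    then have "degree (pderiv P) < degree P"
      by (meson degree_pderiv_le diff_less le_less_trans not_gr_zero zero_less_one)
    with degree_mult_le[of "pderiv P" Q] show ?thesis by linarith
  qed
  have FG: "degree (pderiv F * G) < degree F + degree G" if "pderiv F * G \<noteq> 0"
    using *[of F G] that by simp
  have GF: "degree (F * pderiv G) < degree F + degree G" if "F * pderiv G \<noteq> 0"
    using *[of G F] that by (simp add: mult.commute add.commute)
  show ?thesis
  proof (cases "pderiv F * G = 0 \<or> F * pderiv G = 0")
    case True
    then show ?thesis using assms FG GF by (auto simp: Suc_le_eq)
  next
    case False
    with FG GF have "degree (pderiv F * G - F * pderiv G) < degree F + degree G"
      by (intro degree_diff_less) auto
    then show ?thesis by (simp add: Suc_le_eq)
  qed
qed

lemma pderiv_eq_0_if_dvd_pderiv: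
  fixes F :: "'a::idom poly"
  assumes "F dvd pderiv F"
  shows "pderiv F = 0"
proof (rule ccontr)
  assume nz: "pderiv F \<noteq> 0"
  then have "degree F \<le> degree (pderiv F)"
    using assms by (intro dvd_imp_degree_le)
  also have "\<dots> \<le> degree F - 1" by (rule degree_pderiv_le)
  finally have "degree F = 0" by simp
  with nz show False by (auto elim!: degree_eq_zeroE)
qed

text \<open>If \<open>F' G = F G'\<close> with coprime \<open>F\<close> and \<open>G\<close>, then \<open>F\<close> divides \<open>F'\<close>, whose degree is smaller unless
  \<open>F' = 0\<close>; likewise for \<open>G\<close>.\<close>

lemma pderiv_eq_0_if_wronskian_eq_0:
  fixes F G :: "'a::field_gcd poly"
  assumes "coprime F G" "pderiv F * G - F * pderiv G = 0"
  shows "pderiv F = 0" "pderiv G = 0"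
proof -
  have eq: "pderiv F * G = F * pderiv G" using assms(2) by simp
  have "F dvd pderiv F"
    using assms(1) eq by (metis coprime_dvd_mult_left_iff dvd_triv_left)
  moreover have "G dvd pderiv G"
    using assms(1) eq by (metis coprime_commute coprime_dvd_mult_right_iff dvd_triv_right)
  ultimately show "pderiv F = 0" "pderiv G = 0"
    by (auto intro: pderiv_eq_0_if_dvd_pderiv)
qed

text \<open>By \<open>fermat_wronskian\<close> the power \<open>F\<^sup>m\<close> divides \<open>G\<^sup>m\<close> times the Wronskian of \<open>G\<close> and \<open>H\<close>, hence the
  Wronskian itself, whose degree is less than \<open>deg G + deg H\<close>.\<close>

lemma degree_le_wronskian:
  fixes F G H :: "'a::field_gcd poly"
  assumes eq: "smult a (F ^ Suc m) + smult b (G ^ Suc m) + smult c (H ^ Suc m) = 0"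
    and nz: "of_nat (Suc m) \<noteq> (0::'a)" and "a \<noteq> 0" "b \<noteq> 0"
    and cop: "coprime F G" and W: "pderiv G * H - G * pderiv H \<noteq> 0"
  shows "m * degree F < degree G + degree H"
proof -
  let ?W = "pderiv G * H - G * pderiv H"
  have "smult a (F ^ m) * (pderiv F * H - F * pderiv H) = - (smult b (G ^ m) * ?W)"
    using fermat_wronskian[OF eq refl nz] by (simp add: algebra_simps)
  then have "F ^ m dvd smult b (G ^ m) * ?W"
    using \<open>a \<noteq> 0\<close> by (metis dvd_minus_iff dvd_mult2 dvd_smult dvd_refl)
  then have "F ^ m dvd G ^ m * ?W"
    using \<open>b \<noteq> 0\<close> by (simp add: dvd_smult_iff)
  then have "F ^ m dvd ?W"
    using cop by (metis coprime_dvd_mult_right_iff coprime_power_left_iff coprime_power_right_iff)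
  then have "degree (F ^ m) \<le> degree ?W"
    using W by (rule dvd_imp_degree_le)
  moreover have "degree (F ^ m) = m * degree F"
  proof (cases "F = 0")
    case False then show ?thesis by (simp add: degree_power_eq)
  qed (cases m; simp)
  ultimately show ?thesis
    using degree_wronskian_less[OF W] by linarith
qed

text \<open>If no Wronskian vanishes, adding the three bounds of \<open>degree_le_wronskian\<close> gives
  \<open>(n - 1) s < 2 s\<close> for the sum \<open>s\<close> of the degrees, which is impossible for \<open>n \<ge> 3\<close>. So one Wronskian
  vanishes; this kills two derivatives, and the equation the third.\<close>

lemma pderiv_eq_0_if_fermat:
  fixes F G H :: "'a::field_gcd poly"
  assumes eq: "smult a (F ^ n) + smult b (G ^ n) + smult c (H ^ n) = 0"
    and nz: "of_nat n \<noteq> (0::'a)" "a \<noteq> 0" "b \<noteq> 0" "c \<noteq> 0"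
    and cop: "coprime F G" "coprime G H" "coprime H F" and n: "n \<ge> 3"
  shows "pderiv F = 0 \<and> pderiv G = 0 \<and> pderiv H = 0"
proof -
  obtain m where m: "n = Suc m" "m \<ge> 2" using n by (cases n) auto
  have eqs: "smult b (G ^ Suc m) + smult c (H ^ Suc m) + smult a (F ^ Suc m) = 0"
     "smult c (H ^ Suc m) + smult a (F ^ Suc m) + smult b (G ^ Suc m) = 0"
     "smult a (F ^ Suc m) + smult b (G ^ Suc m) + smult c (H ^ Suc m) = 0"
    using eq m(1) by (simp_all add: ac_simps)
  note nz' = nz(1)[unfolded m(1)]
  let ?WFG = "pderiv F * G - F * pderiv G" and ?WGH = "pderiv G * H - G * pderiv H"
    and ?WHF = "pderiv H * F - H * pderiv F"
  have pd0: "pderiv P = 0" if "pderiv (smult s (P ^ n)) = 0" "s \<noteq> 0" for P :: "'a poly" and s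
    using that nz(1) m by (auto simp: pderiv_smult pderiv_power_Suc simp del: of_nat_Suc power_Suc)
  have sum: "pderiv (smult a (F ^ n)) + pderiv (smult b (G ^ n)) + pderiv (smult c (H ^ n)) = 0"
    using arg_cong[OF eq, of pderiv] by (simp only: pderiv_add pderiv_0)
  have pw0: "pderiv (smult s (P ^ n)) = 0" if "pderiv P = 0" for P :: "'a poly" and s
    using that m by (simp add: pderiv_smult pderiv_power_Suc del: power_Suc)
  consider "?WFG = 0" | "?WGH = 0" | "?WHF = 0"
  proof (rule ccontr)
    assume "\<not> thesis"
    with that have W: "?WFG \<noteq> 0" "?WGH \<noteq> 0" "?WHF \<noteq> 0" by auto
    have "m * degree F < degree G + degree H"
      using degree_le_wronskian[OF eqs(3) nz' nz(2,3) cop(1) W(2)] .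
    moreover have "m * degree G < degree H + degree F"
      using degree_le_wronskian[OF eqs(1) nz' nz(3,4) cop(2) W(3)] .
    moreover have "m * degree H < degree F + degree G"
      using degree_le_wronskian[OF eqs(2) nz' nz(4,2) cop(3) W(1)] .
    moreover have "2 * degree F \<le> m * degree F" "2 * degree G \<le> m * degree G"
        "2 * degree H \<le> m * degree H"
      using m(2) by simp_all
    ultimately show False by linarith
  qed
  then show ?thesis
  proof cases
    case 1
    from pderiv_eq_0_if_wronskian_eq_0[OF cop(1) this] have "pderiv F = 0" "pderiv G = 0" .
    with pw0[of F a] pw0[of G b] sum pd0[of c H] nz show ?thesis by simp
  next
    case 2
    from pderiv_eq_0_if_wronskian_eq_0[OF cop(2) this] have "pderiv G = 0" "pderiv H = 0" .
    with pw0[of H c] pw0[of G b] sum pd0[of a F] nz show ?thesis by simp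
  next
    case 3
    from pderiv_eq_0_if_wronskian_eq_0[OF cop(3) this] have "pderiv H = 0" "pderiv F = 0" .
    with pw0[of F a] pw0[of H c] sum pd0[of b G] nz show ?thesis by simp
  qed
qed

lemma coeff_pcompose_monom:
  fixes P :: "'a::comm_ring_1 poly"
  assumes "q > 0"
  shows "poly.coeff (pcompose P (Polynomial.monom 1 q)) i = (if q dvd i then poly.coeff P (i div q) else 0)"
proof (induction P arbitrary: i)
  case 0
  show ?case by simp
next
  case (pCons a P)
  have m: "poly.coeff (Polynomial.monom 1 q * R) i = (if q \<le> i then poly.coeff R (i - q) else 0)" for R :: "'a poly" and i
    by (simp add: coeff_monom_mult)
  show ?case
  proof (cases "i = 0")
    case True
    then show ?thesis using assms by (simp add: pcompose_pCons m)
  next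
    case False
    have "q dvd i - q \<longleftrightarrow> q dvd i" if "q \<le> i"
      using that by (simp add: dvd_minus_self)
    moreover have "i div q = Suc ((i - q) div q)" if "q \<le> i"
      using that assms by (simp add: le_div_geq)
    moreover have "\<not> q dvd i" if "\<not> q \<le> i"
      using that False by (auto dest: dvd_imp_le)
    ultimately show ?thesis using assms False pCons.IH
      by (auto simp: pcompose_pCons m coeff_pCons split: nat.splits)
  qed
qed

lemma pderiv_eq_0_imp_pcompose_monom:
  fixes P :: "'a::idom poly"
  assumes "pderiv P = 0" and q: "CHAR('a) = q" "q > 0"
  obtains P' where "P = pcompose P' (Polynomial.monom 1 q)"
proof
  let ?P' = "Abs_poly (\<lambda>i. poly.coeff P (q * i))"
  have fin: "\<forall>\<^sub>\<infinity>i. poly.coeff P (q * i) = 0"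
    unfolding MOST_nat
  proof (intro exI[of _ "degree P"] allI impI)
    fix i assume "degree P < i"
    also have "i \<le> q * i" using q(2) by simp
    finally show "poly.coeff P (q * i) = 0" by (rule coeff_eq_0)
  qed
  have c: "poly.coeff ?P' i = poly.coeff P (q * i)" for i
    using Abs_poly_inverse[of "\<lambda>i. poly.coeff P (q * i)"] fin by simp
  show "P = pcompose ?P' (Polynomial.monom 1 q)"
  proof (rule poly_eqI)
    fix i
    have "poly.coeff P i = 0" if "\<not> q dvd i"
    proof -
      from that obtain j where j: "i = Suc j" by (cases i) auto
      have "of_nat (Suc j) * poly.coeff P (Suc j) = 0"
        using arg_cong[OF assms(1), of "\<lambda>R. poly.coeff R j"] by (simp add: coeff_pderiv)
      then show ?thesis
        using that q(1) j of_nat_eq_0_iff_char_dvd[of "Suc j", where ?'a = 'a] by (simp del: of_nat_Suc)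
    qed
    then show "poly.coeff P i = poly.coeff (pcompose ?P' (Polynomial.monom 1 q)) i"
      by (auto simp: coeff_pcompose_monom[OF q(2)] c)
  qed
qed

lemma pcompose_power: "pcompose (P ^ n) Q = pcompose P Q ^ n" for P Q :: "'a::comm_ring_1 poly"
  by (induction n) (simp_all add: pcompose_mult pcompose_1)

lemma coprime_of_coprime_pcompose:
  fixes P Q R :: "'a::field_gcd poly"
  assumes "coprime (pcompose P R) (pcompose Q R)" "degree R > 0"
  shows "coprime P Q"
proof (rule coprimeI)
  fix d assume "d dvd P" "d dvd Q"
  then have "pcompose d R dvd pcompose P R" "pcompose d R dvd pcompose Q R"
    by (auto simp: dvd_def pcompose_mult)
  with assms(1) have u: "is_unit (pcompose d R)" by (rule coprime_common_divisor)
  then have "degree d * degree R = 0" by (metis is_unit_iff_degree degree_pcompose not_is_unit_0)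
  with assms(2) have "degree d = 0" by simp
  moreover have "d \<noteq> 0" using u by auto
  ultimately show "is_unit d" by (simp add: is_unit_iff_degree)
qed

text \<open>In characteristic \<open>0\<close> vanishing derivatives mean constant polynomials. In characteristic \<open>q > 0\<close> they
  mean polynomials in \<open>t\<^sup>q\<close>; replacing \<open>t\<^sup>q\<close> by \<open>t\<close> leaves the coefficients of the equation
  unchanged and lowers the degrees, so that infinite descent applies over every field.\<close>

theorem fermat_poly_constant:
  fixes F G H :: "'a::field_gcd poly"
  assumes "smult a (F ^ n) + smult b (G ^ n) + smult c (H ^ n) = 0"
    and nz: "of_nat n \<noteq> (0::'a)" "a \<noteq> 0" "b \<noteq> 0" "c \<noteq> 0"
    and "coprime F G" "coprime G H" "coprime H F" and n: "n \<ge> 3"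
  shows "degree F = 0 \<and> degree G = 0 \<and> degree H = 0"
  using assms(1,6-8)
proof (induction "degree F + degree G + degree H" arbitrary: F G H rule: less_induct)
  case less
  note d = pderiv_eq_0_if_fermat[OF less.prems(1) nz less.prems(2-4) n]
  show ?case
  proof (cases "CHAR('a) = 0")
    case True
    have "degree P = 0" if "pderiv P = 0" for P :: "'a poly"
    proof (rule ccontr)
      assume "degree P \<noteq> 0"
      then obtain j where j: "degree P = Suc j" by (cases "degree P") auto
      have "of_nat (Suc j) * poly.coeff P (Suc j) = 0"
        using arg_cong[OF that, of "\<lambda>R. poly.coeff R j"] by (simp add: coeff_pderiv)
      then show False
        using j True of_nat_eq_0_iff_char_dvd[of "Suc j", where ?'a = 'a]
        by (simp del: of_nat_Suc) (metis coeff_0 degree_0 leading_coeff_0_iff nat.distinct(1))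
    qed
    with d show ?thesis by blast
  next
    case False
    define q where "q = CHAR('a)"
    have q: "CHAR('a) = q" "q > 0" "Factorial_Ring.prime q"
      using False prime_CHAR_semidom[where ?'a = 'a] by (auto simp: q_def)
    let ?X = "Polynomial.monom (1::'a) q"
    have dX: "degree ?X = q" by (simp add: degree_monom_eq)
    obtain F' G' H' where FGH: "F = pcompose F' ?X" "G = pcompose G' ?X" "H = pcompose H' ?X"
      using d q pderiv_eq_0_imp_pcompose_monom by metis
    have deg: "degree F = degree F' * q" "degree G = degree G' * q" "degree H = degree H' * q"
      by (simp_all add: FGH degree_pcompose dX)
    have "pcompose (smult a (F' ^ n) + smult b (G' ^ n) + smult c (H' ^ n)) ?X = 0"
      using less.prems(1) by (simp add: FGH pcompose_add pcompose_smult pcompose_power)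
    then have eq: "smult a (F' ^ n) + smult b (G' ^ n) + smult c (H' ^ n) = 0"
      by (rule pcompose_eq_0) (simp add: dX q)
    have cop: "coprime F' G'" "coprime G' H'" "coprime H' F'"
      using less.prems(2-4) q unfolding FGH
      by (auto intro!: coprime_of_coprime_pcompose[of _ ?X] simp: degree_monom_eq)
    show ?thesis
    proof (rule ccontr)
      assume "\<not> ?thesis"
      then have pos: "degree F' + degree G' + degree H' > 0" by (auto simp: deg)
      have "degree F + degree G + degree H = (degree F' + degree G' + degree H') * q"
        by (simp add: deg algebra_simps)
      also have "\<dots> > (degree F' + degree G' + degree H') * 1"
        using pos prime_gt_1_nat[OF q(3)] by (intro mult_strict_left_mono) auto
      finally have "degree F' + degree G' + degree H' < degree F + degree G + degree H" by simp
      from less.hyps[OF this eq cop] pos show False by simp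
    qed
  qed
qed

text \<open>This says that the curve \<open>Z\<^sup>n = \<alpha> U\<^sup>n + \<beta>\<close> has only constant solutions in rational functions, written with a
  common denominator \<open>H\<close>. Dividing by the greatest common divisor of \<open>G\<close> and \<open>H\<close>, which also divides \<open>F\<close>,
  makes the three polynomials pairwise coprime.\<close>

lemma fermat_poly_proportional:
  fixes F G H :: "'a::field_gcd poly"
  assumes eq: "F ^ n = smult \<alpha> (G ^ n) + smult \<beta> (H ^ n)"
    and nz: "of_nat n \<noteq> (0::'a)" "\<alpha> \<noteq> 0" "\<beta> \<noteq> 0" and n: "n \<ge> 3" and "H \<noteq> 0"
  obtains s where "G = smult s H"
proof -
  define d where "d = gcd G H"
  have "d \<noteq> 0" using \<open>H \<noteq> 0\<close> by (simp add: d_def)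
  obtain G' H' where GH: "G = G' * d" "H = H' * d" and cop: "coprime G' H'"
    using gcd_coprime_exists[of G H] \<open>d \<noteq> 0\<close> unfolding d_def by blast
  have "d ^ n dvd F ^ n"
    unfolding eq GH power_mult_distrib by (intro dvd_add dvd_smult) auto
  then have "d dvd F" using n by (subst (asm) pow_divides_pow_iff) auto
  then obtain F' where F: "F = F' * d" by (metis dvdE mult.commute)
  have "(smult (- 1) (F' ^ n) + smult \<alpha> (G' ^ n) + smult \<beta> (H' ^ n)) * d ^ n = 0"
    using eq unfolding F GH by (simp add: algebra_simps)
  then have eq': "smult (- 1) (F' ^ n) + smult \<alpha> (G' ^ n) + smult \<beta> (H' ^ n) = 0"
    using \<open>d \<noteq> 0\<close> by (metis mult_eq_0_iff power_eq_0_iff)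
  then have eqF: "F' ^ n = smult \<alpha> (G' ^ n) + smult \<beta> (H' ^ n)" by (simp add: algebra_simps)
  have np: "n > 0" using n by simp
  have "coprime (smult \<alpha> (G' ^ n) + smult \<beta> (H' ^ n)) (G' ^ n)"
  proof (rule coprimeI)
    fix e assume e: "e dvd smult \<alpha> (G' ^ n) + smult \<beta> (H' ^ n)" "e dvd G' ^ n"
    then have "e dvd smult \<beta> (H' ^ n)" using dvd_add_right_iff[OF dvd_smult[OF e(2)]] by blast
    then have "e dvd H' ^ n" using nz(3) by (simp add: dvd_smult_iff)
    with e(2) cop show "is_unit e" by (meson coprime_common_divisor coprime_power_left_iff coprime_power_right_iff)
  qed
  then have c1: "coprime F' G'" using np by (simp flip: eqF)
  have "coprime (smult \<alpha> (G' ^ n) + smult \<beta> (H' ^ n)) (H' ^ n)"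
  proof (rule coprimeI)
    fix e assume e: "e dvd smult \<alpha> (G' ^ n) + smult \<beta> (H' ^ n)" "e dvd H' ^ n"
    then have "e dvd smult \<alpha> (G' ^ n)" using dvd_add_left_iff[OF dvd_smult[OF e(2)]] by blast
    then have "e dvd G' ^ n" using nz(2) by (simp add: dvd_smult_iff)
    with e(2) cop show "is_unit e" by (meson coprime_common_divisor coprime_power_left_iff coprime_power_right_iff)
  qed
  then have c2: "coprime H' F'" using np by (simp add: coprime_commute flip: eqF)
  have "degree F' = 0 \<and> degree G' = 0 \<and> degree H' = 0"
    using fermat_poly_constant[OF eq' nz(1) _ nz(2,3) c1 cop c2 n] by simp
  then obtain g h where gh: "G' = [:g:]" "H' = [:h:]" by (meson degree_eq_zeroE)
  with \<open>H \<noteq> 0\<close> GH have "h \<noteq> 0" by auto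
  then have "G = smult (g / h) H" unfolding GH gh by simp
  with that show thesis .
qed

lemma poly_eq_const_times_nth_power:
  fixes R :: "'a::field_gcd poly"
  assumes "R \<noteq> 0" "n > 0" "\<And>\<pi>. Factorial_Ring.prime \<pi> \<Longrightarrow> n dvd multiplicity \<pi> R"
  obtains s Q where "s \<noteq> 0" "R = smult s (Q ^ n)"
proof -
  have "is_nth_power n (normalize R)"
    using assms is_nth_power_conv_multiplicity[of n R] by simp
  then obtain Q where "normalize R = Q ^ n" by (auto elim: is_nth_powerE)
  moreover have "R = unit_factor R * normalize R" by simp
  moreover have "is_unit (unit_factor R)" using assms(1) by simp
  then obtain s where "unit_factor R = [:s:]" "s \<noteq> 0" by (metis is_unit_poly_iff not_is_unit_0)
  ultimately show thesis using that[of s Q] by simp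
qed

text \<open>The equation is \<open>Z\<^sup>p U\<^sup>m = \<alpha> (1 + U)\<close> for \<open>Z = A / B\<close> and \<open>U = G / H\<close> with the denominators cleared. Comparing
  multiplicities at a prime dividing one of the pairwise coprime \<open>G\<close>, \<open>H\<close>, \<open>G + H\<close>, the multiplicity
  times \<open>m\<close>, \<open>m - 1\<close> or \<open>1\<close>, respectively, is divisible by \<open>p\<close>, and so is the multiplicity itself. So
  \<open>G\<close>, \<open>H\<close> and their sum are constant multiples of \<open>p\<close>-th powers, and Fermat's equation applies. For \<open>m = 1\<close> the argument
  breaks down at \<open>H\<close>, and that curve is rational indeed.\<close>

lemma superelliptic_poly_constant:
  fixes G H A B :: "'a::field_gcd poly"
  assumes eq: "A ^ p * G ^ m = smult \<alpha> (B ^ p * (G + H) * H ^ (m - 1))"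
    and cop: "coprime G H" and B: "B \<noteq> 0" and H: "H \<noteq> 0" and \<alpha>: "\<alpha> \<noteq> 0"
    and p: "Factorial_Ring.prime p" "odd p" "of_nat p \<noteq> (0::'a)" and m: "2 \<le> m" "m < p"
  shows "degree G = 0 \<and> degree H = 0"
proof (cases "G = 0 \<or> G + H = 0")
  case True
  then have "is_unit H"
  proof
    assume "G + H = 0"
    then have "G = - H" by (simp add: eq_neg_iff_add_eq_0)
    with cop show ?thesis by simp
  qed (use cop in simp)
  with True show ?thesis
    by (metis add_eq_0_iff2 degree_minus degree_0 is_unit_iff_degree H)
next
  case False
  then have nz: "G \<noteq> 0" "G + H \<noteq> 0" by auto
  from eq nz B H \<alpha> have A: "A \<noteq> 0" using m p by (auto simp: power_0_left)
  have copG: "coprime G (G + H)" and copH: "coprime H (G + H)"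
    using cop by (auto intro!: coprimeI dest: coprime_common_divisor simp: dvd_add_right_iff dvd_add_left_iff)
  have cpm: "coprime p m" "coprime p (m - 1)"
    using p(1) m by (auto intro!: prime_imp_coprime dest!: dvd_imp_le)
  have mult: "p * multiplicity \<pi> A + m * multiplicity \<pi> G =
      p * multiplicity \<pi> B + multiplicity \<pi> (G + H) + (m - 1) * multiplicity \<pi> H"
    if "Factorial_Ring.prime \<pi>" for \<pi>
  proof -
    have pe: "prime_elem \<pi>" using that by simp
    have "multiplicity \<pi> (A ^ p * G ^ m) = multiplicity \<pi> (smult \<alpha> (B ^ p * (G + H) * H ^ (m - 1)))"
      using eq by simp
    also have "smult \<alpha> (B ^ p * (G + H) * H ^ (m - 1)) = [:\<alpha>:] * (B ^ p * (G + H) * H ^ (m - 1))" by simp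
    also have "multiplicity \<pi> \<dots> = multiplicity \<pi> (B ^ p * (G + H) * H ^ (m - 1))"
      using \<alpha> by (intro multiplicity_times_unit_right) (simp add: is_unit_iff_degree)
    finally show ?thesis
      using nz A B H by (simp add: prime_elem_multiplicity_mult_distrib[OF pe]
          prime_elem_multiplicity_power_distrib[OF pe])
  qed
  have disj: "multiplicity \<pi> P = 0 \<or> multiplicity \<pi> Q = 0"
    if "Factorial_Ring.prime \<pi>" "coprime P Q" for \<pi> P Q :: "'a poly"
    using that by (metis coprime_common_divisor not_dvd_imp_multiplicity_0 not_prime_unit)
  have "p dvd multiplicity \<pi> G \<and> p dvd multiplicity \<pi> H \<and> p dvd multiplicity \<pi> (G + H)"
    if \<pi>: "Factorial_Ring.prime \<pi>" for \<pi>
  proof -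
    note M = mult[OF \<pi>]
    note D = disj[OF \<pi> cop] disj[OF \<pi> copG] disj[OF \<pi> copH]
    show ?thesis
    proof (cases "multiplicity \<pi> G = 0")
      case False
      with D M have "p * multiplicity \<pi> A + m * multiplicity \<pi> G = p * multiplicity \<pi> B" by auto
      then have "p dvd m * multiplicity \<pi> G" by (metis dvd_add_right_iff dvd_triv_left)
      with cpm have "p dvd multiplicity \<pi> G" by (simp add: coprime_dvd_mult_right_iff)
      with False D show ?thesis by auto
    next
      case G: True
      show ?thesis
      proof (cases "multiplicity \<pi> H = 0")
        case False
        with D M G have "p * multiplicity \<pi> A = p * multiplicity \<pi> B + (m - 1) * multiplicity \<pi> H" by auto
        then have "p dvd (m - 1) * multiplicity \<pi> H" by (metis dvd_add_right_iff dvd_triv_left)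
        with cpm have "p dvd multiplicity \<pi> H" by (simp add: coprime_dvd_mult_right_iff)
        with False D G show ?thesis by auto
      next
        case True
        with M G have "p * multiplicity \<pi> A = p * multiplicity \<pi> B + multiplicity \<pi> (G + H)" by auto
        then have "p dvd multiplicity \<pi> (G + H)" by (metis dvd_add_right_iff dvd_triv_left)
        with G True show ?thesis by auto
      qed
    qed
  qed
  note dvds = this
  have p0: "p > 0" using p(1) prime_gt_0_nat by blast
  obtain r G' where G': "r \<noteq> 0" "G = smult r (G' ^ p)"
    using poly_eq_const_times_nth_power[OF nz(1) p0] dvds by metis
  obtain s H' where H': "s \<noteq> 0" "H = smult s (H' ^ p)"
    using poly_eq_const_times_nth_power[OF H p0] dvds by metis
  obtain t F' where F': "t \<noteq> 0" "G + H = smult t (F' ^ p)"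
    using poly_eq_const_times_nth_power[OF nz(2) p0] dvds by metis
  have eq': "smult (- t) (F' ^ p) + smult r (G' ^ p) + smult s (H' ^ p) = 0"
    using F'(2) unfolding G'(2) H'(2) by (simp add: diff_add_eq)
  have base: "coprime P Q" if "coprime (smult e (P ^ p)) (smult f (Q ^ p))" for e f and P Q :: "'a poly"
  proof (rule coprimeI)
    fix d assume "d dvd P" "d dvd Q"
    with p0 have "d dvd smult e (P ^ p)" "d dvd smult f (Q ^ p)"
      by (auto intro!: dvd_smult intro: dvd_trans dvd_power)
    with that show "is_unit d" by (rule coprime_common_divisor)
  qed
  have cop': "coprime F' G'" "coprime G' H'" "coprime H' F'"
    using base[of t F' r G', folded F'(2) G'(2)] base[of r G' s H', folded G'(2) H'(2)]
      base[of s H' t F', folded H'(2) F'(2)] cop copG copH by (simp_all only: coprime_commute)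
  have "p \<ge> 3" using p m by auto
  from fermat_poly_constant[OF eq' p(3) _ G'(1) H'(1) cop' this] F'(1)
  have "degree G' = 0" "degree H' = 0" by auto
  then show ?thesis unfolding G'(2) H'(2) using G'(1) H'(1)
    by (metis degree_smult_eq degree_power_le mult_zero_left le_zero_eq)
qed

section \<open>Curves without a rational parametrization\<close>

text \<open>The fractions of elements of a subring are closed under all field operations.\<close>

lemma (in field) generate_field_fraction:
  assumes S: "subring S R" and f: "f \<in> generate_field R S"
  obtains g h where "g \<in> S" "h \<in> S" "h \<noteq> \<zero>" "f \<otimes> h = g"
proof -
  note S' = subringE[OF S]
  have Sc: "s \<in> carrier R" if "s \<in> S" for s using S'(1) that by blast
  have gc: "h \<in> carrier R" if "h \<in> generate_field R S" for h
    using generate_field_in_carrier[OF S'(1) that] .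
  from f have "\<exists>g\<in>S. \<exists>h\<in>S. h \<noteq> \<zero> \<and> f \<otimes> h = g"
  proof (induction rule: generate_field.induct)
    case one
    show ?case using S'(3) by (intro bexI[of _ \<one>]) auto
  next
    case (incl h)
    then show ?case using S'(3) Sc by (intro bexI[of _ h] bexI[of _ \<one>]) auto
  next
    case (a_inv f)
    then obtain g h where gh: "g \<in> S" "h \<in> S" "h \<noteq> \<zero>" "f \<otimes> h = g" by blast
    then have "(\<ominus> f) \<otimes> h = \<ominus> g" using gc[OF a_inv(1)] Sc by (simp add: l_minus)
    with gh show ?case using S'(5) by blast
  next
    case (m_inv f)
    then obtain g h where gh: "g \<in> S" "h \<in> S" "h \<noteq> \<zero>" "f \<otimes> h = g" by blast
    have u: "f \<in> Units R" using gc[OF m_inv(1)] m_inv(2) field_Units by blast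
    have "inv f \<otimes> g = h"
      using u Sc[OF gh(2)] gc[OF m_inv(1)] unfolding gh(4)[symmetric] by (simp add: m_assoc[symmetric])
    moreover have "g \<noteq> \<zero>"
      using gh gc[OF m_inv(1)] m_inv(2) Sc[OF gh(2)] by (auto simp: integral_iff)
    ultimately show ?case using gh by blast
  next
    case (eng_add f f')
    then obtain g h g' h' where gh: "g \<in> S" "h \<in> S" "h \<noteq> \<zero>" "f \<otimes> h = g"
      "g' \<in> S" "h' \<in> S" "h' \<noteq> \<zero>" "f' \<otimes> h' = g'" by blast
    have "(f \<oplus> f') \<otimes> (h \<otimes> h') = g \<otimes> h' \<oplus> g' \<otimes> h"
      using gc[OF eng_add(1)] gc[OF eng_add(2)] Sc[OF gh(2)] Sc[OF gh(6)]
      by (simp add: l_distr r_distr m_ac flip: gh(4,8))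
    moreover have "g \<otimes> h' \<oplus> g' \<otimes> h \<in> S" "h \<otimes> h' \<in> S" "h \<otimes> h' \<noteq> \<zero>"
      using gh S'(6,7) Sc by (auto simp: integral_iff)
    ultimately show ?case by blast
  next
    case (eng_mult f f')
    then obtain g h g' h' where gh: "g \<in> S" "h \<in> S" "h \<noteq> \<zero>" "f \<otimes> h = g"
      "g' \<in> S" "h' \<in> S" "h' \<noteq> \<zero>" "f' \<otimes> h' = g'" by blast
    have "(f \<otimes> f') \<otimes> (h \<otimes> h') = g \<otimes> g'"
      using gc[OF eng_mult(1)] gc[OF eng_mult(2)] Sc[OF gh(2)] Sc[OF gh(6)]
      by (simp add: m_ac flip: gh(4,8))
    moreover have "g \<otimes> g' \<in> S" "h \<otimes> h' \<in> S" "h \<otimes> h' \<noteq> \<zero>"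
      using gh S'(6,7) Sc by (auto simp: integral_iff)
    ultimately show ?case by blast
  qed
  with that show thesis by blast
qed

text \<open>The two families of curves that occur as residue curves have no points over \<open>F = L(t)\<close> with \<open>u\<close> outside \<open>L\<close>.
  The predicate depends on the pair \<open>(F, L)\<close> only, so that it can be used to select such a pair.\<close>

definition no_parametrization :: "('a, 'm) ring_scheme \<Rightarrow> 'a set \<Rightarrow> bool" where
  "no_parametrization F L \<longleftrightarrow>
     (\<forall>t (p::nat) \<alpha> \<beta> z u. t \<in> carrier F \<longrightarrow> ring.transcendental F L t \<longrightarrow>
        generate_field F (insert t L) = carrier F \<longrightarrow>
        Factorial_Ring.prime p \<longrightarrow> odd p \<longrightarrow> [p] \<cdot>\<^bsub>F\<^esub> \<one>\<^bsub>F\<^esub> \<noteq> \<zero>\<^bsub>F\<^esub> \<longrightarrow>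
        \<alpha> \<in> L - {\<zero>\<^bsub>F\<^esub>} \<longrightarrow> \<beta> \<in> L - {\<zero>\<^bsub>F\<^esub>} \<longrightarrow> z \<in> carrier F \<longrightarrow> u \<in> carrier F \<longrightarrow>
        (z [^]\<^bsub>F\<^esub> p = \<alpha> \<otimes>\<^bsub>F\<^esub> u [^]\<^bsub>F\<^esub> p \<oplus>\<^bsub>F\<^esub> \<beta> \<longrightarrow> u \<in> L) \<and>
        (\<forall>m::nat. 2 \<le> m \<longrightarrow> m < p \<longrightarrow>
          z [^]\<^bsub>F\<^esub> p \<otimes>\<^bsub>F\<^esub> u [^]\<^bsub>F\<^esub> m = \<alpha> \<otimes>\<^bsub>F\<^esub> (\<one>\<^bsub>F\<^esub> \<oplus>\<^bsub>F\<^esub> u) \<longrightarrow> u \<in> L))"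

text \<open>Every type of the form \<open>'a set\<close> has at least the two elements needed for a field.\<close>

definition two_element_field :: "'a set ring" where
  "two_element_field = \<lparr>carrier = {{}, UNIV}, monoid.mult = (\<inter>), one = UNIV, ring.zero = {}, add = (\<lambda>A B. (A - B) \<union> (B - A))\<rparr>"

lemma two_element_field: "field (two_element_field :: 'a set ring)"
proof -
  let ?F = "two_element_field :: 'a set ring"
  have "cring ?F"
    by (rule cringI[OF abelian_groupI comm_monoidI]) (auto simp: two_element_field_def)
  moreover have "Units ?F = carrier ?F - {\<zero>\<^bsub>?F\<^esub>}"
    by (auto simp: Units_def two_element_field_def)
  ultimately show ?thesis by (rule cring.cring_fieldI)
qed

text \<open>Polynomials with their arithmetic live on types of class \<open>field\<close>, whereas residue fields are records. To
  bridge the gap, a pair \<open>(F, L)\<close> is chosen that violates \<open>no_parametrization\<close> if any pair does. The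
  carrier \<open>L\<close> of this one pair becomes a type of class \<open>field\<close>, the claim is shown for it with the
  polynomials over that type, and then it holds for all pairs.\<close>

definition sample :: "'a set ring \<times> 'a set set" where
  "sample = (SOME (F, L). field F \<and> subfield L F \<and>
     (no_parametrization F L \<longrightarrow> (\<forall>F L. field (F :: 'a set ring) \<longrightarrow> subfield L F \<longrightarrow> no_parametrization F L)))"

lemma sample_props:
  "field (fst (sample :: 'a set ring \<times> 'a set set))" (is ?A)
  "subfield (snd (sample :: 'a set ring \<times> 'a set set)) (fst sample)" (is ?B)
  "no_parametrization (fst (sample :: 'a set ring \<times> 'a set set)) (snd sample) \<Longrightarrow>
    field (F :: 'a set ring) \<Longrightarrow> subfield L F \<Longrightarrow> no_parametrization F L" (is "PROP ?C")
proof -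
  let ?all = "\<forall>F L. field (F :: 'a set ring) \<longrightarrow> subfield L F \<longrightarrow> no_parametrization F L"
  have "\<exists>s. case s of (F :: 'a set ring, L) \<Rightarrow>
     field F \<and> subfield L F \<and> (no_parametrization F L \<longrightarrow> ?all)"
  proof (cases ?all)
    case True
    have "subfield (carrier two_element_field) (two_element_field :: 'a set ring)"
      using field.carrier_is_subfield[OF two_element_field] .
    with True two_element_field show ?thesis by blast
  next
    case False
    then show ?thesis by auto
  qed
  from someI_ex[OF this, folded sample_def]
  have *: "?A \<and> ?B \<and> (no_parametrization (fst (sample :: 'a set ring \<times> 'a set set)) (snd sample) \<longrightarrow> ?all)"
    by (simp add: case_prod_beta)
  then show ?A ?B by auto
  from * show "PROP ?C" by blast
qed

typedef 'a scalar = "snd (sample :: 'a set ring \<times> 'a set set)"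
  morphisms of_scalar Scalar
proof -
  have "\<one>\<^bsub>fst (sample :: 'a set ring \<times> 'a set set)\<^esub> \<in> snd sample"
    using subringE(3)[OF subfieldE(1)[OF sample_props(2)]] .
  then show ?thesis by blast
qed

abbreviation sample_field :: "'a set ring" where "sample_field \<equiv> fst sample"

instantiation scalar :: (type) field
begin

definition "0 = Scalar \<zero>\<^bsub>sample_field\<^esub>"
definition "1 = Scalar \<one>\<^bsub>sample_field\<^esub>"
definition "r + s = Scalar (of_scalar r \<oplus>\<^bsub>sample_field\<^esub> of_scalar s)"
definition "r * s = Scalar (of_scalar r \<otimes>\<^bsub>sample_field\<^esub> of_scalar s)"
definition "- r = Scalar (\<ominus>\<^bsub>sample_field\<^esub> of_scalar r)"
definition "r - s = r + - (s :: 'a scalar)"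
definition "inverse r = (if r = 0 then 0 else Scalar (inv\<^bsub>sample_field\<^esub> of_scalar r))"
definition "r div s = r * inverse (s :: 'a scalar)"

instance
proof
  let ?F = "sample_field :: 'a set ring"
  interpret F: field ?F by (rule sample_props)
  have L: "subring (snd sample) ?F" using subfieldE(1)[OF sample_props(2)] .
  note Lc = subringE(2,3,5,6,7)[OF L]
  note of = of_scalar[where 'a = 'a]
  have car: "of_scalar r \<in> carrier ?F" for r :: "'a scalar"
    using of subringE(1)[OF L] by blast
  have o0: "of_scalar (0 :: 'a scalar) = \<zero>\<^bsub>?F\<^esub>"
    and o1: "of_scalar (1 :: 'a scalar) = \<one>\<^bsub>?F\<^esub>"
    and oa: "of_scalar (r + s) = of_scalar r \<oplus>\<^bsub>?F\<^esub> of_scalar s"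
    and om: "of_scalar (r * s) = of_scalar r \<otimes>\<^bsub>?F\<^esub> of_scalar s"
    and on: "of_scalar (- r) = \<ominus>\<^bsub>?F\<^esub> of_scalar r" for r s :: "'a scalar"
    using Lc of by (simp_all add: zero_scalar_def one_scalar_def plus_scalar_def times_scalar_def
      uminus_scalar_def Scalar_inverse)
  have inj: "r = s \<longleftrightarrow> of_scalar r = of_scalar s" for r s :: "'a scalar"
    by (simp add: of_scalar_inject)
  have inv: "of_scalar (inverse r) = inv\<^bsub>?F\<^esub> of_scalar r" if "r \<noteq> 0" for r :: "'a scalar"
    using that F.subfield_m_inv(1)[OF sample_props(2), of "of_scalar r"] of[of r]
    by (simp add: inverse_scalar_def Scalar_inverse inj o0)
  fix r s t :: "'a scalar"
  show "r + s + t = r + (s + t)" "r + s = s + r" "0 + r = r" "- r + r = 0"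
     "r * s * t = r * (s * t)" "r * s = s * r" "1 * r = r" "(r + s) * t = r * t + s * t"
    by (simp_all add: inj o0 o1 oa om on car F.a_ac F.m_ac F.l_distr F.r_distr F.l_neg F.r_neg)
  show "r - s = r + - s" by (rule minus_scalar_def)
  show "r div s = r * inverse s" by (rule divide_scalar_def)
  show "(0 :: 'a scalar) \<noteq> 1" by (simp add: inj o0 o1)
  show "inverse (0 :: 'a scalar) = 0" by (simp add: inverse_scalar_def)
  show "inverse r * r = 1" if "r \<noteq> 0"
    using that F.field_Units car[of r] by (simp add: inj o0 o1 om inv F.Units_l_inv)
qed

end

lemma of_scalar_hom:
  "of_scalar (0 :: 'a scalar) = \<zero>\<^bsub>sample_field\<^esub>"
  "of_scalar (1 :: 'a scalar) = \<one>\<^bsub>sample_field\<^esub>"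
  "of_scalar (r + s :: 'a scalar) = of_scalar r \<oplus>\<^bsub>sample_field\<^esub> of_scalar s"
  "of_scalar (r * s :: 'a scalar) = of_scalar r \<otimes>\<^bsub>sample_field\<^esub> of_scalar s"
proof -
  let ?F = "sample_field :: 'a set ring"
  have L: "subring (snd sample) ?F" using subfieldE(1)[OF sample_props(2)] .
  show "of_scalar (0 :: 'a scalar) = \<zero>\<^bsub>?F\<^esub>" "of_scalar (1 :: 'a scalar) = \<one>\<^bsub>?F\<^esub>"
    "of_scalar (r + s) = of_scalar r \<oplus>\<^bsub>?F\<^esub> of_scalar s"
    "of_scalar (r * s) = of_scalar r \<otimes>\<^bsub>?F\<^esub> of_scalar s"
    using subringE(2,3,5,6,7)[OF L] of_scalar[where 'a = 'a]
    by (simp_all add: zero_scalar_def one_scalar_def plus_scalar_def times_scalar_def Scalar_inverse)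
qed

text \<open>
  As a field is a Euclidean ring in a trivial way, polynomials over \<open>scalar\<close> have greatest common divisors and
  unique factorization.
\<close>

instantiation scalar :: (type)
  "{unique_euclidean_ring, normalization_euclidean_semiring, normalization_semidom_multiplicative}"
begin

definition [simp]: "normalize_scalar = (normalize_field :: 'a scalar \<Rightarrow> _)"
definition [simp]: "unit_factor_scalar = (unit_factor_field :: 'a scalar \<Rightarrow> _)"
definition [simp]: "modulo_scalar = (mod_field :: 'a scalar \<Rightarrow> _)"
definition [simp]: "euclidean_size_scalar = (euclidean_size_field :: 'a scalar \<Rightarrow> _)"
definition [simp]: "division_segment (r :: 'a scalar) = 1"

instance
  by standard (simp_all add: dvd_field_iff field_split_simps split: if_splits)

end

instantiation scalar :: (type) euclidean_ring_gcd
begin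

definition gcd_scalar :: "'a scalar \<Rightarrow> 'a scalar \<Rightarrow> 'a scalar" where
  "gcd_scalar = Euclidean_Algorithm.gcd"
definition lcm_scalar :: "'a scalar \<Rightarrow> 'a scalar \<Rightarrow> 'a scalar" where
  "lcm_scalar = Euclidean_Algorithm.lcm"
definition Gcd_scalar :: "'a scalar set \<Rightarrow> 'a scalar" where
 "Gcd_scalar = Euclidean_Algorithm.Gcd"
definition Lcm_scalar :: "'a scalar set \<Rightarrow> 'a scalar" where
 "Lcm_scalar = Euclidean_Algorithm.Lcm"

instance by standard (simp_all add: gcd_scalar_def lcm_scalar_def Gcd_scalar_def Lcm_scalar_def)

end

instance scalar :: (type) field_gcd ..

text \<open>The value at \<open>t\<close> of a polynomial with coefficients in \<open>L\<close>. It goes through evaluation of coefficient lists (with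
  the leading coefficient in front), in terms of which transcendence is defined.\<close>

definition ev :: "'a set \<Rightarrow> 'a scalar poly \<Rightarrow> 'a set" where
  "ev t q = ring.eval sample_field (map of_scalar (rev (coeffs q))) t"

context
  fixes t :: "'a set"
  assumes t: "t \<in> carrier sample_field"
begin

interpretation F: field "sample_field :: 'a set ring" by (rule sample_props)

lemma of_scalar_closed: "of_scalar r \<in> carrier (sample_field :: 'a set ring)"
  using of_scalar[of r] subringE(1)[OF subfieldE(1)[OF sample_props(2)]] by blast

lemma ev_closed: "ev t q \<in> carrier sample_field"
  unfolding ev_def using t of_scalar_closed by (intro F.eval_in_carrier) auto

lemma ev_0: "ev t 0 = \<zero>\<^bsub>sample_field\<^esub>"
  by (simp add: ev_def)

lemma ev_pCons: "ev t (pCons r q) = ev t q \<otimes>\<^bsub>sample_field\<^esub> t \<oplus>\<^bsub>sample_field\<^esub> of_scalar r"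
proof (cases "r = 0 \<and> q = 0")
  case True
  then show ?thesis using t by (simp add: ev_0 of_scalar_hom)
next
  case False
  then have "coeffs (pCons r q) = r # coeffs q" by (auto simp: cCons_def)
  then show ?thesis unfolding ev_def
    using F.eval_append_aux[of "map of_scalar (rev (coeffs q))" "of_scalar r" t] of_scalar_closed t
    by auto
qed

lemma ev_const: "ev t [:r:] = of_scalar r"
  using t of_scalar_closed by (simp add: ev_pCons ev_0)

lemma ev_1: "ev t 1 = \<one>\<^bsub>sample_field\<^esub>"
  using ev_const[of 1] by (simp add: of_scalar_hom one_pCons)

lemma ev_add: "ev t (q + r) = ev t q \<oplus>\<^bsub>sample_field\<^esub> ev t r"
proof (induction q r rule: poly_induct2)
  case 0
  show ?case by (simp add: ev_0)
next
  case (pCons a p b q)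
  then show ?case using t ev_closed of_scalar_closed
    by (simp add: ev_pCons of_scalar_hom F.l_distr F.a_ac)
qed

lemma ev_smult: "ev t (smult a q) = of_scalar a \<otimes>\<^bsub>sample_field\<^esub> ev t q"
proof (induction q)
  case 0
  show ?case using of_scalar_closed by (simp add: ev_0)
next
  case (pCons b q)
  then show ?case using t ev_closed of_scalar_closed
    by (simp add: ev_pCons of_scalar_hom F.r_distr F.m_ac)
qed

lemma ev_mult: "ev t (q * r) = ev t q \<otimes>\<^bsub>sample_field\<^esub> ev t r"
proof (induction q)
  case 0
  show ?case using ev_closed by (simp add: ev_0)
next
  case (pCons a q)
  then show ?case using t ev_closed of_scalar_closed
    by (simp add: ev_add ev_pCons ev_smult of_scalar_hom F.l_distr F.r_distr F.a_ac F.m_ac)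
qed

lemma ev_power: "ev t (q ^ n) = ev t q [^]\<^bsub>sample_field\<^esub> n"
  by (induction n) (simp_all add: ev_1 ev_mult F.nat_pow_Suc ev_closed F.m_comm)

lemma ev_uminus: "ev t (- q) = \<ominus>\<^bsub>sample_field\<^esub> ev t q"
  using ev_add[of "- q" q] ev_closed by (simp add: ev_0 F.sum_zero_eq_neg)

lemma ev_eq_0:
  assumes "ring.transcendental sample_field (snd sample) t" "ev t q = \<zero>\<^bsub>sample_field\<^esub>"
  shows "q = 0"
proof (rule ccontr)
  assume q: "q \<noteq> 0"
  let ?l = "map of_scalar (rev (coeffs q))"
  have "polynomial\<^bsub>sample_field\<^esub> (snd sample) ?l"
  proof -
    have "hd (rev (coeffs q)) \<noteq> 0"
      using q by (simp add: hd_rev last_coeffs_eq_coeff_degree)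
    then have "hd ?l \<noteq> \<zero>\<^bsub>sample_field\<^esub>"
      using q by (simp add: hd_map of_scalar_inject flip: of_scalar_hom(1))
    then show ?thesis using of_scalar by (auto simp: polynomial_def)
  qed
  then have "?l \<in> carrier ((snd sample)[X]\<^bsub>sample_field\<^esub>)" by (simp add: univ_poly_carrier)
  from F.eval_transcendental[OF _ this] assms have "?l = []" by (simp add: over_def ev_def)
  with q show False by simp
qed

text \<open>The values of polynomials at \<open>t\<close> form a subring that contains \<open>t\<close> and \<open>L\<close>.\<close>

lemma ev_fraction:
  assumes "ring.transcendental sample_field (snd sample) t"
    and "f \<in> generate_field sample_field (insert t (snd sample))"
  shows "\<exists>q r. r \<noteq> 0 \<and> f \<otimes>\<^bsub>sample_field\<^esub> ev t r = ev t q"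
proof -
  have S: "subring (range (ev t)) sample_field"
  proof (rule F.subringI)
    show "range (ev t) \<subseteq> carrier sample_field" using ev_closed by blast
    show "\<one>\<^bsub>sample_field\<^esub> \<in> range (ev t)" using ev_1 by (metis rangeI)
  qed (auto simp flip: ev_uminus ev_mult ev_add)
  have "t = ev t [:0, 1:]"
    using t ev_closed by (simp add: ev_pCons ev_0 of_scalar_hom)
  moreover have "l \<in> range (ev t)" if "l \<in> snd sample" for l
    using ev_const[of "Scalar l"] that by (metis Scalar_inverse rangeI)
  ultimately have "insert t (snd sample) \<subseteq> range (ev t)" by blast
  then have "f \<in> generate_field sample_field (range (ev t))"
    using F.mono_generate_field subringE(1)[OF S] assms(2) by blast
  from F.generate_field_fraction[OF S this] obtain g h where gh: "g \<in> range (ev t)" "h \<in> range (ev t)"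
    "h \<noteq> \<zero>\<^bsub>sample_field\<^esub>" "f \<otimes>\<^bsub>sample_field\<^esub> h = g" .
  then obtain q r where "g = ev t q" "h = ev t r" by blast
  moreover from this gh(3) have "r \<noteq> 0" by (auto simp: ev_0)
  ultimately show ?thesis using gh(4) by blast
qed

end

lemma of_scalar_of_nat: "of_scalar (of_nat n :: 'a scalar) = [n] \<cdot>\<^bsub>sample_field\<^esub> \<one>\<^bsub>sample_field\<^esub>"
proof -
  interpret F: field "sample_field :: 'a set ring" by (rule sample_props)
  show ?thesis by (induction n) (simp_all add: of_scalar_hom F.a_comm F.add.nat_pow_Suc)
qed

lemma no_parametrization_sample:
  "no_parametrization (sample_field :: 'a set ring) (snd sample)"
  unfolding no_parametrization_def
proof (intro allI impI)
  fix t :: "'a set" and p :: nat and \<alpha> \<beta> z u :: "'a set"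
  let ?F = "sample_field :: 'a set ring"
  let ?L = "snd (sample :: 'a set ring \<times> 'a set set)"
  interpret F: field ?F by (rule sample_props)
  assume t: "t \<in> carrier ?F" and tr: "ring.transcendental ?F ?L t"
    and gen: "generate_field ?F (insert t ?L) = carrier ?F"
    and p: "Factorial_Ring.prime p" "odd p" "[p] \<cdot>\<^bsub>?F\<^esub> \<one>\<^bsub>?F\<^esub> \<noteq> \<zero>\<^bsub>?F\<^esub>"
    and \<alpha>: "\<alpha> \<in> ?L - {\<zero>\<^bsub>?F\<^esub>}" and \<beta>: "\<beta> \<in> ?L - {\<zero>\<^bsub>?F\<^esub>}"
    and z: "z \<in> carrier ?F" and u: "u \<in> carrier ?F"
  note evs = ev_closed[OF t] ev_0[OF t] ev_1[OF t] ev_add[OF t] ev_mult[OF t] ev_power[OF t]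
    ev_smult[OF t] ev_const[OF t]
  note ne = ev_eq_0[OF t tr]
  have ev_inj: "q = r" if "ev t q = ev t r" for q r
  proof -
    have "ev t (q - r) \<oplus>\<^bsub>?F\<^esub> ev t r = ev t r"
      using evs(4)[of "q - r" r] that by simp
    then have "q - r = 0" using evs(1) by (intro ne) simp
    then show ?thesis by simp
  qed
  have pnz: "of_nat p \<noteq> (0 :: 'a scalar)"
    using p(3) of_scalar_of_nat[of p, where 'a = 'a] of_scalar_hom(1)[where 'a = 'a] by auto
  have p3: "p \<ge> 3"
  proof -
    have "p \<noteq> 2" using p(2) by auto
    with prime_ge_2_nat[OF p(1)] show ?thesis by linarith
  qed
  define a where "a = Scalar \<alpha>"
  define b where "b = Scalar \<beta>"
  have ab: "of_scalar a = \<alpha>" "of_scalar b = \<beta>"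
    using \<alpha> \<beta> by (simp_all add: a_def b_def Scalar_inverse)
  have ab0: "a \<noteq> 0" "b \<noteq> 0" using \<alpha> \<beta> of_scalar_hom(1)[where 'a = 'a] by (auto simp flip: ab)
  have frac: "\<exists>q r. r \<noteq> 0 \<and> coprime q r \<and> f \<otimes>\<^bsub>?F\<^esub> ev t r = ev t q" if "f \<in> carrier ?F" for f
  proof -
    have "f \<in> generate_field ?F (insert t ?L)" using that gen by simp
    from ev_fraction[OF t tr this]
    obtain q r where qr: "r \<noteq> 0" "f \<otimes>\<^bsub>?F\<^esub> ev t r = ev t q" by (elim exE conjE)
    define d where "d = gcd q r"
    have g0: "d \<noteq> 0" using qr(1) by (simp add: d_def)
    obtain q' r' where q': "q = q' * d" "r = r' * d" "coprime q' r'"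
      using gcd_coprime_exists[OF g0[unfolded d_def]] unfolding d_def by blast
    have "f \<otimes>\<^bsub>?F\<^esub> ev t r' \<otimes>\<^bsub>?F\<^esub> ev t d = f \<otimes>\<^bsub>?F\<^esub> ev t r"
      using that evs(1) by (simp add: q'(2) evs(5) F.m_assoc)
    also have "\<dots> = ev t q' \<otimes>\<^bsub>?F\<^esub> ev t d"
      unfolding qr(2) by (simp add: q'(1) evs(5))
    finally have "f \<otimes>\<^bsub>?F\<^esub> ev t r' \<otimes>\<^bsub>?F\<^esub> ev t d = ev t q' \<otimes>\<^bsub>?F\<^esub> ev t d" .
    moreover have "ev t d \<noteq> \<zero>\<^bsub>?F\<^esub>" using g0 ne by auto
    ultimately have "f \<otimes>\<^bsub>?F\<^esub> ev t r' = ev t q'"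
      using F.m_rcancel[of "ev t d" "f \<otimes>\<^bsub>?F\<^esub> ev t r'" "ev t q'"] that evs(1) by simp
    moreover have "r' \<noteq> 0" using qr(1) q'(2) by auto
    ultimately show ?thesis using q'(3) by blast
  qed
  have const: "f \<in> ?L" if "f \<otimes>\<^bsub>?F\<^esub> ev t r = ev t (smult s r)" "r \<noteq> 0" "f \<in> carrier ?F" for f r s
  proof -
    have "ev t r \<noteq> \<zero>\<^bsub>?F\<^esub>" using ne that(2) by blast
    with that have "f = of_scalar s"
      using F.m_rcancel[of "ev t r" f "of_scalar s"] evs(1) of_scalar_closed[OF t] by (simp add: evs(7))
    then show ?thesis using of_scalar by simp
  qed
  from frac[OF z]
  obtain A B where AB: "B \<noteq> 0" "z \<otimes>\<^bsub>?F\<^esub> ev t B = ev t A" by (elim exE conjE)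
  from frac[OF u]
  obtain G H where GH: "H \<noteq> 0" "coprime G H" "u \<otimes>\<^bsub>?F\<^esub> ev t H = ev t G" by (elim exE conjE)
  show "(z [^]\<^bsub>?F\<^esub> p = \<alpha> \<otimes>\<^bsub>?F\<^esub> u [^]\<^bsub>?F\<^esub> p \<oplus>\<^bsub>?F\<^esub> \<beta> \<longrightarrow> u \<in> ?L) \<and>
        (\<forall>m. 2 \<le> m \<longrightarrow> m < p \<longrightarrow>
          z [^]\<^bsub>?F\<^esub> p \<otimes>\<^bsub>?F\<^esub> u [^]\<^bsub>?F\<^esub> m = \<alpha> \<otimes>\<^bsub>?F\<^esub> (\<one>\<^bsub>?F\<^esub> \<oplus>\<^bsub>?F\<^esub> u) \<longrightarrow> u \<in> ?L)"
  proof (intro conjI allI impI)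
    assume eq: "z [^]\<^bsub>?F\<^esub> p = \<alpha> \<otimes>\<^bsub>?F\<^esub> u [^]\<^bsub>?F\<^esub> p \<oplus>\<^bsub>?F\<^esub> \<beta>"
    \<comment> \<open>Both functions are put over the common denominator \<open>B * H\<close>.\<close>
    have zz: "ev t (A * H) = z \<otimes>\<^bsub>?F\<^esub> ev t (B * H)"
      and uu: "ev t (G * B) = u \<otimes>\<^bsub>?F\<^esub> ev t (B * H)"
      using z u evs(1) by (simp_all add: evs(5) F.m_ac flip: AB(2) GH(3))
    have "ev t ((A * H) ^ p) = ev t (smult a ((G * B) ^ p) + smult b ((B * H) ^ p))"
      unfolding evs(4,6,7) zz uu ab
      using eq z u evs(1) \<alpha> \<beta> of_scalar_closed[OF t, of a] of_scalar_closed[OF t, of b] 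
      by (simp add: ab F.nat_pow_distrib F.l_distr F.m_assoc)
    then have "(A * H) ^ p = smult a ((G * B) ^ p) + smult b ((B * H) ^ p)" by (rule ev_inj)
    then obtain s where "G * B = smult s (B * H)"
      using fermat_poly_proportional[OF _ pnz ab0 p3, of "A * H" "G * B" "B * H"] AB(1) GH(1) by auto
    with uu have "u \<otimes>\<^bsub>?F\<^esub> ev t (B * H) = ev t (smult s (B * H))" by simp
    from const[OF this _ u] AB(1) GH(1) show "u \<in> ?L" by simp
  next
    fix m :: nat assume m: "2 \<le> m" "m < p"
      and eq: "z [^]\<^bsub>?F\<^esub> p \<otimes>\<^bsub>?F\<^esub> u [^]\<^bsub>?F\<^esub> m = \<alpha> \<otimes>\<^bsub>?F\<^esub> (\<one>\<^bsub>?F\<^esub> \<oplus>\<^bsub>?F\<^esub> u)"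
    from m have m1: "m = Suc (m - 1)" by simp
    have GHa: "ev t (G + H) = (\<one>\<^bsub>?F\<^esub> \<oplus>\<^bsub>?F\<^esub> u) \<otimes>\<^bsub>?F\<^esub> ev t H"
      using u evs(1) by (simp add: evs(4) F.l_distr F.a_comm flip: GH(3))
    have "ev t (A ^ p * G ^ m) = z [^]\<^bsub>?F\<^esub> p \<otimes>\<^bsub>?F\<^esub> u [^]\<^bsub>?F\<^esub> m \<otimes>\<^bsub>?F\<^esub> (ev t B [^]\<^bsub>?F\<^esub> p \<otimes>\<^bsub>?F\<^esub> ev t H [^]\<^bsub>?F\<^esub> m)"
      using z u evs(1) by (simp add: evs(5,6) F.nat_pow_distrib F.m_ac flip: AB(2) GH(3))
    also have "ev t H [^]\<^bsub>?F\<^esub> m = ev t H \<otimes>\<^bsub>?F\<^esub> ev t (H ^ (m - 1))"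
      using evs(1) by (subst m1) (simp add: evs(6) F.nat_pow_Suc F.m_comm)
    also have "z [^]\<^bsub>?F\<^esub> p \<otimes>\<^bsub>?F\<^esub> u [^]\<^bsub>?F\<^esub> m \<otimes>\<^bsub>?F\<^esub> (ev t B [^]\<^bsub>?F\<^esub> p \<otimes>\<^bsub>?F\<^esub> (ev t H \<otimes>\<^bsub>?F\<^esub> ev t (H ^ (m - 1))))
        = ev t (smult a (B ^ p * (G + H) * H ^ (m - 1)))"
      unfolding eq evs(5,7) GHa ab
      using u evs(1) of_scalar_closed[OF t, of a] by (simp add: ab evs(6) F.m_ac)
    finally have "A ^ p * G ^ m = smult a (B ^ p * (G + H) * H ^ (m - 1))" by (rule ev_inj)
    from superelliptic_poly_constant[OF this GH(2) AB(1) GH(1) ab0(1) p(1,2) pnz m]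
    obtain g h where gh: "G = [:g:]" "H = [:h:]" by (meson degree_eq_zeroE)
    with GH(1) have "G = smult (g / h) H" by simp
    with GH(3) have "u \<otimes>\<^bsub>?F\<^esub> ev t H = ev t (smult (g / h) H)" by simp
    from const[OF this GH(1) u] show "u \<in> ?L" .
  qed
qed

theorem no_parametrization_subfield:
  "field (F :: 'a set ring) \<Longrightarrow> subfield L F \<Longrightarrow> no_parametrization F L"
  using sample_props(3)[OF no_parametrization_sample] .

section \<open>Valued fields and their residue fields\<close>

instance vext :: (linordered_ab_group_add) ordered_ab_semigroup_add
proof
  fix a b c :: "'a vext"
  assume "a \<le> b"
  then show "c + a \<le> c + b" by (cases a; cases b; cases c) auto
qed

lemma vext_less_simps [simp]:
  "Fin g < Fin h \<longleftrightarrow> g < h" "Fin g < Infty" "\<not> Infty < x"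
  by (auto simp: less_vext_def not_le)

lemma vext_add_less_cancel:
  "x \<noteq> Infty \<Longrightarrow> (y :: 'a::linordered_ab_group_add vext) + x < z + x \<longleftrightarrow> y < z"
  by (cases x; cases y; cases z) auto

lemma vext_add_eq_cancel:
  "x \<noteq> Infty \<Longrightarrow> (y :: 'a::linordered_ab_group_add vext) + x = z + x \<longleftrightarrow> y = z"
  by (cases x; cases y; cases z) auto

locale valued_field = field K for K (structure) +
  fixes w :: "'a \<Rightarrow> 'g::linordered_ab_group_add vext"
  assumes valuation: "valuation K w"
begin

abbreviation valuation_ring ("\<O>") where "\<O> \<equiv> {x \<in> carrier K. 0 \<le> w x}"

abbreviation residue ("\<rho>") where "\<rho> x \<equiv> val_ideal K w +>\<^bsub>val_ring K w\<^esub> x"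

abbreviation Kw where "Kw \<equiv> residue_field K w"

lemma w_eq_Infty_iff: "x \<in> carrier K \<Longrightarrow> w x = Infty \<longleftrightarrow> x = \<zero>"
  and w_mult: "\<lbrakk>x \<in> carrier K; y \<in> carrier K\<rbrakk> \<Longrightarrow> w (x \<otimes> y) = w x + w y"
  and w_add: "\<lbrakk>x \<in> carrier K; y \<in> carrier K\<rbrakk> \<Longrightarrow> min (w x) (w y) \<le> w (x \<oplus> y)"
  using valuation by (auto simp: valuation_def)

lemma w_zero [simp]: "w \<zero> = Infty"
  using w_eq_Infty_iff[of \<zero>] by simp

lemma w_one [simp]: "w \<one> = 0"
proof -
  obtain g where g: "w \<one> = Fin g"
    using w_eq_Infty_iff[of \<one>] by (cases "w \<one>") auto
  have "w \<one> = w \<one> + w \<one>" using w_mult[of \<one> \<one>] by simp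
  then show ?thesis by (simp add: g zero_vext_def)
qed

lemma w_uminus [simp]:
  assumes x: "x \<in> carrier K"
  shows "w (\<ominus> x) = w x"
proof -
  have "w (\<ominus> \<one>) + w (\<ominus> \<one>) = 0"
    using w_mult[of "\<ominus> \<one>" "\<ominus> \<one>"] by (simp add: l_minus r_minus)
  then have "w (\<ominus> \<one>) = 0"
    by (cases "w (\<ominus> \<one>)") (auto simp: zero_vext_def)
  moreover have "\<ominus> x = \<ominus> \<one> \<otimes> x" using x by (simp add: l_minus)
  ultimately show ?thesis using w_mult[of "\<ominus> \<one>" x] x by simp
qed

lemma inv_nz [simp]: "\<lbrakk>x \<in> carrier K; x \<noteq> \<zero>\<rbrakk> \<Longrightarrow> inv x \<in> carrier K"
  "\<lbrakk>x \<in> carrier K; x \<noteq> \<zero>\<rbrakk> \<Longrightarrow> inv x \<otimes> x = \<one>"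
  "\<lbrakk>x \<in> carrier K; x \<noteq> \<zero>\<rbrakk> \<Longrightarrow> x \<otimes> inv x = \<one>"
  "\<lbrakk>x \<in> carrier K; x \<noteq> \<zero>\<rbrakk> \<Longrightarrow> inv x \<noteq> \<zero>"
proof -
  assume "x \<in> carrier K" "x \<noteq> \<zero>"
  then have "x \<in> Units K" using field_Units by blast
  then show "inv x \<in> carrier K" "inv x \<otimes> x = \<one>" "x \<otimes> inv x = \<one>" by simp_all
  with \<open>x \<in> carrier K\<close> show "inv x \<noteq> \<zero>" by auto
qed

lemma mult_inv_cancel [simp]:
  assumes "x \<in> carrier K" "x \<noteq> \<zero>" "z \<in> carrier K"
  shows "z \<otimes> inv x \<otimes> x = z" "z \<otimes> x \<otimes> inv x = z" "x \<otimes> (inv x \<otimes> z) = z" "inv x \<otimes> (x \<otimes> z) = z"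
proof -
  show "z \<otimes> inv x \<otimes> x = z" "z \<otimes> x \<otimes> inv x = z" using assms by (simp_all add: m_assoc)
  show "x \<otimes> (inv x \<otimes> z) = z" "inv x \<otimes> (x \<otimes> z) = z" using assms by (simp_all add: m_assoc[symmetric])
qed

lemma pow_nz [simp]: "\<lbrakk>x \<in> carrier K; x \<noteq> \<zero>\<rbrakk> \<Longrightarrow> x [^] (n::nat) \<noteq> \<zero>"
  by (induction n) (auto simp: integral_iff)

lemma w_mult_less_iff:
  assumes "x \<in> carrier K" "y \<in> carrier K" "z \<in> carrier K" "z \<noteq> \<zero>"
  shows "w (x \<otimes> z) < w (y \<otimes> z) \<longleftrightarrow> w x < w y"
  using assms w_eq_Infty_iff[of z] by (simp add: w_mult vext_add_less_cancel)

lemma w_mult_eq_iff: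
  assumes "x \<in> carrier K" "y \<in> carrier K" "z \<in> carrier K" "z \<noteq> \<zero>"
  shows "w (x \<otimes> z) = w (y \<otimes> z) \<longleftrightarrow> w x = w y"
  using assms w_eq_Infty_iff[of z] by (simp add: w_mult vext_add_eq_cancel)

lemma w_mult_inv:
  assumes "x \<in> carrier K" "y \<in> carrier K" "y \<noteq> \<zero>"
  shows "w (x \<otimes> inv y) = 0 \<longleftrightarrow> w x = w y"
  using w_mult_eq_iff[of "x \<otimes> inv y" \<one> y] assms by simp

lemma w_pow: "\<lbrakk>x \<in> carrier K; w x = Fin g\<rbrakk> \<Longrightarrow> w (x [^] n) = Fin (nmul n g)"
  by (induction n) (auto simp: w_mult zero_vext_def add.commute)

lemma w_pow_zero: "\<lbrakk>x \<in> carrier K; w x = 0\<rbrakk> \<Longrightarrow> w (x [^] (n::nat)) = 0"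
  using w_pow[of x 0 n] by (simp add: zero_vext_def)

lemma w_add_gt:
  "\<lbrakk>x \<in> carrier K; y \<in> carrier K; a < w x; a < w y\<rbrakk> \<Longrightarrow> a < w (x \<oplus> y)"
  using w_add[of x y] by (metis min_less_iff_conj less_le_trans)

lemma w_add_eq:
  assumes "x \<in> carrier K" "y \<in> carrier K" "w x < w y"
  shows "w (x \<oplus> y) = w x"
proof (rule ccontr)
  assume ne: "w (x \<oplus> y) \<noteq> w x"
  have "w x \<le> w (x \<oplus> y)" using w_add[OF assms(1,2)] assms(3) by (simp add: min_absorb1)
  with ne have "w x < w (x \<oplus> y)" by simp
  then have "w x < w ((x \<oplus> y) \<oplus> \<ominus> y)"
    using assms by (intro w_add_gt[of "x \<oplus> y"]) auto
  moreover have "(x \<oplus> y) \<oplus> \<ominus> y = x" using assms(1,2) by algebra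
  ultimately show False by simp
qed

text \<open>The hypothesis means that \<open>y\<close> is a dominant term of \<open>x\<close>; statements of this form replace expansions of \<open>x\<close>.\<close>

lemma w_eq_of_w_diff:
  assumes "x \<in> carrier K" "y \<in> carrier K" "w x < w (x \<ominus> y)"
  shows "w y = w x"
proof -
  have "y = x \<oplus> \<ominus> (x \<ominus> y)" using assms(1,2) by algebra
  moreover have "w (x \<oplus> \<ominus> (x \<ominus> y)) = w x" using assms by (intro w_add_eq) auto
  ultimately show ?thesis by simp
qed

subsection \<open>The residue field\<close>

lemma subring_O: "subring \<O> K"
proof (rule subringI)
  fix x y assume xy: "x \<in> \<O>" "y \<in> \<O>"
  then have "0 \<le> min (w x) (w y)" by simp
  with xy w_add[of x y] have "0 \<le> w (x \<oplus> y)" by (intro order_trans[OF _ w_add]) auto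
  with xy show "x \<oplus> y \<in> \<O>" by auto
  from xy have "0 + 0 \<le> w x + w y" by (intro add_mono) auto
  with xy show "x \<otimes> y \<in> \<O>" by (auto simp: w_mult)
qed auto

lemma val_ring_sel: "carrier (val_ring K w) = \<O>" "\<zero>\<^bsub>val_ring K w\<^esub> = \<zero>" "\<one>\<^bsub>val_ring K w\<^esub> = \<one>"
  "x \<oplus>\<^bsub>val_ring K w\<^esub> y = x \<oplus> y" "x \<otimes>\<^bsub>val_ring K w\<^esub> y = x \<otimes> y"
  by (simp_all add: val_ring_def)

lemma cring_val_ring: "cring (val_ring K w)"
  using subcring_iff[OF subringE(1)[OF subring_O]] subcringI'[OF subring_O] by (simp add: val_ring_def)

lemma ideal_val_ideal: "ideal (val_ideal K w) (val_ring K w)"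
proof -
  interpret R: cring "val_ring K w" by (rule cring_val_ring)
  have um: "\<ominus>\<^bsub>val_ring K w\<^esub> x = \<ominus> x" if "x \<in> \<O>" for x
  proof -
    have "\<ominus> x \<in> \<O>" using that by auto
    then show ?thesis using that R.minus_equality[of "\<ominus> x" x] by (auto simp: val_ring_sel l_neg)
  qed
  show ?thesis
  proof (rule idealI)
    show "ring (val_ring K w)" ..
    show "subgroup (val_ideal K w) (add_monoid (val_ring K w))"
    proof (rule group.subgroupI)
      show "group (add_monoid (val_ring K w))" by (rule R.add.is_group)
      show "val_ideal K w \<noteq> {}" by (auto simp: val_ideal_def intro!: exI[of _ \<zero>] simp: zero_vext_def)
      show "val_ideal K w \<subseteq> carrier (add_monoid (val_ring K w))" by (auto simp: val_ideal_def val_ring_sel)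
      fix x assume x: "x \<in> val_ideal K w"
      then have "inv\<^bsub>add_monoid (val_ring K w)\<^esub> x = \<ominus> x"
        using um[of x] by (auto simp: a_inv_def val_ideal_def)
      with x show "inv\<^bsub>add_monoid (val_ring K w)\<^esub> x \<in> val_ideal K w" by (auto simp: val_ideal_def)
      fix y assume "y \<in> val_ideal K w"
      with x show "x \<otimes>\<^bsub>add_monoid (val_ring K w)\<^esub> y \<in> val_ideal K w"
        by (auto simp: val_ideal_def val_ring_sel intro: w_add_gt)
    qed
    fix x y assume "x \<in> val_ideal K w" "y \<in> carrier (val_ring K w)"
    then have xy: "x \<in> carrier K" "y \<in> carrier K" "0 < w x" "0 \<le> w y"
      by (auto simp: val_ideal_def val_ring_sel)
    then have "0 < w x + w y" by (cases "w x"; cases "w y") (auto simp: zero_vext_def add_pos_nonneg)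
    with xy show "y \<otimes>\<^bsub>val_ring K w\<^esub> x \<in> val_ideal K w" "x \<otimes>\<^bsub>val_ring K w\<^esub> y \<in> val_ideal K w"
      by (auto simp: val_ideal_def val_ring_sel w_mult add.commute)
  qed
qed

sublocale M: ideal "val_ideal K w" "val_ring K w"
  by (rule ideal_val_ideal)

lemma field_Kw: "field Kw"
proof -
  have "maximalideal (val_ideal K w) (val_ring K w)"
  proof (rule maximalidealI[OF ideal_val_ideal])
    have "\<one> \<in> carrier (val_ring K w) - val_ideal K w" by (simp add: val_ring_sel val_ideal_def)
    then show "carrier (val_ring K w) \<noteq> val_ideal K w" by blast
  next
    fix J assume J: "ideal J (val_ring K w)" "val_ideal K w \<subseteq> J" "J \<subseteq> carrier (val_ring K w)"
    interpret J: ideal J "val_ring K w" by (rule J)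
    show "J = val_ideal K w \<or> J = carrier (val_ring K w)"
    proof (cases "J = val_ideal K w")
      case False
      then obtain x where x: "x \<in> J" "x \<notin> val_ideal K w" using J(2) by blast
      with J(3) have x': "x \<in> carrier K" "w x = 0" by (auto simp: val_ring_sel val_ideal_def)
      then have nz: "x \<noteq> \<zero>" by (auto simp: zero_vext_def)
      then have "w (inv x) = 0" using w_mult_inv[of \<one> x] x' by simp
      then have "inv x \<in> carrier (val_ring K w)" using x' nz by (simp add: val_ring_sel)
      from J.I_l_closed[OF x(1) this] have "\<one> \<in> J" using x' nz by (simp add: val_ring_sel)
      then show ?thesis using J.one_imp_carrier by (simp add: val_ring_sel)
    qed simp
  qed
  then show ?thesis unfolding residue_field_def
    by (rule maximalideal.quotient_is_field[OF _ cring_val_ring])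
qed

sublocale Kw: field Kw by (rule field_Kw)

lemma residue_ring_hom: "\<rho> \<in> ring_hom (val_ring K w) Kw"
  unfolding residue_field_def by (rule M.rcos_ring_hom)

lemma residue_closed [simp]: "x \<in> carrier K \<Longrightarrow> 0 \<le> w x \<Longrightarrow> \<rho> x \<in> carrier Kw"
  using ring_hom_memE(1)[OF residue_ring_hom] by (simp add: val_ring_sel)

lemma residue_mult: "\<lbrakk>x \<in> carrier K; 0 \<le> w x; y \<in> carrier K; 0 \<le> w y\<rbrakk> \<Longrightarrow> \<rho> (x \<otimes> y) = \<rho> x \<otimes>\<^bsub>Kw\<^esub> \<rho> y"
  and residue_add: "\<lbrakk>x \<in> carrier K; 0 \<le> w x; y \<in> carrier K; 0 \<le> w y\<rbrakk> \<Longrightarrow> \<rho> (x \<oplus> y) = \<rho> x \<oplus>\<^bsub>Kw\<^esub> \<rho> y"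
  and residue_one [simp]: "\<rho> \<one> = \<one>\<^bsub>Kw\<^esub>"
  using ring_hom_memE(2-4)[OF residue_ring_hom] by (simp_all add: val_ring_sel)

lemma carrier_Kw: "carrier Kw = \<rho> ` \<O>"
proof -
  have "carrier Kw = (\<Union>x\<in>carrier (val_ring K w). {\<rho> x})"
    by (simp add: residue_field_def FactRing_def A_RCOSETS_def')
  then show ?thesis by (simp only: val_ring_sel(1)) blast
qed

lemma residue_eq_zero_iff:
  assumes "x \<in> carrier K" "0 \<le> w x"
  shows "\<rho> x = \<zero>\<^bsub>Kw\<^esub> \<longleftrightarrow> 0 < w x"
proof -
  have "x \<in> carrier (val_ring K w)" using assms by (simp add: val_ring_sel)
  then have "\<rho> x = val_ideal K w \<longleftrightarrow> x \<in> val_ideal K w"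
    using M.a_rcos_const[of x] M.a_rcos_self[of x] by metis
  with assms(1) show ?thesis by (simp add: residue_field_def FactRing_def val_ideal_def)
qed

lemma residue_eq_zero: "x \<in> carrier K \<Longrightarrow> 0 < w x \<Longrightarrow> \<rho> x = \<zero>\<^bsub>Kw\<^esub>"
  using residue_eq_zero_iff by simp

lemma residue_nz: "x \<in> carrier K \<Longrightarrow> w x = 0 \<Longrightarrow> \<rho> x \<noteq> \<zero>\<^bsub>Kw\<^esub>"
  using residue_eq_zero_iff by simp

lemma residue_uminus: "x \<in> carrier K \<Longrightarrow> 0 \<le> w x \<Longrightarrow> \<rho> (\<ominus> x) = \<ominus>\<^bsub>Kw\<^esub> \<rho> x"
  using residue_add[of "\<ominus> x" x] residue_eq_zero[of \<zero>]
  by (simp add: l_neg Kw.sum_zero_eq_neg zero_vext_def)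

lemma residue_pow: "x \<in> carrier K \<Longrightarrow> w x = 0 \<Longrightarrow> \<rho> (x [^] (n::nat)) = \<rho> x [^]\<^bsub>Kw\<^esub> n"
  by (induction n) (simp_all add: residue_mult w_pow_zero)

lemma residue_inv: 
  assumes "x \<in> carrier K" "w x = 0" shows "\<rho> (inv x) = inv\<^bsub>Kw\<^esub> (\<rho> x)"
proof -
  have nz: "x \<noteq> \<zero>" using assms by (auto simp: zero_vext_def)
  have "w (inv x) = 0" using w_mult_inv[of \<one> x] assms nz by simp
  then have "\<rho> x \<otimes>\<^bsub>Kw\<^esub> \<rho> (inv x) = \<one>\<^bsub>Kw\<^esub>" using residue_mult[of x "inv x"] assms nz by simp
  then show ?thesis using assms nz \<open>w (inv x) = 0\<close>
    by (intro Kw.comm_inv_char[symmetric]) auto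
qed

lemma residue_cong:
  assumes "x \<in> carrier K" "y \<in> carrier K" "0 \<le> w x" "0 < w (x \<ominus> y)"
  shows "0 \<le> w y" "\<rho> y = \<rho> x"
proof -
  have y: "y = x \<oplus> \<ominus> (x \<ominus> y)" using assms(1,2) by algebra
  have d: "\<ominus> (x \<ominus> y) \<in> carrier K" "0 < w (\<ominus> (x \<ominus> y))" using assms by auto
  have "0 \<le> min (w x) (w (\<ominus> (x \<ominus> y)))" using assms d by simp
  from order_trans[OF this w_add[OF assms(1) d(1)]] show "0 \<le> w y" by (simp flip: y)
  show "\<rho> y = \<rho> x"
    using residue_add[OF assms(1,3) d(1)] residue_eq_zero[OF d] y assms(1,3) d by simp
qed

lemma mem_residue_subfield_iff: "\<xi> \<in> residue_subfield K w E \<longleftrightarrow> (\<exists>x\<in>E. 0 \<le> w x \<and> \<xi> = \<rho> x)"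
  by (auto simp: residue_subfield_def)

lemma residue_subfield_carrier: "residue_subfield K w (carrier K) = carrier Kw"
  by (auto simp: carrier_Kw mem_residue_subfield_iff)

lemma subfield_residue_subfield:
  assumes "subfield E K"
  shows "subfield (residue_subfield K w E) Kw"
proof -
  note E = subringE[OF subfieldE(1)[OF assms]]
  have Ec: "x \<in> carrier K" if "x \<in> E" for x using E(1) that by blast
  show ?thesis
  proof (rule Kw.subfieldI'[OF Kw.subringI])
    show "residue_subfield K w E \<subseteq> carrier Kw"
      by (auto simp: mem_residue_subfield_iff Ec)
    show "\<one>\<^bsub>Kw\<^esub> \<in> residue_subfield K w E"
      using E(3) by (auto simp: mem_residue_subfield_iff intro!: bexI[of _ \<one>])
    fix \<xi> assume "\<xi> \<in> residue_subfield K w E"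
    then obtain x where x: "x \<in> E" "0 \<le> w x" "\<xi> = \<rho> x" by (auto simp: mem_residue_subfield_iff)
    then show "\<ominus>\<^bsub>Kw\<^esub> \<xi> \<in> residue_subfield K w E"
      using E(5)[of x] Ec[of x] residue_uminus[of x]
      by (auto simp: mem_residue_subfield_iff intro!: bexI[of _ "\<ominus> x"])
    fix \<eta> assume "\<eta> \<in> residue_subfield K w E"
    then obtain y where y: "y \<in> E" "0 \<le> w y" "\<eta> = \<rho> y" by (auto simp: mem_residue_subfield_iff)
    from x y show "\<xi> \<otimes>\<^bsub>Kw\<^esub> \<eta> \<in> residue_subfield K w E"
      using E(6)[of x y] Ec subringE(6)[OF subring_O, of x y] residue_mult[of x y]
      by (auto simp: mem_residue_subfield_iff intro!: bexI[of _ "x \<otimes> y"])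
    from x y show "\<xi> \<oplus>\<^bsub>Kw\<^esub> \<eta> \<in> residue_subfield K w E"
      using E(7)[of x y] Ec subringE(7)[OF subring_O, of x y] residue_add[of x y]
      by (auto simp: mem_residue_subfield_iff intro!: bexI[of _ "x \<oplus> y"])
  next
    fix \<xi> assume "\<xi> \<in> residue_subfield K w E - {\<zero>\<^bsub>Kw\<^esub>}"
    then obtain x where x: "x \<in> E" "0 \<le> w x" "\<xi> = \<rho> x" "\<rho> x \<noteq> \<zero>\<^bsub>Kw\<^esub>" by (auto simp: mem_residue_subfield_iff)
    with residue_eq_zero[OF Ec[OF x(1)]] have w0: "w x = 0" by fastforce
    then have nz: "x \<noteq> \<zero>" by (auto simp: zero_vext_def)
    have "w (inv x) = 0" using w_mult_inv[of \<one> x] w0 nz Ec[OF x(1)] by simp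
    moreover have "inv x \<in> E" using subfield_m_inv(1)[OF assms, of x] x nz by simp
    ultimately show "inv\<^bsub>Kw\<^esub> \<xi> \<in> residue_subfield K w E"
      using residue_inv[OF Ec[OF x(1)] w0] x(3)
      by (auto simp: mem_residue_subfield_iff intro!: bexI[of _ "inv x"])
  qed
qed

end

section \<open>Residually transcendental extensions\<close>

lemma (in ring) eval_in_subring:
  assumes "subring S R" "set q \<subseteq> S" "x \<in> S"
  shows "eval q x \<in> S"
  using ring.eval_in_carrier[OF subring_is_ring[OF assms(1)], of q x] assms by simp

context valued_field
begin

lemma residue_eval:
  assumes "set q \<subseteq> \<O>" "x \<in> carrier K" "w x = 0"
  shows "0 \<le> w (eval q x) \<and> \<rho> (eval q x) = Kw.eval (map \<rho> q) (\<rho> x)"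
  using assms(1)
proof (induction q)
  case Nil
  show ?case using residue_eq_zero[of \<zero>] by (simp add: zero_vext_def)
next
  case (Cons a q)
  then have a: "a \<in> carrier K" "0 \<le> w a" and q: "eval q x \<in> carrier K" "0 \<le> w (eval q x)"
    using assms(2) by (auto intro!: eval_in_carrier)
  have xn: "x [^] n \<in> carrier K" "w (x [^] n) = 0" for n :: nat
    using assms(2,3) by (auto simp: w_pow_zero)
  have ax: "a \<otimes> x [^] length q \<in> carrier K" "0 \<le> w (a \<otimes> x [^] length q)"
    using a xn by (auto simp: w_mult)
  have "0 \<le> w (a \<otimes> x [^] length q \<oplus> eval q x)"
    using subringE(7)[OF subring_O, of "a \<otimes> x [^] length q" "eval q x"] ax q by auto
  moreover have "\<rho> (a \<otimes> x [^] length q \<oplus> eval q x) = \<rho> a \<otimes>\<^bsub>Kw\<^esub> \<rho> x [^]\<^bsub>Kw\<^esub> length q \<oplus>\<^bsub>Kw\<^esub> \<rho> (eval q x)"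
    using residue_add[OF ax q] residue_mult[OF a xn(1)[of "length q"]] xn assms(2,3)
    by (simp add: residue_pow)
  ultimately show ?case using Cons by simp
qed

lemma eval_scale:
  assumes "set q \<subseteq> carrier K" "x \<in> carrier K" "d \<in> carrier K"
  shows "eval (map (\<lambda>a. a \<otimes> d) q) x = eval q x \<otimes> d"
  using assms(1)
proof (induction q)
  case (Cons a q)
  then show ?case using assms(2,3) by (simp add: eval_in_carrier l_distr r_distr m_ac)
qed (use assms in simp)

text \<open>Dividing the polynomial by a coefficient \<open>d\<close> of minimal value makes its coefficients integral and one of them
  \<open>1\<close>. The reduced polynomial is then nonzero and does not vanish at the residue of \<open>\<tau>\<close>.\<close>

lemma transcendental_residue_eval:
  assumes E: "subfield E K" and \<tau>: "\<tau> \<in> carrier K" "w \<tau> = 0"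
    and tr: "Kw.transcendental (residue_subfield K w E) (\<rho> \<tau>)"
    and q: "set q \<subseteq> E" "\<not> set q \<subseteq> {\<zero>}"
  shows "\<exists>d\<in>E - {\<zero>}. w (eval q \<tau>) = w d \<and>
     \<rho> (eval q \<tau> \<otimes> inv d) \<in> generate_field Kw (insert (\<rho> \<tau>) (residue_subfield K w E))"
proof -
  let ?L = "residue_subfield K w E" and ?G = "generate_field Kw (insert (\<rho> \<tau>) (residue_subfield K w E))"
  have L: "subfield ?L Kw" using subfield_residue_subfield[OF E] .
  have Ec: "E \<subseteq> carrier K" using subringE(1)[OF subfieldE(1)[OF E]] .
  have "finite (w ` set q)" "w ` set q \<noteq> {}" using q(2) by auto
  then obtain d where d: "d \<in> set q" "\<forall>a\<in>set q. w d \<le> w a"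
    using Min_in[of "w ` set q"] Min_le[of "w ` set q"] by fastforce
  obtain a where a: "a \<in> set q" "a \<noteq> \<zero>" using q(2) by blast
  have dc: "d \<in> carrier K" "d \<in> E" using d(1) q(1) Ec by auto
  have d0: "d \<noteq> \<zero>"
  proof
    assume "d = \<zero>"
    then have "Infty \<le> w a" using d(2) a(1) by auto
    then have "w a = Infty" by (cases "w a") auto
    then show False using a q(1) Ec w_eq_Infty_iff by blast
  qed
  have invd: "inv d \<in> E" using subfield_m_inv(1)[OF E, of d] dc d0 by simp
  let ?q = "map (\<lambda>a. a \<otimes> inv d) q"
  have qE: "set ?q \<subseteq> E" using q(1) invd subringE(6)[OF subfieldE(1)[OF E]] by auto
  have "0 \<le> w (a \<otimes> inv d)" if "a \<in> set q" for a
  proof -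
    have ac: "a \<in> carrier K" using that q(1) Ec by auto
    have "\<not> w (a \<otimes> inv d) < w \<one>"
    proof
      assume "w (a \<otimes> inv d) < w \<one>"
      then have "w (a \<otimes> inv d \<otimes> d) < w (\<one> \<otimes> d)"
        using w_mult_less_iff[of "a \<otimes> inv d" \<one> d] dc d0 ac by simp
      then show False using d(2) that ac dc d0 by (simp add: not_le[symmetric])
    qed
    then show ?thesis by simp
  qed
  then have qO: "set ?q \<subseteq> \<O>" using q(1) Ec dc d0 by auto
  have ev: "eval ?q \<tau> = eval q \<tau> \<otimes> inv d"
    using q(1) Ec dc d0 \<tau> by (intro eval_scale) auto
  have evc: "eval q \<tau> \<in> carrier K" using q(1) Ec \<tau>(1) by (intro eval_in_carrier) auto
  note re = residue_eval[OF qO \<tau>]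
  have set\<rho>: "set (map \<rho> ?q) \<subseteq> ?L"
    using qE qO by (fastforce simp: mem_residue_subfield_iff)
  have sub: "insert (\<rho> \<tau>) ?L \<subseteq> carrier Kw"
    using subringE(1)[OF subfieldE(1)[OF L]] \<tau> by simp
  have G: "subfield ?G Kw" by (rule Kw.generate_field_is_subfield[OF sub])
  have "Kw.eval (map \<rho> ?q) (\<rho> \<tau>) \<in> ?G"
    using set\<rho> by (intro Kw.eval_in_subring[OF subfieldE(1)[OF G]]) (auto intro: generate_field.incl)
  with re ev have inG: "\<rho> (eval q \<tau> \<otimes> inv d) \<in> ?G" by simp
  have one: "\<one>\<^bsub>Kw\<^esub> \<in> set (map \<rho> ?q)"
    using d(1) dc d0 by (auto intro!: image_eqI[of _ \<rho> \<one>] image_eqI[of _ _ d])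
  have "Kw.normalize l \<noteq> []" if "\<one>\<^bsub>Kw\<^esub> \<in> set l" for l
    using that by (induction l) auto
  with one have "Kw.normalize (map \<rho> ?q) \<noteq> []" by blast
  moreover have "Kw.normalize (map \<rho> ?q) \<in> carrier (?L[X]\<^bsub>Kw\<^esub>)"
    using Kw.normalize_gives_polynomial[OF set\<rho>] by (simp add: univ_poly_carrier)
  ultimately have "Kw.eval (Kw.normalize (map \<rho> ?q)) (\<rho> \<tau>) \<noteq> \<zero>\<^bsub>Kw\<^esub>"
    using Kw.eval_transcendental[of ?L "\<rho> \<tau>"] tr by (auto simp: over_def)
  then have nz: "Kw.eval (map \<rho> ?q) (\<rho> \<tau>) \<noteq> \<zero>\<^bsub>Kw\<^esub>"
    using set\<rho> sub by (subst (asm) Kw.eval_normalize) auto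
  then have "\<not> 0 < w (eval ?q \<tau>)" "0 \<le> w (eval ?q \<tau>)"
    using re residue_eq_zero[of "eval ?q \<tau>"] evc ev dc d0 by auto
  then have "w (eval q \<tau> \<otimes> inv d) = 0" using ev by simp
  then have "w (eval q \<tau>) = w d" using w_mult_inv[OF evc dc(1) d0] by simp
  with inG dc d0 show ?thesis by blast
qed

lemma generate_field_insert_simple_extension:
  assumes E: "subfield E K" and r: "r \<in> carrier K"
  shows "generate_field K (simple_extension E r) = generate_field K (insert r E)"
proof -
  have S: "subring (simple_extension E r) K"
    using simple_extension_is_subring[OF subfieldE(1)[OF E] r] .
  have Ec: "E \<subseteq> carrier K" using subringE(1)[OF subfieldE(1)[OF E]] .
  have sub: "insert r E \<subseteq> simple_extension E r"
    using simple_extension_mem[OF subfieldE(1)[OF E] r] simple_extension_incl[OF Ec r] by blast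
  have insc: "insert r E \<subseteq> carrier K" using Ec r by simp
  have "simple_extension E r \<subseteq> generate_field K (insert r E)"
    using simple_extension_subring_incl[OF subfieldE(1)[OF generate_field_is_subfield[OF insc]], of E r]
    by (auto intro: generate_field.incl)
  then show ?thesis
    using mono_generate_field[OF sub subringE(1)[OF S]]
      generate_field_min_subfield1[OF subringE(1)[OF S] generate_field_is_subfield[OF insc]] by blast
qed

text \<open>A nonzero element of \<open>E(\<tau>)\<close> is a quotient of two elements of \<open>E[\<tau>]\<close>; the constants \<open>d\<close> and the residues that
  \<open>transcendental_residue_eval\<close> assigns to them are divided accordingly.\<close>

lemma transcendental_residue_field:
  assumes E: "subfield E K" and \<tau>: "\<tau> \<in> carrier K" "w \<tau> = 0"
    and tr: "Kw.transcendental (residue_subfield K w E) (\<rho> \<tau>)"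
    and f: "f \<in> generate_field K (insert \<tau> E)" "f \<noteq> \<zero>"
  shows "\<exists>d\<in>E - {\<zero>}. w f = w d \<and>
     \<rho> (f \<otimes> inv d) \<in> generate_field Kw (insert (\<rho> \<tau>) (residue_subfield K w E))"
proof -
  let ?L = "residue_subfield K w E" and ?G = "generate_field Kw (insert (\<rho> \<tau>) (residue_subfield K w E))"
  have Ec: "E \<subseteq> carrier K" using subringE(1)[OF subfieldE(1)[OF E]] .
  have fc: "f \<in> carrier K" using generate_field_in_carrier[of "insert \<tau> E"] f(1) Ec \<tau>(1) by blast
  have S: "subring (simple_extension E \<tau>) K"
    using simple_extension_is_subring[OF subfieldE(1)[OF E] \<tau>(1)] .
  have "insert (\<rho> \<tau>) ?L \<subseteq> carrier Kw"
    using subringE(1)[OF subfieldE(1)[OF subfield_residue_subfield[OF E]]] \<tau> by simp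
  then have G: "subfield ?G Kw" by (rule Kw.generate_field_is_subfield)
  have ev: "\<exists>d\<in>E - {\<zero>}. w g = w d \<and> \<rho> (g \<otimes> inv d) \<in> ?G"
    if "g \<in> simple_extension E \<tau>" "g \<noteq> \<zero>" for g
  proof -
    obtain q where q: "q \<in> carrier (E[X])" "g = eval q \<tau>"
      using \<open>g \<in> simple_extension E \<tau>\<close> unfolding simple_extension_as_eval_img[OF Ec \<tau>(1)] by blast
    with that(2) have "q \<noteq> []" by auto
    with q(1) have "set q \<subseteq> E" "\<not> set q \<subseteq> {\<zero>}"
      by (auto simp: polynomial_def univ_poly_carrier[symmetric] intro: hd_in_set)
    from transcendental_residue_eval[OF E \<tau> tr this] show ?thesis by (simp add: q(2))
  qed
  obtain g h where gh: "g \<in> simple_extension E \<tau>" "h \<in> simple_extension E \<tau>" "h \<noteq> \<zero>" "f \<otimes> h = g"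
    using generate_field_fraction[OF S] f(1) generate_field_insert_simple_extension[OF E \<tau>(1)] by metis
  have ghc: "g \<in> carrier K" "h \<in> carrier K" using gh(1,2) subringE(1)[OF S] by blast+
  have g0: "g \<noteq> \<zero>" using gh f(2) fc ghc by (auto simp: integral_iff)
  obtain d where d: "d \<in> E - {\<zero>}" "w g = w d" "\<rho> (g \<otimes> inv d) \<in> ?G" using ev[OF gh(1) g0] by blast
  obtain e where e: "e \<in> E - {\<zero>}" "w h = w e" "\<rho> (h \<otimes> inv e) \<in> ?G" using ev[OF gh(2,3)] by blast
  have de: "d \<in> carrier K" "d \<noteq> \<zero>" "e \<in> carrier K" "e \<noteq> \<zero>" using d(1) e(1) Ec by auto
  have invde: "inv d \<in> E" "inv e \<in> E" using subfield_m_inv(1)[OF E] d(1) e(1) by auto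
  define u where "u = d \<otimes> inv e"
  have u: "u \<in> E - {\<zero>}" using d(1) invde(2) subringE(6)[OF subfieldE(1)[OF E], of d "inv e"] de
    by (auto simp: u_def integral_iff)
  then have uc: "u \<in> carrier K" "u \<noteq> \<zero>" using Ec by auto
  have ue: "u \<otimes> e = d" using de by (simp add: u_def)
  define s where "s = f \<otimes> inv u"
  have sc: "s \<in> carrier K" using fc uc by (simp add: s_def)
  have fu: "f = s \<otimes> u" using fc uc by (simp add: s_def)
  have hh: "h = h \<otimes> inv e \<otimes> e" "g = g \<otimes> inv d \<otimes> d" using ghc de by simp_all
  have "s \<otimes> (h \<otimes> inv e) \<otimes> d = f \<otimes> h"
  proof -
    have "s \<otimes> (h \<otimes> inv e) \<otimes> (u \<otimes> e) = s \<otimes> u \<otimes> (h \<otimes> inv e \<otimes> e)"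
      using sc ghc(2) de uc by (simp add: m_ac del: mult_inv_cancel)
    then show ?thesis using ghc(2) de by (simp add: ue fu)
  qed
  also have "\<dots> = g \<otimes> inv d \<otimes> d" using gh(4) ghc de by simp
  finally have sgh: "s \<otimes> (h \<otimes> inv e) = g \<otimes> inv d"
    using m_rcancel[of d "s \<otimes> (h \<otimes> inv e)" "g \<otimes> inv d"] sc ghc de by simp
  have w0: "w (g \<otimes> inv d) = 0" "w (h \<otimes> inv e) = 0"
    using w_mult_inv ghc de d(2) e(2) by auto
  have ws: "w s = 0" using w_mult[of s "h \<otimes> inv e"] sgh w0 sc ghc de by simp
  have "\<rho> s \<otimes>\<^bsub>Kw\<^esub> \<rho> (h \<otimes> inv e) = \<rho> (g \<otimes> inv d)"
    using residue_mult[of s "h \<otimes> inv e"] sgh ws w0 sc ghc de by simp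
  moreover have hn: "\<rho> (h \<otimes> inv e) \<in> carrier Kw" "\<rho> (h \<otimes> inv e) \<noteq> \<zero>\<^bsub>Kw\<^esub>"
    using residue_nz[of "h \<otimes> inv e"] w0 ghc de by auto
  moreover have "\<rho> s \<in> carrier Kw" using sc ws by simp
  ultimately have "\<rho> s = \<rho> (g \<otimes> inv d) \<otimes>\<^bsub>Kw\<^esub> inv\<^bsub>Kw\<^esub> (\<rho> (h \<otimes> inv e))"
    using Kw.field_Units by (metis Diff_iff Kw.Units_r_inv Kw.m_assoc Kw.r_one Kw.Units_inv_closed empty_iff insert_iff)
  moreover have "inv\<^bsub>Kw\<^esub> (\<rho> (h \<otimes> inv e)) \<in> ?G"
    using Kw.subfield_m_inv(1)[OF G] e(3) hn by auto
  ultimately have "\<rho> s \<in> ?G" using d(3) subringE(6)[OF subfieldE(1)[OF G]] by metis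
  moreover have "w f = w u" using w_mult_inv[OF fc uc] ws by (simp add: s_def)
  ultimately show ?thesis using u by (auto simp: s_def)
qed

text \<open>If \<open>f\<close> has value \<open>0\<close>, then so has the constant \<open>d\<close> of \<open>transcendental_residue_field\<close>, and the residue of \<open>f\<close> is the
  product of the residues of \<open>d\<close> and \<open>f / d\<close>.\<close>

corollary residue_subfield_transcendental:
  assumes E: "subfield E K" and \<tau>: "\<tau> \<in> carrier K" "w \<tau> = 0"
    and tr: "Kw.transcendental (residue_subfield K w E) (\<rho> \<tau>)"
  shows "residue_subfield K w (generate_field K (insert \<tau> E)) \<subseteq>
     generate_field Kw (insert (\<rho> \<tau>) (residue_subfield K w E))"
proof
  let ?L = "residue_subfield K w E" and ?G = "generate_field Kw (insert (\<rho> \<tau>) (residue_subfield K w E))"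
  have Ec: "E \<subseteq> carrier K" using subringE(1)[OF subfieldE(1)[OF E]] .
  have "insert (\<rho> \<tau>) ?L \<subseteq> carrier Kw"
    using subringE(1)[OF subfieldE(1)[OF subfield_residue_subfield[OF E]]] \<tau> by simp
  then have G: "subfield ?G Kw" by (rule Kw.generate_field_is_subfield)
  fix \<xi> assume "\<xi> \<in> residue_subfield K w (generate_field K (insert \<tau> E))"
  then obtain f where f: "f \<in> generate_field K (insert \<tau> E)" "0 \<le> w f" "\<xi> = \<rho> f"
    by (auto simp: mem_residue_subfield_iff)
  have fc: "f \<in> carrier K" using generate_field_in_carrier[of "insert \<tau> E"] f(1) Ec \<tau>(1) by blast
  show "\<xi> \<in> ?G"
  proof (cases "0 < w f")
    case True
    then show ?thesis using residue_eq_zero[OF fc] subringE(2)[OF subfieldE(1)[OF G]] f(3) by simp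
  next
    case False
    with f(2) have w0: "w f = 0" by simp
    then have "f \<noteq> \<zero>" by (auto simp: zero_vext_def)
    from transcendental_residue_field[OF E \<tau> tr f(1) this]
    obtain d where d: "d \<in> E" "d \<noteq> \<zero>" "w f = w d" "\<rho> (f \<otimes> inv d) \<in> ?G" by auto
    have dc: "d \<in> carrier K" using d(1) Ec by blast
    have "\<rho> d \<in> ?L" unfolding mem_residue_subfield_iff using d w0 by (intro bexI[of _ d]) auto
    then have "\<rho> d \<in> ?G" by (auto intro: generate_field.incl)
    moreover have "\<rho> f = \<rho> (f \<otimes> inv d) \<otimes>\<^bsub>Kw\<^esub> \<rho> d"
      using residue_mult[of "f \<otimes> inv d" d] w_mult_inv[OF fc dc d(2)] d w0 fc dc by simp
    ultimately show ?thesis using d(4) f(3) subringE(6)[OF subfieldE(1)[OF G]] by simp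
  qed
qed

end

section \<open>Ramified and Gauss extensions\<close>

context valued_field
begin

text \<open>The assumption \<open>ram\<close> says that \<open>w r\<close> has order at least \<open>p\<close> modulo the value group of \<open>E\<close>. The nonzero terms of
  a polynomial in \<open>r\<close> of degree below \<open>p\<close> therefore have pairwise different values, and the one of
  least value dominates.\<close>

lemma ramified_dominant_term:
  assumes E: "subfield E K" and r: "r \<in> carrier K" "r \<noteq> \<zero>"
    and ram: "\<And>j e. \<lbrakk>0 < j; j < p; e \<in> E - {\<zero>}\<rbrakk> \<Longrightarrow> w (r [^] (j::nat)) \<noteq> w e"
    and q: "set q \<subseteq> E" "length q \<le> p" "eval q r \<noteq> \<zero>"
  shows "\<exists>e\<in>E - {\<zero>}. \<exists>i<length q. w (eval q r) < w (eval q r \<ominus> e \<otimes> r [^] i)"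
  using q
proof (induction q)
  case Nil
  then show ?case by simp
next
  case (Cons a q)
  have Ec: "E \<subseteq> carrier K" using subringE(1)[OF subfieldE(1)[OF E]] .
  define n where "n = length q"
  define g where "g = eval q r"
  define f where "f = eval (a # q) r"
  have np: "n < p" using Cons.prems(2) by (simp add: n_def)
  have a: "a \<in> E" "a \<in> carrier K" using Cons.prems(1) Ec by auto
  have gc: "g \<in> carrier K" using Cons.prems(1) Ec r(1) unfolding g_def by (intro eval_in_carrier) auto
  have f: "f = a \<otimes> r [^] n \<oplus> g" by (simp add: f_def g_def n_def)
  have f0: "f \<noteq> \<zero>" using Cons.prems(3) by (simp only: f_def) simp
  have ac: "a \<otimes> r [^] n \<in> carrier K" using a r by simp
  have IH: "\<exists>e\<in>E - {\<zero>}. \<exists>i<n. w g < w (g \<ominus> e \<otimes> r [^] i)" if "g \<noteq> \<zero>"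
    using Cons.IH Cons.prems(1,2) that unfolding g_def n_def by simp
  have "\<exists>e\<in>E - {\<zero>}. \<exists>i<Suc n. w f < w (f \<ominus> e \<otimes> r [^] i)"
  proof -
    consider "a = \<zero>" | "a \<noteq> \<zero>" "g = \<zero>" | "a \<noteq> \<zero>" "g \<noteq> \<zero>" by blast
    then show ?thesis
    proof cases
      case 1
      then have "f = g" using r gc f by simp
      with IH f0 show ?thesis using less_Suc_eq by blast
    next
      case 2
      then have "f \<ominus> a \<otimes> r [^] n = \<zero>" using f ac by (simp add: minus_eq r_neg)
      moreover have "w f < Infty" using w_eq_Infty_iff[of f] f0 f ac gc by (cases "w f") auto
      ultimately show ?thesis using 2 a by (intro bexI[of _ a] exI[of _ n]) auto
    next
      case 3
      then obtain e i where e: "e \<in> E - {\<zero>}" "i < n" "w g < w (g \<ominus> e \<otimes> r [^] i)" using IH by blast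
      have ec: "e \<in> carrier K" "e \<noteq> \<zero>" using e(1) Ec by auto
      have eic: "e \<otimes> r [^] i \<in> carrier K" using ec r by simp
      have wg: "w (e \<otimes> r [^] i) = w g" using w_eq_of_w_diff[OF gc eic e(3)] .
      \<comment> \<open>Monomials of different degrees below \<open>p\<close> have different values.\<close>
      have ne: "w (a \<otimes> r [^] n) \<noteq> w (e \<otimes> r [^] i)"
      proof
        assume eq: "w (a \<otimes> r [^] n) = w (e \<otimes> r [^] i)"
        have "r [^] n = r [^] (n - i) \<otimes> r [^] i" using e(2) r by (simp add: nat_pow_mult)
        with eq have "w (a \<otimes> r [^] (n - i) \<otimes> r [^] i) = w (e \<otimes> r [^] i)" using a r by (simp add: m_assoc)
        then have "w (a \<otimes> r [^] (n - i)) = w e" using a ec r w_mult_eq_iff by simp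
        moreover have "a \<otimes> r [^] (n - i) = r [^] (n - i) \<otimes> a" using a r by (simp add: m_comm)
        moreover have "e = e \<otimes> inv a \<otimes> a" using a 3 ec by simp
        ultimately have "w (r [^] (n - i)) = w (e \<otimes> inv a)"
          using w_mult_eq_iff[of "r [^] (n - i)" "e \<otimes> inv a" a] a ec r 3 by simp
        moreover have "e \<otimes> inv a \<in> E - {\<zero>}"
          using e(1) a 3 subfield_m_inv(1)[OF E, of a] subringE(6)[OF subfieldE(1)[OF E], of e "inv a"] ec
          by (auto simp: integral_iff)
        ultimately show False using ram[of "n - i" "e \<otimes> inv a"] e(2) np by (simp add: less_imp_diff_less)
      qed
      show ?thesis
      proof (cases "w (a \<otimes> r [^] n) < w g")
        case True
        then have "w f = w (a \<otimes> r [^] n)" unfolding f using w_add_eq ac gc by simp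
        moreover have "f \<ominus> a \<otimes> r [^] n = g" unfolding f using ac gc by algebra
        ultimately show ?thesis using True a 3 by (intro bexI[of _ a] exI[of _ n]) auto
      next
        case False
        with ne wg have less: "w g < w (a \<otimes> r [^] n)" by simp
        then have "w f = w g" unfolding f using w_add_eq[of g "a \<otimes> r [^] n"] ac gc by (simp add: a_comm)
        moreover have "f \<ominus> e \<otimes> r [^] i = a \<otimes> r [^] n \<oplus> (g \<ominus> e \<otimes> r [^] i)"
          unfolding f using ac gc eic by algebra
        moreover have "w g < w (a \<otimes> r [^] n \<oplus> (g \<ominus> e \<otimes> r [^] i))"
          using less e(3) ac gc eic by (intro w_add_gt[of "a \<otimes> r [^] n"]) auto
        ultimately show ?thesis using e(1,2) by (intro bexI[of _ e] exI[of _ i]) auto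
      qed
    qed
  qed
  then show ?case by (simp only: f_def n_def list.size add_Suc_right add_0_right)
qed

text \<open>Reducing modulo the trinomial brings every polynomial in \<open>r\<close> to degree below \<open>p\<close>. The trinomial may be reducible.\<close>

lemma simple_extension_trinomial:
  assumes E: "subfield E K" and r: "r \<in> carrier K" and B: "B1 \<in> E" "B2 \<in> E"
    and eq: "r [^] p = B1 \<otimes> r \<oplus> B2" and p: "2 \<le> (p::nat)"
    and f: "f \<in> simple_extension E r"
  obtains q where "set q \<subseteq> E" "length q \<le> p" "f = eval q r"
proof -
  note E' = subringE[OF subfieldE(1)[OF E]]
  have Ec: "E \<subseteq> carrier K" using E'(1) .
  from f have "\<exists>q. set q \<subseteq> E \<and> length q \<le> p \<and> f = eval q r"
  proof (induction rule: simple_extension.induct)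
    case zero
    show ?case by (intro exI[of _ "[]"]) simp
  next
    case (lin k1 k2)
    then obtain q where q: "set q \<subseteq> E" "length q \<le> p" "k1 = eval q r" by blast
    have qc: "set q \<subseteq> carrier K" "k2 \<in> carrier K" using q(1) lin(2) Ec by auto
    show ?case
    proof (cases "length q < p")
      case True
      then show ?thesis
        using q lin(2) eval_append_aux[OF qc r] by (intro exI[of _ "q @ [k2]"]) auto
    next
      case False
      with q(2) have "length q = p" by simp
      with p obtain a q' where "q = a # q'" by (cases q) auto
      moreover from this \<open>length q = p\<close> p have "length q' = p - 1" "q' \<noteq> []" by auto
      ultimately have aq: "q = a # q'" "length q' = p - 1" "q' \<noteq> []" .
      then obtain q'' u where u: "q' = q'' @ [u]" by (metis rev_exhaust)
      have c: "a \<in> carrier K" "u \<in> carrier K" "set q'' \<subseteq> carrier K" "B1 \<in> carrier K" "B2 \<in> carrier K"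
        using qc B Ec unfolding aq(1) u by auto
      have evc: "eval q'' r \<in> carrier K" using c r by (intro eval_in_carrier) auto
      have inE: "u \<oplus> a \<otimes> B1 \<in> E" "k2 \<oplus> a \<otimes> B2 \<in> E" "set q'' \<subseteq> E"
        using q(1) B lin(2) E'(6,7) unfolding aq(1) u by auto
      have ev2: "eval (q'' @ [s, t]) r = (eval q'' r \<otimes> r \<oplus> s) \<otimes> r \<oplus> t"
        if "s \<in> carrier K" "t \<in> carrier K" for s t
        using eval_append_aux[of "q'' @ [s]" t r] eval_append_aux[of q'' s r] c r that by simp
      have "k1 \<otimes> r \<oplus> k2 = eval (q @ [k2]) r" using eval_append_aux[OF qc r] q(3) by simp
      also have "\<dots> = eval (a # (q'' @ [u, k2])) r" by (simp add: aq(1) u)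
      also have "\<dots> = a \<otimes> r [^] p \<oplus> eval (q'' @ [u, k2]) r"
        using aq(2) u p by simp
      also have "\<dots> = a \<otimes> (B1 \<otimes> r \<oplus> B2) \<oplus> ((eval q'' r \<otimes> r \<oplus> u) \<otimes> r \<oplus> k2)"
        using ev2[of u k2] c qc by (simp add: eq)
      also have "\<dots> = (eval q'' r \<otimes> r \<oplus> (u \<oplus> a \<otimes> B1)) \<otimes> r \<oplus> (k2 \<oplus> a \<otimes> B2)"
        using evc c r qc by algebra
      also have "\<dots> = eval (q'' @ [u \<oplus> a \<otimes> B1, k2 \<oplus> a \<otimes> B2]) r"
        using ev2[of "u \<oplus> a \<otimes> B1" "k2 \<oplus> a \<otimes> B2"] c qc by simp
      finally show ?thesis
        using inE aq(2) u p by (intro exI[of _ "q'' @ [u \<oplus> a \<otimes> B1, k2 \<oplus> a \<otimes> B2]"]) auto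
    qed
  qed
  with that show thesis by blast
qed

lemma generate_field_trinomial:
  assumes E: "subfield E K" and r: "r \<in> carrier K" and B: "B1 \<in> E" "B2 \<in> E"
    and eq: "r [^] p = B1 \<otimes> r \<oplus> B2" and p: "2 \<le> (p::nat)"
  shows "generate_field K (insert r E) = simple_extension E r"
proof -
  note E' = subringE[OF subfieldE(1)[OF E]]
  have Bc: "B1 \<in> carrier K" "B2 \<in> carrier K" using B E'(1) by auto
  let ?q = "\<one> # (replicate (p - 2) \<zero> @ [\<ominus> B1, \<ominus> B2])"
  have "eval ?q r = \<one> \<otimes> r [^] p \<oplus> eval [\<ominus> B1, \<ominus> B2] r"
  proof -
    have "length (replicate (p - 2) \<zero> @ [\<ominus> B1, \<ominus> B2]) = p" using p by simp
    then show ?thesis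
      using eval_replicate[of "[\<ominus> B1, \<ominus> B2]" r "p - 2"] Bc r by (simp del: length_append length_replicate)
  qed
  also have "eval [\<ominus> B1, \<ominus> B2] r = \<ominus> B1 \<otimes> r \<oplus> \<ominus> B2" using Bc r by simp
  also have "\<one> \<otimes> r [^] p \<oplus> (\<ominus> B1 \<otimes> r \<oplus> \<ominus> B2) = \<zero>"
    unfolding eq using Bc r by (simp add: l_minus minus_add[symmetric] r_neg)
  finally have "eval ?q r = \<zero>" .
  moreover have "?q \<in> carrier (E[X])"
  proof -
    have "set ?q \<subseteq> E" using E'(2,3) E'(5)[OF B(1)] E'(5)[OF B(2)] by auto
    then show ?thesis by (simp add: univ_poly_carrier[symmetric] polynomial_def)
  qed
  ultimately have "algebraic E r" using algebraicI[of ?q E r] unfolding over_def by blast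
  then have S: "subfield (simple_extension E r) K"
    using simple_extension_is_subfield[OF E r] by (simp add: over_def)
  have "generate_field K (simple_extension E r) = simple_extension E r"
    using generate_field_min_subfield1[OF subringE(1)[OF subfieldE(1)[OF S]] S]
    by (auto intro: generate_field.incl)
  then show ?thesis using generate_field_insert_simple_extension[OF E r] by simp
qed

text \<open>The equation of the curve is a trinomial in each of \<open>x\<close>, \<open>y\<close> over the field generated by the other one or by
  \<open>y / x\<close>, which is why the relation for the generator has this shape.\<close>

proposition ramified_extension:
  assumes E: "subfield E K" and r: "r \<in> carrier K" "r \<noteq> \<zero>"
    and A: "A0 \<in> E" "A1 \<in> E" "A2 \<in> E" "A0 \<noteq> \<zero>"
    and eq: "A0 \<otimes> r [^] p = A1 \<otimes> r \<oplus> A2" and p: "2 \<le> (p::nat)"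
    and ram: "\<And>j e. \<lbrakk>0 < j; j < p; e \<in> E - {\<zero>}\<rbrakk> \<Longrightarrow> w (r [^] (j::nat)) \<noteq> w e"
    and f: "f \<in> generate_field K (insert r E)" "f \<noteq> \<zero>"
  shows "\<exists>e\<in>E - {\<zero>}. \<exists>i<p. w f < w (f \<ominus> e \<otimes> r [^] i)"
proof -
  note E' = subringE[OF subfieldE(1)[OF E]]
  have Ac: "A0 \<in> carrier K" "A1 \<in> carrier K" "A2 \<in> carrier K" using A E'(1) by auto
  have i: "inv A0 \<in> E" "inv A0 \<in> carrier K" using subfield_m_inv(1)[OF E, of A0] A Ac by auto
  have B: "inv A0 \<otimes> A1 \<in> E" "inv A0 \<otimes> A2 \<in> E" using E'(6) i A by auto
  have "r [^] p = inv A0 \<otimes> (A0 \<otimes> r [^] p)" using Ac A(4) r by simp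
  also have "\<dots> = inv A0 \<otimes> A1 \<otimes> r \<oplus> inv A0 \<otimes> A2"
    unfolding eq using Ac i r by (simp add: r_distr m_assoc)
  finally have eq': "r [^] p = inv A0 \<otimes> A1 \<otimes> r \<oplus> inv A0 \<otimes> A2" .
  have "f \<in> simple_extension E r" using f(1) generate_field_trinomial[OF E r(1) B eq' p] by simp
  from simple_extension_trinomial[OF E r(1) B eq' p this]
  obtain q where q: "set q \<subseteq> E" "length q \<le> p" "f = eval q r" by blast
  from ramified_dominant_term[OF E r ram q(1,2)] f(2) q(3)
  obtain e i where "e \<in> E - {\<zero>}" "i < length q" "w f < w (f \<ominus> e \<otimes> r [^] i)" by blast
  with q(2) show ?thesis by (intro bexI[of _ e] exI[of _ i]) auto
qed

text \<open>If the dominant term \<open>e r\<^sup>i\<close> has value \<open>0\<close>, then \<open>w (r\<^sup>i)\<close> is the value of \<open>1 / e\<close>, so \<open>i = 0\<close>: the dominant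
  term is an element of \<open>E\<close> with the same residue.\<close>

corollary ramified_extension_residue:
  assumes E: "subfield E K" and r: "r \<in> carrier K" "r \<noteq> \<zero>"
    and A: "A0 \<in> E" "A1 \<in> E" "A2 \<in> E" "A0 \<noteq> \<zero>"
    and eq: "A0 \<otimes> r [^] p = A1 \<otimes> r \<oplus> A2" and p: "2 \<le> (p::nat)"
    and ram: "\<And>j e. \<lbrakk>0 < j; j < p; e \<in> E - {\<zero>}\<rbrakk> \<Longrightarrow> w (r [^] (j::nat)) \<noteq> w e"
  shows "residue_subfield K w (generate_field K (insert r E)) \<subseteq> residue_subfield K w E"
proof
  fix \<xi> assume "\<xi> \<in> residue_subfield K w (generate_field K (insert r E))"
  then obtain f where f: "f \<in> generate_field K (insert r E)" "0 \<le> w f" "\<xi> = \<rho> f"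
    by (auto simp: mem_residue_subfield_iff)
  note E' = subringE[OF subfieldE(1)[OF E]]
  have fc: "f \<in> carrier K" using generate_field_in_carrier[of "insert r E"] f(1) E'(1) r(1) by blast
  show "\<xi> \<in> residue_subfield K w E"
  proof (cases "0 < w f")
    case True
    then have "\<rho> f = \<rho> \<zero>" using residue_eq_zero[OF fc] residue_eq_zero[of \<zero>] by (simp add: zero_vext_def)
    then show ?thesis using f(3) E'(2) by (auto simp: mem_residue_subfield_iff zero_vext_def intro!: bexI[of _ \<zero>])
  next
    case False
    with f(2) have w0: "w f = 0" by simp
    then have "f \<noteq> \<zero>" by (auto simp: zero_vext_def)
    with ramified_extension[OF E r A eq p ram f(1)]
    obtain e i where e: "e \<in> E" "e \<noteq> \<zero>" "i < p" "w f < w (f \<ominus> e \<otimes> r [^] i)" by blast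
    have ec: "e \<in> carrier K" "e \<otimes> r [^] i \<in> carrier K" using e(1) E'(1) r(1) by auto
    have wei: "w (e \<otimes> r [^] i) = 0" using w_eq_of_w_diff[OF fc ec(2) e(4)] w0 by simp
    have ie: "inv e \<in> E - {\<zero>}" "inv e \<in> carrier K" using subfield_m_inv(1)[OF E, of e] e ec by auto
    have "i = 0"
    proof (rule ccontr)
      assume "i \<noteq> 0"
      have "w (r [^] i \<otimes> e) = w (inv e \<otimes> e)" using wei ec r e(2) by (simp add: m_comm)
      then have "w (r [^] i) = w (inv e)" using w_mult_eq_iff[of "r [^] i" "inv e" e] ec ie r e(2) by simp
      with ram[of i "inv e"] \<open>i \<noteq> 0\<close> e(3) ie(1) show False by simp
    qed
    then have "0 < w (f \<ominus> e)" using e(4) w0 ec by simp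
    from residue_cong[OF fc ec(1) f(2) this] show ?thesis
      using e(1) f(3) by (auto simp: mem_residue_subfield_iff intro!: bexI[of _ e])
  qed
qed

text \<open>A polynomial in \<open>i x\<^sup>n\<close> rewritten as a polynomial in \<open>x\<close>, up to any degree bound \<open>N\<close> that leaves room for all its
  terms. The coefficient of the leading term is recorded.\<close>

lemma eval_power_as_finsum:
  assumes k: "subfield k K" and x: "x \<in> carrier K" and n: "0 < n" and i: "i \<in> k"
    and q: "set q \<subseteq> k" and N: "n * length q \<le> N"
  shows "\<exists>c. c \<in> UNIV \<rightarrow> k \<and> (\<forall>j\<ge>n * length q. c j = \<zero>) \<and>
     (q \<noteq> [] \<longrightarrow> c (n * (length q - 1)) = hd q \<otimes> i [^] (length q - 1)) \<and>
     eval q (x [^] n \<otimes> i) = (\<Oplus>j\<in>{..N}. c j \<otimes> x [^] j)"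
  using q N
proof (induction q)
  case Nil
  then show ?case using subringE(2)[OF subfieldE(1)[OF k]] x
    by (intro exI[of _ "\<lambda>_. \<zero>"]) (auto simp: finsum_zero)
next
  case (Cons a q)
  note k' = subringE[OF subfieldE(1)[OF k]]
  have kc: "k \<subseteq> carrier K" using k'(1) .
  define m where "m = n * length q"
  from Cons obtain c where c: "c \<in> UNIV \<rightarrow> k" "\<forall>j\<ge>m. c j = \<zero>"
    "eval q (x [^] n \<otimes> i) = (\<Oplus>j\<in>{..N}. c j \<otimes> x [^] j)" unfolding m_def by auto
  have cc: "c j \<in> carrier K" for j using c(1) kc by auto
  have mN: "m \<le> N" "m < n * length (a # q)" using Cons.prems(2) n by (auto simp: m_def)
  define b where "b = a \<otimes> i [^] length q"
  have ac: "a \<in> carrier K" "i \<in> carrier K" using Cons.prems(1) i kc by auto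
  have ipow: "i [^] l \<in> k" for l :: nat using i k'(3,6) by (induction l) auto
  have b: "b \<in> k" "b \<in> carrier K" using Cons.prems(1) ipow k'(6) kc unfolding b_def by auto
  let ?c = "c(m := b)"
  have "(\<Oplus>j\<in>{..N}. ?c j \<otimes> x [^] j) = (\<Oplus>j\<in>{..N}. c j \<otimes> x [^] j \<oplus> (if m = j then b \<otimes> x [^] j else \<zero>))"
    using c(2) cc b x by (intro finsum_cong') auto
  also have "\<dots> = (\<Oplus>j\<in>{..N}. c j \<otimes> x [^] j) \<oplus> (\<Oplus>j\<in>{..N}. if m = j then b \<otimes> x [^] j else \<zero>)"
    using cc b x by (intro finsum_addf) auto
  also have "(\<Oplus>j\<in>{..N}. if m = j then b \<otimes> x [^] j else \<zero>) = b \<otimes> x [^] m"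
    using finsum_singleton[of m "{..N}" "\<lambda>j. b \<otimes> x [^] j"] mN(1) b x by auto
  also have "b \<otimes> x [^] m = a \<otimes> (x [^] n \<otimes> i) [^] length q"
    using x ac by (simp add: b_def m_def nat_pow_distrib nat_pow_pow m_ac)
  finally have "eval (a # q) (x [^] n \<otimes> i) = (\<Oplus>j\<in>{..N}. ?c j \<otimes> x [^] j)"
    using c(3) cc ac x by (simp add: a_comm)
  moreover have "?c \<in> UNIV \<rightarrow> k" using c(1) b(1) by auto
  moreover have "\<forall>j\<ge>n * length (a # q). ?c j = \<zero>" using c(2) mN(2) by auto
  ultimately show ?case by (intro exI[of _ ?c]) (auto simp: m_def b_def)
qed

text \<open>The assumption \<open>gauss\<close> is the half of the Gauss formula that does not hold in general. If the
  residue of \<open>x\<^sup>n / d\<close> were a root of a nonzero polynomial over the residue field of \<open>k\<close>, a lift of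
  that polynomial with a unit as leading coefficient would have positive value at \<open>x\<^sup>n / d\<close>; but by \<open>gauss\<close>
  that value is at most the value of the leading term, which is \<open>0\<close>.\<close>

lemma gauss_transcendental_residue:
  assumes k: "subfield k K" and x: "x \<in> carrier K" and n: "0 < (n::nat)" and d: "d \<in> k" "d \<noteq> \<zero>"
    and gauss: "\<And>N c j. \<lbrakk>c \<in> {..N} \<rightarrow> k; j \<le> N\<rbrakk> \<Longrightarrow> w (\<Oplus>i\<in>{..N}. c i \<otimes> x [^] i) \<le> w (c j \<otimes> x [^] (j::nat))"
    and w0: "w (x [^] n \<otimes> inv d) = 0"
  shows "Kw.transcendental (residue_subfield K w k) (\<rho> (x [^] n \<otimes> inv d))"
proof (rule ccontr)
  note k' = subringE[OF subfieldE(1)[OF k]]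
  let ?L = "residue_subfield K w k" and ?\<tau> = "x [^] n \<otimes> inv d"
  have L: "subfield ?L Kw" using subfield_residue_subfield[OF k] .
  have dc: "d \<in> carrier K" "inv d \<in> k" "inv d \<in> carrier K" "inv d \<noteq> \<zero>"
    using subfield_m_inv(1)[OF k, of d] d k'(1) by auto
  have \<tau>: "?\<tau> \<in> carrier K" using x dc by simp
  assume "\<not> Kw.transcendental ?L (\<rho> ?\<tau>)"
  then obtain l where l: "l \<in> carrier (?L[X]\<^bsub>Kw\<^esub>)" "l \<noteq> []" "Kw.eval l (\<rho> ?\<tau>) = \<zero>\<^bsub>Kw\<^esub>"
    using Kw.algebraicE[OF subfieldE(1)[OF L], of "\<rho> ?\<tau>"] \<tau> w0 by (auto simp: over_def)
  then have l': "set l \<subseteq> ?L" "hd l \<noteq> \<zero>\<^bsub>Kw\<^esub>" by (auto simp: univ_poly_carrier[symmetric] polynomial_def)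
  have "\<exists>q. set q \<subseteq> k \<inter> \<O> \<and> map \<rho> q = l"
    using l'(1)
  proof (induction l)
    case (Cons \<xi> l)
    then obtain q where q: "set q \<subseteq> k \<inter> \<O>" "map \<rho> q = l" by auto
    from Cons obtain u where "u \<in> k \<inter> \<O>" "\<xi> = \<rho> u" using k'(1) by (auto simp: mem_residue_subfield_iff)
    with q show ?case by (intro exI[of _ "u # q"]) auto
  qed simp
  then obtain q where q: "set q \<subseteq> k \<inter> \<O>" "map \<rho> q = l" by blast
  with l(2) have q0: "q \<noteq> []" by auto
  have evc: "eval q ?\<tau> \<in> carrier K" using q(1) k'(1) \<tau> by (intro eval_in_carrier) auto
  have "0 \<le> w (eval q ?\<tau>)" "\<rho> (eval q ?\<tau>) = \<zero>\<^bsub>Kw\<^esub>"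
    using residue_eval[of q ?\<tau>] q \<tau> w0 l(3) by auto
  with residue_eq_zero_iff[OF evc] have pos: "0 < w (eval q ?\<tau>)" by simp
  let ?N = "n * length q" and ?m = "n * (length q - 1)"
  obtain c where c: "c \<in> UNIV \<rightarrow> k" "c ?m = hd q \<otimes> inv d [^] (length q - 1)"
      "eval q ?\<tau> = (\<Oplus>j\<in>{..?N}. c j \<otimes> x [^] j)"
    using eval_power_as_finsum[OF k x n dc(2), of q ?N] q(1) q0 by auto
  have "w (eval q ?\<tau>) \<le> w (c ?m \<otimes> x [^] ?m)"
    unfolding c(3) using c(1) by (intro gauss) auto
  also have "c ?m \<otimes> x [^] ?m = hd q \<otimes> ?\<tau> [^] (length q - 1)"
  proof -
    have "hd q \<in> carrier K" using q(1) q0 k'(1) hd_in_set[OF q0] by blast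
    then show ?thesis unfolding c(2) using x dc by (simp add: nat_pow_distrib nat_pow_pow m_ac)
  qed
  also have "w (hd q \<otimes> ?\<tau> [^] (length q - 1)) = w (hd q)"
  proof -
    have "hd q \<in> carrier K" using q(1) q0 k'(1) hd_in_set[OF q0] by blast
    then show ?thesis using w_mult[of "hd q" "?\<tau> [^] (length q - 1)"] \<tau> w_pow_zero[OF \<tau> w0] by simp
  qed
  finally have "0 < w (hd q)" using pos by simp
  moreover have "hd q \<in> carrier K" using q(1) q0 k'(1) hd_in_set[OF q0] by blast
  ultimately have "\<rho> (hd q) = \<zero>\<^bsub>Kw\<^esub>" using residue_eq_zero by blast
  moreover have "hd l = \<rho> (hd q)" using q(2) q0 by (auto simp: hd_map)
  ultimately show False using l'(2) by simp
qed

end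

section \<open>Two values modulo a subgroup\<close>

lemma zmul_of_nat: "zmul (int n) x = nmul n x"
  by (simp add: zmul_def)

lemma zmul_0 [simp]: "zmul 0 x = 0" and zmul_1 [simp]: "zmul 1 x = x"
  by (simp_all add: zmul_def)

lemma zmul_succ: "zmul (m + 1) x = zmul m x + x"
proof (cases "0 \<le> m")
  case True
  then show ?thesis by (simp add: zmul_def nat_add_distrib add.commute)
next
  case False
  then obtain n where n: "m = - int (Suc n)" using int_cases3 by (metis False linorder_not_le negD)
  have "nat (int n + 1) = Suc n" by simp
  then show ?thesis by (cases "n = 0") (simp_all add: n zmul_def)
qed

lemma zmul_add: "zmul (m + n) x = zmul m x + zmul n x"
proof (induction n rule: int_induct[of _ 0])
  case (step1 n)
  then show ?case using zmul_succ[of "m + n" x] zmul_succ[of n x] by (simp add: add.assoc)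
next
  case (step2 n)
  have "zmul (m + n) x = zmul (m + (n - 1)) x + x" "zmul n x = zmul (n - 1) x + x"
    using zmul_succ[of "m + (n - 1)" x] zmul_succ[of "n - 1" x] by (simp_all add: algebra_simps)
  with step2 show ?case by (simp add: algebra_simps)
qed simp

lemma zmul_uminus: "zmul (- m) x = - zmul m x"
  using zmul_add[of "- m" m x] by (simp add: eq_neg_iff_add_eq_0)

lemma zmul_diff: "zmul (m - n) x = zmul m x - zmul n x"
  using zmul_add[of m "- n" x] by (simp add: zmul_uminus)

lemma zmul_mult: "zmul (m * n) x = zmul m (zmul n x)"
proof (induction m rule: int_induct[of _ 0])
  case (step1 m)
  then show ?case by (simp add: zmul_add distrib_right)
next
  case (step2 m)
  then show ?case by (simp add: zmul_diff left_diff_distrib)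
qed simp

lemma zmul_add_right: "zmul m (x + y) = zmul m x + zmul m y"
proof (induction m rule: int_induct[of _ 0])
  case (step1 m)
  then show ?case by (simp add: zmul_add algebra_simps)
next
  case (step2 m)
  then show ?case by (simp add: zmul_diff algebra_simps)
qed simp

lemma coprime_less_prime:
  assumes "Factorial_Ring.prime p" "0 < j" "j < p"
  shows "coprime (int j) (int p)"
proof -
  have "\<not> p dvd j" using assms(2,3) by (auto dest: dvd_imp_le)
  then have "coprime p j" using assms(1) by (intro prime_imp_coprime) auto
  then show ?thesis by (simp add: coprime_commute)
qed

locale add_subgroup =
  fixes H :: "'g::ab_group_add set"
  assumes zero: "0 \<in> H" and add: "\<lbrakk>g \<in> H; h \<in> H\<rbrakk> \<Longrightarrow> g + h \<in> H" and uminus: "g \<in> H \<Longrightarrow> - g \<in> H"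
begin

lemma diff: "\<lbrakk>g \<in> H; h \<in> H\<rbrakk> \<Longrightarrow> g - h \<in> H"
  using add[of g "- h"] uminus[of h] by simp

lemma nmul: "g \<in> H \<Longrightarrow> nmul n g \<in> H"
  by (induction n) (auto intro: zero add)

lemma zmul: "g \<in> H \<Longrightarrow> zmul m g \<in> H"
  using uminus by (simp add: zmul_def nmul)

lemma mem_add_multiples_iff: "h \<in> add_multiples H g \<longleftrightarrow> (\<exists>m. h - zmul m g \<in> H)"
proof
  assume "\<exists>m. h - zmul m g \<in> H"
  then obtain m where "h - zmul m g \<in> H" by blast
  then show "h \<in> add_multiples H g"
    unfolding add_multiples_def by (intro CollectI exI[of _ "h - zmul m g"] exI[of _ m]) simp
next
  assume "h \<in> add_multiples H g"
  then obtain f m where "f \<in> H" "h = f + zmul m g" by (auto simp: add_multiples_def)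
  then show "\<exists>m. h - zmul m g \<in> H" by (intro exI[of _ m]) simp
qed

lemma self_mem_add_multiples: "g \<in> add_multiples H g"
  unfolding mem_add_multiples_iff using zero by (intro exI[of _ 1]) simp

lemma add_multiples_eq_self:
  assumes "g \<in> H" shows "add_multiples H g = H"
proof (intro equalityI subsetI)
  fix h assume "h \<in> add_multiples H g"
  then obtain m where "h - zmul m g \<in> H" by (auto simp: mem_add_multiples_iff)
  from add[OF this zmul[OF assms, of m]] show "h \<in> H" by simp
next
  fix h assume "h \<in> H"
  then show "h \<in> add_multiples H g" unfolding mem_add_multiples_iff by (intro exI[of _ 0]) simp
qed

lemma add_multiples_subset:
  assumes "g \<in> add_multiples H h" shows "add_multiples H g \<subseteq> add_multiples H h"
proof
  fix f assume "f \<in> add_multiples H g"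
  then obtain m n where "f - zmul m g \<in> H" "g - zmul n h \<in> H"
    using assms by (auto simp: mem_add_multiples_iff)
  then have "(f - zmul m g) + zmul m (g - zmul n h) \<in> H" by (intro add zmul)
  also have "(f - zmul m g) + zmul m (g - zmul n h) = f - zmul (m * n) h"
    using zmul_add_right[of m "g - zmul n h" "zmul n h"] by (simp add: zmul_mult algebra_simps)
  finally show "f \<in> add_multiples H h" by (auto simp: mem_add_multiples_iff)
qed

text \<open>The order of \<open>g\<close> modulo \<open>H\<close> divides both \<open>p\<close> and \<open>m\<close>.\<close>

lemma mem_if_coprime_multiple_mem:
  assumes "nmul p g \<in> H" "zmul m g \<in> H" "coprime m (int p)"
  shows "g \<in> H"
proof -
  obtain u v where "u * m + v * int p = 1"
    using bezout_int[of m "int p"] assms(3) by (auto simp: coprime_iff_gcd_eq_1)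
  then have "g = zmul u (zmul m g) + zmul v (nmul p g)"
    using zmul_add[of "u * m" "v * int p" g] by (simp add: zmul_mult zmul_of_nat)
  then show ?thesis using add zmul assms(1,2) by metis
qed

lemma nmul_notin:
  assumes p: "Factorial_Ring.prime p" and g: "nmul p g \<in> H" "g \<notin> H" and j: "0 < j" "j < p"
  shows "nmul j g \<notin> H"
proof
  assume "nmul j g \<in> H"
  moreover have "coprime (int j) (int p)"
    using p j by (rule coprime_less_prime)
  ultimately show False using mem_if_coprime_multiple_mem[of p g "int j"] g by (simp add: zmul_of_nat)
qed

text \<open>If \<open>h\<close> is not in \<open>H + \<int> g\<close>, its order modulo this group is \<open>p\<close>. Otherwise \<open>h\<close> is congruent to \<open>m g\<close> with
  \<open>0 \<le> m < p\<close>, and \<open>m = 0\<close> and \<open>m = 1\<close> are set apart because they lead to rational curves unless \<open>g\<close> lies in \<open>H\<close>.\<close>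

lemma value_cases:
  assumes p: "Factorial_Ring.prime p" and g: "nmul p g \<in> H" and h: "nmul p h \<in> H"
  obtains
    (ramified) "h \<notin> add_multiples H g" "\<And>i j. \<lbrakk>0 < j; j < p\<rbrakk> \<Longrightarrow> nmul j h - nmul i g \<notin> H"
  | (second) "g \<notin> H" "h \<in> H"
  | (quotient) "g \<notin> H" "h - g \<in> H"
  | (unramified) "g \<in> H" "h \<in> H"
  | (mixed) m where "g \<notin> H" "2 \<le> m" "m < p" "h - nmul m g \<in> H"
proof (cases "h \<in> add_multiples H g")
  case False
  have "nmul j h - nmul i g \<notin> H" if j: "0 < j" "j < p" for i j
  proof
    assume H: "nmul j h - nmul i g \<in> H"
    have "coprime (int j) (int p)"
      using p j by (rule coprime_less_prime)
    then obtain u v where uv: "u * int j + v * int p = 1"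
      using bezout_int[of "int j" "int p"] by (auto simp: coprime_iff_gcd_eq_1)
    have aux: "a - d = c + e" if "a = b + e" "b = c + d" for a b c d e :: 'g
      using that by (simp add: algebra_simps)
    have mem: "zmul u (nmul j h - nmul i g) + zmul v (nmul p h) \<in> H" using H h by (intro add zmul)
    have "zmul u (nmul j h) = zmul u (nmul j h - nmul i g) + zmul (u * int i) g"
      using zmul_add_right[of u "nmul j h - nmul i g" "nmul i g"] by (simp add: zmul_mult zmul_of_nat)
    moreover have "h = zmul u (nmul j h) + zmul v (nmul p h)"
      using zmul_add[of "u * int j" "v * int p" h] uv by (simp add: zmul_mult zmul_of_nat)
    ultimately have "h - zmul (u * int i) g = zmul u (nmul j h - nmul i g) + zmul v (nmul p h)"
      by (intro aux)
    with mem have "h - zmul (u * int i) g \<in> H" by (simp only:)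
    with False show False unfolding mem_add_multiples_iff by blast
  qed
  with False show thesis by (rule ramified)
next
  case True
  then obtain n where n: "h - zmul n g \<in> H" by (auto simp: mem_add_multiples_iff)
  define m where "m = nat (n mod int p)"
  have p0: "0 < p" using p prime_gt_0_nat by blast
  then have m: "m < p" "int m = n mod int p" by (auto simp: m_def nat_less_iff)
  have "zmul n g = zmul (n div int p * int p + n mod int p) g" by simp
  also have "\<dots> = zmul (n div int p) (nmul p g) + nmul m g"
    unfolding zmul_add by (simp add: zmul_mult zmul_of_nat flip: m(2))
  finally have "h - nmul m g = (h - zmul n g) + zmul (n div int p) (nmul p g)" by simp
  then have hm: "h - nmul m g \<in> H" using n g add zmul by metis
  have h': "h \<in> H" if "g \<in> H" using add[OF hm nmul[OF that, of m]] by simp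
  consider "g \<in> H" | "g \<notin> H" "m = 0" | "g \<notin> H" "m = 1" | "g \<notin> H" "2 \<le> m" by linarith
  then show thesis
  proof cases
    case 1 then show ?thesis using unramified h' by blast
  next
    case 2 then show ?thesis using second hm by simp
  next
    case 3 then show ?thesis using quotient hm by simp
  next
    case 4 then show ?thesis using mixed hm m(1) by blast
  qed
qed

text \<open>Neither \<open>m\<close> nor \<open>m - 1\<close> is divisible by \<open>p\<close>: the former makes \<open>g\<close> a multiple of \<open>h\<close> modulo \<open>H\<close>, the latter
  keeps \<open>g\<close> and \<open>h\<close> from being congruent.\<close>

lemma mixed_criterion:
  assumes p: "Factorial_Ring.prime p" and g: "nmul p g \<in> H"
    and m: "g \<notin> H" "2 \<le> m" "m < p" "h - nmul m g \<in> H"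
  shows "add_multiples H g = add_multiples H h" "g - h \<notin> H"
proof -
  have "h \<in> add_multiples H g"
    unfolding mem_add_multiples_iff using m(4) by (intro exI[of _ "int m"]) (simp add: zmul_of_nat)
  moreover have "g \<in> add_multiples H h"
  proof -
    have "coprime (int m) (int p)"
      using p m by (intro coprime_less_prime) auto
    then obtain u v where uv: "u * int m + v * int p = 1"
      using bezout_int[of "int m" "int p"] by (auto simp: coprime_iff_gcd_eq_1)
    have aux: "a - d = e - c" if "a = b + e" "d = c + b" for a b c d e :: 'g
      using that by (simp add: algebra_simps)
    have mem: "zmul v (nmul p g) - zmul u (h - nmul m g) \<in> H" using diff[OF zmul[OF g, of v] zmul[OF m(4), of u]] .
    have "zmul u h = zmul u (h - nmul m g) + zmul u (nmul m g)"
      using zmul_add_right[of u "h - nmul m g" "nmul m g"] by simp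
    moreover have "g = zmul u (nmul m g) + zmul v (nmul p g)"
      using zmul_add[of "u * int m" "v * int p" g] uv by (simp add: zmul_mult zmul_of_nat)
    ultimately have "g - zmul u h = zmul v (nmul p g) - zmul u (h - nmul m g)"
      by (intro aux)
    with mem have "g - zmul u h \<in> H" by (simp only:)
    then show ?thesis unfolding mem_add_multiples_iff by blast
  qed
  ultimately show "add_multiples H g = add_multiples H h"
    using add_multiples_subset by blast
  show "g - h \<notin> H"
  proof
    assume "g - h \<in> H"
    from uminus[OF add[OF this m(4)]] have "nmul m g - g \<in> H" by simp
    moreover have "nmul m g = g + nmul (m - 1) g" using m(2) by (cases m) auto
    ultimately have "nmul (m - 1) g \<in> H" by simp
    with nmul_notin[OF p g m(1), of "m - 1"] m show False by simp
  qed
qed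

end

lemma dh_of_uminus: "dh_of (- x) = - dh_of x"
  using dh_of_add[of "- x" x] by (simp add: eq_neg_iff_add_eq_0)

lemma dh_of_diff: "dh_of (x - y) = dh_of x - dh_of y"
  using dh_of_add[of x "- y"] by (simp add: dh_of_uminus)

lemma dh_of_zmul: "dh_of (zmul m x) = zmul m (dh_of x)"
  by (simp add: zmul_def dh_of_nmul dh_of_uminus)

lemma inj_dh_of: "inj dh_of"
  by (rule injI) (metis dh_of_le_iff order_antisym order_refl)

lemma dh_of_less_iff [simp]: "dh_of x < dh_of y \<longleftrightarrow> x < y"
  by (simp add: not_le[symmetric])

lemma add_multiples_dh_of: "add_multiples (dh_of ` H) (dh_of g) = dh_of ` add_multiples H g"
  by (force simp: add_multiples_def dh_of_add dh_of_zmul)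

section \<open>The residue field of the curve\<close>

text \<open>The situation of the theorem in terms of values of elements of \<open>K\<close>. The assumptions \<open>wx\<close> and \<open>wb\<close> say that
  \<open>a x\<^sup>p\<close> and \<open>c\<close> have equal value and that \<open>b x\<close> has a larger one.\<close>

locale superelliptic = valued_field K w for K (structure) and w +
  fixes k :: "'a set" and x y a b c :: 'a and p :: nat
  assumes k: "subfield k K"
    and x: "x \<in> carrier K" and y: "y \<in> carrier K"
    and abc: "a \<in> k" "b \<in> k" "c \<in> k" "a \<noteq> \<zero>" "c \<noteq> \<zero>"
    and p: "Factorial_Ring.prime p" "odd p"
    and eq: "y [^] p = a \<otimes> x [^] p \<oplus> b \<otimes> x \<oplus> c"
    and gen: "generate_field K (insert y (generate_field K (insert x k))) = carrier K"
    and gauss: "\<And>N f j. \<lbrakk>f \<in> {..N} \<rightarrow> k; j \<le> N\<rbrakk> \<Longrightarrow>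
      w (\<Oplus>i\<in>{..N}. f i \<otimes> x [^] i) \<le> w (f j \<otimes> x [^] (j::nat))"
    and wx: "w (x [^] p) = w (c \<otimes> inv a)"
    and wb: "w c < w (b \<otimes> x)"
begin

abbreviation L where "L \<equiv> residue_subfield K w k"

definition d where "d = c \<otimes> inv a"
definition s where "s = x [^] p \<otimes> inv d"
definition q where "q = y [^] p \<otimes> inv c"

lemma k_carrier: "k \<subseteq> carrier K"
  using subringE(1)[OF subfieldE(1)[OF k]] .

lemma inv_k: "e \<in> k \<Longrightarrow> e \<noteq> \<zero> \<Longrightarrow> inv e \<in> k"
  using subfield_m_inv(1)[OF k, of e] by simp

lemma mult_k: "\<lbrakk>e \<in> k; f \<in> k\<rbrakk> \<Longrightarrow> e \<otimes> f \<in> k"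
  using subringE(6)[OF subfieldE(1)[OF k]] .

lemma pow_k: "e \<in> k \<Longrightarrow> e [^] (n::nat) \<in> k"
  using subringE(3)[OF subfieldE(1)[OF k]] mult_k by (induction n) auto

lemma abc_carrier: "a \<in> carrier K" "b \<in> carrier K" "c \<in> carrier K"
  using abc k_carrier by auto

lemma d: "d \<in> k" "d \<in> carrier K" "d \<noteq> \<zero>" "a \<otimes> d = c"
proof -
  show "d \<in> k" unfolding d_def using abc inv_k mult_k by simp
  then show "d \<in> carrier K" using k_carrier by blast
  show "d \<noteq> \<zero>" using abc abc_carrier by (simp add: d_def integral_iff)
  have "d \<otimes> a = c" using abc abc_carrier by (simp add: d_def)
  then show "a \<otimes> d = c" using abc_carrier \<open>d \<in> carrier K\<close> by (simp add: m_comm)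
qed

lemma p_pos: "0 < p" "2 \<le> p"
  using p(1) prime_ge_2_nat[of p] by auto

lemma s: "s \<in> carrier K" "w s = 0" "s \<otimes> d = x [^] p" "s \<noteq> \<zero>"
proof -
  show sc: "s \<in> carrier K" using x d by (simp add: s_def)
  show "w s = 0" using w_mult_inv[of "x [^] p" d] wx x d by (simp add: s_def flip: d_def)
  then show "s \<noteq> \<zero>" by (auto simp: zero_vext_def)
  show "s \<otimes> d = x [^] p" using x d by (simp add: s_def)
qed

lemma x_nz: "x \<noteq> \<zero>"
proof
  assume "x = \<zero>"
  then have "s \<otimes> d = \<zero>" using s(3) p_pos by (simp add: nat_pow_zero)
  from integral[OF this s(1) d(2)] s(4) d(3) show False by blast
qed

lemma L: "subfield L Kw" "L \<subseteq> carrier Kw"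
  using subfield_residue_subfield[OF k] subringE(1)[OF subfieldE(1)] by blast+

lemma residue_k: "e \<in> k \<Longrightarrow> w e = 0 \<Longrightarrow> \<rho> e \<in> L - {\<zero>\<^bsub>Kw\<^esub>}"
  using residue_nz[of e] k_carrier by (auto simp: mem_residue_subfield_iff intro!: bexI[of _ e])

text \<open>The relative algebraic closure of \<open>kv\<close> in \<open>Kw\<close>. It is a field, so that a rational function of an algebraic
  element is algebraic.\<close>

definition algs where "algs = {\<eta> \<in> carrier Kw. Kw.algebraic L \<eta>}"

lemma algs: "subfield algs Kw" "L \<subseteq> algs"
proof -
  show "subfield algs Kw" using Kw.subfield_of_algebraics[OF L(1)] by (simp add: algs_def over_def)
  show "L \<subseteq> algs" using Kw.algebraic_self[OF subfieldE(1)[OF L(1)]] L(2) by (auto simp: algs_def over_def)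
qed

lemma transcendental_s: "\<rho> s \<notin> algs"
  using gauss_transcendental_residue[OF k x p_pos(1) d(1,3) gauss] s(2)
  by (simp add: algs_def flip: s_def)

lemma residue_s: "\<rho> s \<in> carrier Kw" "\<rho> s \<noteq> \<zero>\<^bsub>Kw\<^esub>"
  using s residue_nz[of s] by auto

text \<open>Since \<open>a x\<^sup>p = c s\<close>, the element \<open>q = y\<^sup>p / c\<close> is \<open>1 + s + b x / c\<close>, and the last summand has positive value.
  The value of \<open>q\<close> is exactly \<open>0\<close>, because \<open>1 + \<xi>\<close> cannot vanish for a transcendental \<open>\<xi>\<close>.\<close>

lemma residue_q: "q \<in> carrier K" "w q = 0" "\<rho> q = \<one>\<^bsub>Kw\<^esub> \<oplus>\<^bsub>Kw\<^esub> \<rho> s"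
proof -
  show qc: "q \<in> carrier K" using y abc abc_carrier by (simp add: q_def)
  define e where "e = b \<otimes> x \<otimes> inv c"
  have ec: "e \<in> carrier K" using abc abc_carrier x by (simp add: e_def)
  have ic: "inv c \<in> carrier K" using abc abc_carrier by simp
  have "a \<otimes> x [^] p = s \<otimes> (a \<otimes> d)"
    unfolding s(3)[symmetric] by (rule m_lcomm[OF abc_carrier(1) s(1) d(2)])
  then have ax: "a \<otimes> x [^] p = s \<otimes> c" unfolding d(4) .
  have "q = s \<otimes> c \<otimes> inv c \<oplus> b \<otimes> x \<otimes> inv c \<oplus> c \<otimes> inv c"
    unfolding q_def eq ax
    using l_distr[of "s \<otimes> c \<oplus> b \<otimes> x" c "inv c"] l_distr[of "s \<otimes> c" "b \<otimes> x" "inv c"]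
      s(1) abc_carrier x ic by simp
  also have "\<dots> = (s \<oplus> e) \<oplus> \<one>"
    using s(1) abc abc_carrier by (simp add: e_def)
  finally have q: "q = (s \<oplus> e) \<oplus> \<one>" .
  have "w (\<one> \<otimes> c) < w (e \<otimes> c)"
    using wb abc abc_carrier x by (simp add: e_def)
  then have we: "0 < w e" using w_mult_less_iff[of \<one> e c] abc abc_carrier ec by simp
  have "0 \<le> w (\<one> \<oplus> s)" using subringE(7)[OF subring_O, of \<one> s] s by auto
  moreover have "(\<one> \<oplus> s) \<ominus> q = \<ominus> e" unfolding q using s(1) ec by algebra
  ultimately have r: "0 \<le> w q" "\<rho> q = \<rho> (\<one> \<oplus> s)"
    using residue_cong[of "\<one> \<oplus> s" q] s(1) qc ec we by auto
  then show req: "\<rho> q = \<one>\<^bsub>Kw\<^esub> \<oplus>\<^bsub>Kw\<^esub> \<rho> s" using residue_add[of \<one> s] s by simp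
  have "\<rho> q \<noteq> \<zero>\<^bsub>Kw\<^esub>"
  proof
    assume "\<rho> q = \<zero>\<^bsub>Kw\<^esub>"
    then have "\<rho> s = \<ominus>\<^bsub>Kw\<^esub> \<one>\<^bsub>Kw\<^esub>"
      using req residue_s(1) Kw.sum_zero_eq_neg[of "\<rho> s" "\<one>\<^bsub>Kw\<^esub>"] by (simp add: Kw.a_comm)
    then show False
      using transcendental_s subringE(3,5)[OF subfieldE(1)[OF algs(1)]] by simp
  qed
  with r(1) residue_eq_zero[OF qc] show "w q = 0" by fastforce
qed

lemma y_pow: "y [^] p = q \<otimes> c"
  using y abc abc_carrier by (simp add: q_def)

lemma y_nz: "y \<noteq> \<zero>"
proof
  assume "y = \<zero>"
  then have "q \<otimes> c = \<zero>" using y_pow p_pos by (simp add: nat_pow_zero)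
  moreover have "q \<noteq> \<zero>" using residue_q(2) by (auto simp: zero_vext_def)
  ultimately show False using residue_q(1) abc abc_carrier by (simp add: integral_iff)
qed

lemma w_y_pow: "w (y [^] p) = w c"
  using w_mult[of q c] residue_q abc_carrier by (simp add: y_pow)

text \<open>From \<open>y\<^sup>p = c q\<close> and \<open>x\<^sup>p = d s\<close> follows \<open>(y / (e x\<^sup>m))\<^sup>p s\<^sup>m = c / (e\<^sup>p d\<^sup>m) q\<close>. All other factors have value \<open>0\<close>,
  hence so has the constant \<open>c / (e\<^sup>p d\<^sup>m)\<close>.\<close>

lemma residue_curve:
  assumes e: "e \<in> k" "e \<noteq> \<zero>" and wy: "w y = w (e \<otimes> x [^] (m::nat))"
  defines "z \<equiv> y \<otimes> inv (e \<otimes> x [^] m)"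
  obtains \<kappa> where "\<kappa> \<in> L - {\<zero>\<^bsub>Kw\<^esub>}"
    "\<rho> z [^]\<^bsub>Kw\<^esub> p \<otimes>\<^bsub>Kw\<^esub> \<rho> s [^]\<^bsub>Kw\<^esub> m = \<kappa> \<otimes>\<^bsub>Kw\<^esub> (\<one>\<^bsub>Kw\<^esub> \<oplus>\<^bsub>Kw\<^esub> \<rho> s)"
    "z \<in> carrier K" "w z = 0"
proof -
  have ec: "e \<in> carrier K" using e k_carrier by blast
  define E where "E = e \<otimes> x [^] m"
  have E: "E \<in> carrier K" "E \<noteq> \<zero>" using ec e x x_nz by (auto simp: E_def integral_iff)
  have zc: "z \<in> carrier K" and zE: "z \<otimes> E = y" and wz: "w z = 0"
    using y E wy w_mult_inv[OF y E] by (simp_all add: z_def flip: E_def)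
  define M where "M = e [^] p \<otimes> d [^] m"
  have M: "M \<in> k" "M \<in> carrier K" "M \<noteq> \<zero>"
    using e ec d pow_k mult_k by (auto simp: M_def integral_iff)
  define \<kappa> where "\<kappa> = c \<otimes> inv M"
  have \<kappa>: "\<kappa> \<in> k" "\<kappa> \<in> carrier K" "\<kappa> \<otimes> M = c"
    using abc abc_carrier M inv_k mult_k by (auto simp: \<kappa>_def)
  have "E [^] p = e [^] p \<otimes> (x [^] p) [^] m"
    using ec x by (simp add: E_def nat_pow_distrib nat_pow_pow mult.commute)
  also have "\<dots> = M \<otimes> s [^] m"
    using ec d s by (simp add: M_def nat_pow_distrib m_ac flip: s(3))
  finally have Ep: "E [^] p = M \<otimes> s [^] m" .
  have "z [^] p \<otimes> E [^] p = y [^] p" using zc E by (simp add: nat_pow_distrib[symmetric] zE)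
  then have "z [^] p \<otimes> s [^] m \<otimes> M = (\<kappa> \<otimes> q) \<otimes> M"
    using zc s(1) M \<kappa>(1,2) residue_q(1) by (simp add: Ep y_pow m_ac flip: \<kappa>(3))
  then have main: "z [^] p \<otimes> s [^] m = \<kappa> \<otimes> q"
    using m_rcancel[of M "z [^] p \<otimes> s [^] m" "\<kappa> \<otimes> q"] M zc s(1) \<kappa>(2) residue_q(1) by simp
  have w1: "w (z [^] p) = 0" "w (s [^] m) = 0" using w_pow_zero zc wz s by auto
  have "w \<kappa> = 0"
    using arg_cong[OF main, of w] zc s \<kappa> residue_q w1 by (simp add: w_mult)
  moreover have "\<rho> z [^]\<^bsub>Kw\<^esub> p \<otimes>\<^bsub>Kw\<^esub> \<rho> s [^]\<^bsub>Kw\<^esub> m = \<rho> \<kappa> \<otimes>\<^bsub>Kw\<^esub> \<rho> q"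
    using arg_cong[OF main, of \<rho>] zc s \<kappa> residue_q w1 wz \<open>w \<kappa> = 0\<close>
    by (simp add: residue_mult residue_pow)
  ultimately show thesis using that[of "\<rho> \<kappa>"] residue_k[OF \<kappa>(1)] zc wz residue_q(3) by simp
qed

lemma ruledI:
  assumes "\<tau> \<in> carrier K" "w \<tau> = 0" "\<rho> \<tau> \<notin> algs"
    and "carrier Kw \<subseteq> generate_field Kw (insert (\<rho> \<tau>) L)"
  shows "ruled Kw L"
proof -
  have \<tau>: "\<rho> \<tau> \<in> carrier Kw" using assms(1,2) by simp
  then have "generate_field Kw (insert (\<rho> \<tau>) L) \<subseteq> carrier Kw"
    using L(2) by (intro Kw.generate_field_incl) auto
  moreover have "Kw.finite_dimension L L"
    using Kw.finite_dimensionI[OF Kw.dimension_one[OF L(1)]] .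
  ultimately show ?thesis
    unfolding ruled_def using assms(3,4) L(1) \<tau> by (intro exI[of _ L] exI[of _ "\<rho> \<tau>"]) (auto simp: algs_def)
qed

lemma k_insert_carrier: "u \<in> carrier K \<Longrightarrow> insert u k \<subseteq> carrier K"
  using k_carrier by simp

text \<open>For changing the generators of \<open>K\<close>.\<close>

lemma generate_field_eqI:
  assumes "subfield E K" "u \<in> carrier K" "k \<subseteq> E" "x \<in> generate_field K (insert u E)"
    "y \<in> generate_field K (insert u E)"
  shows "generate_field K (insert u E) = carrier K"
proof -
  have Ec: "insert u E \<subseteq> carrier K" using subringE(1)[OF subfieldE(1)[OF assms(1)]] assms(2) by simp
  note S = generate_field_is_subfield[OF Ec]
  have "insert x k \<subseteq> generate_field K (insert u E)"
    using assms(3,4) by (auto intro: generate_field.incl)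
  from generate_field_min_subfield1[OF k_insert_carrier[OF x] S this]
  have "insert y (generate_field K (insert x k)) \<subseteq> generate_field K (insert u E)"
    using assms(5) by simp
  from generate_field_min_subfield1[OF _ S this] generate_field_in_carrier[OF k_insert_carrier[OF x]] y gen
  show ?thesis using generate_field_incl[OF Ec] by auto
qed

text \<open>The common part of the two cases in which \<open>x\<close> is the ramified generator.\<close>

lemma ruled_if_ramified_over_transcendental:
  assumes \<tau>: "\<tau> \<in> carrier K" "w \<tau> = 0" "\<rho> \<tau> \<notin> algs"
    and gen': "generate_field K (insert x (generate_field K (insert \<tau> k))) = carrier K"
    and A: "A0 \<in> generate_field K (insert \<tau> k)" "A1 \<in> generate_field K (insert \<tau> k)"
      "A2 \<in> generate_field K (insert \<tau> k)" "A0 \<noteq> \<zero>" "A0 \<otimes> x [^] p = A1 \<otimes> x \<oplus> A2"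
    and ram: "\<And>j e. \<lbrakk>0 < j; j < p; e \<in> k - {\<zero>}\<rbrakk> \<Longrightarrow> w (x [^] (j::nat)) \<noteq> w e"
  shows "ruled Kw L"
proof (rule ruledI[OF \<tau>])
  let ?E = "generate_field K (insert \<tau> k)"
  have E: "subfield ?E K" using generate_field_is_subfield[OF k_insert_carrier[OF \<tau>(1)]] .
  have tr: "Kw.transcendental L (\<rho> \<tau>)" using \<tau> by (simp add: algs_def)
  have "w (x [^] j) \<noteq> w e" if j: "0 < j" "j < p" and e: "e \<in> ?E - {\<zero>}" for j :: nat and e
  proof -
    obtain e' where "e' \<in> k - {\<zero>}" "w e = w e'"
      using transcendental_residue_field[OF k \<tau>(1,2) tr, of e] e by blast
    with ram[OF j] show ?thesis by simp
  qed
  from ramified_extension_residue[OF E x x_nz A p_pos(2) this]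
  have "carrier Kw \<subseteq> residue_subfield K w ?E" by (simp add: gen' residue_subfield_carrier)
  also have "\<dots> \<subseteq> generate_field Kw (insert (\<rho> \<tau>) L)"
    by (rule residue_subfield_transcendental[OF k \<tau>(1,2) tr])
  finally show "carrier Kw \<subseteq> generate_field Kw (insert (\<rho> \<tau>) L)" .
qed

text \<open>Case \<open>h \<in> H\<close>: the residue \<open>\<theta>\<close> of \<open>\<tau> = y / e\<close> satisfies \<open>\<theta>\<^sup>p = \<kappa> (1 + \<xi>)\<close>, so it is transcendental, and \<open>x\<close> is ramified
  over \<open>k(y) = k(\<tau>)\<close>.\<close>

lemma ruled_if_second_coordinate:
  assumes e: "e \<in> k" "e \<noteq> \<zero>" and wy: "w y = w e"
    and ram: "\<And>j e. \<lbrakk>0 < j; j < p; e \<in> k - {\<zero>}\<rbrakk> \<Longrightarrow> w (x [^] (j::nat)) \<noteq> w e"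
  shows "ruled Kw L"
proof -
  have ec: "e \<in> carrier K" using e k_carrier by blast
  define \<tau> where "\<tau> = y \<otimes> inv e"
  have "w y = w (e \<otimes> x [^] (0::nat))" using wy ec by simp
  from residue_curve[OF e this] ec obtain \<kappa> where \<kappa>: "\<kappa> \<in> L - {\<zero>\<^bsub>Kw\<^esub>}"
    "\<rho> \<tau> [^]\<^bsub>Kw\<^esub> p = \<kappa> \<otimes>\<^bsub>Kw\<^esub> (\<one>\<^bsub>Kw\<^esub> \<oplus>\<^bsub>Kw\<^esub> \<rho> s)" and \<tau>: "\<tau> \<in> carrier K" "w \<tau> = 0"
    by (auto simp: \<tau>_def)
  have \<kappa>c: "\<kappa> \<in> carrier Kw" "\<kappa> \<in> algs" "\<kappa> \<noteq> \<zero>\<^bsub>Kw\<^esub>" using \<kappa>(1) L(2) algs(2) by auto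
  note A = subringE[OF subfieldE(1)[OF algs(1)]]
  have \<tau>t: "\<rho> \<tau> \<notin> algs"
  proof
    assume al: "\<rho> \<tau> \<in> algs"
    have pw: "\<rho> \<tau> [^]\<^bsub>Kw\<^esub> n \<in> algs" for n :: nat using al A(3,6) by (induction n) auto
    have i: "inv\<^bsub>Kw\<^esub> \<kappa> \<in> algs" "inv\<^bsub>Kw\<^esub> \<kappa> \<in> carrier Kw" "inv\<^bsub>Kw\<^esub> \<kappa> \<otimes>\<^bsub>Kw\<^esub> \<kappa> = \<one>\<^bsub>Kw\<^esub>"
      using Kw.subfield_m_inv[OF algs(1), of \<kappa>] \<kappa>c A(1) by auto
    have "inv\<^bsub>Kw\<^esub> \<kappa> \<otimes>\<^bsub>Kw\<^esub> \<rho> \<tau> [^]\<^bsub>Kw\<^esub> p = \<one>\<^bsub>Kw\<^esub> \<oplus>\<^bsub>Kw\<^esub> \<rho> s"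
      unfolding \<kappa>(2) using i \<kappa>c residue_s by (simp add: Kw.m_assoc[symmetric])
    then have "\<one>\<^bsub>Kw\<^esub> \<oplus>\<^bsub>Kw\<^esub> \<rho> s \<in> algs" using A(6)[OF i(1) pw[of p]] by simp
    then have "(\<one>\<^bsub>Kw\<^esub> \<oplus>\<^bsub>Kw\<^esub> \<rho> s) \<oplus>\<^bsub>Kw\<^esub> \<ominus>\<^bsub>Kw\<^esub> \<one>\<^bsub>Kw\<^esub> \<in> algs" using A(3,5,7) by simp
    moreover have "(\<one>\<^bsub>Kw\<^esub> \<oplus>\<^bsub>Kw\<^esub> \<rho> s) \<oplus>\<^bsub>Kw\<^esub> \<ominus>\<^bsub>Kw\<^esub> \<one>\<^bsub>Kw\<^esub> = \<rho> s"
      using residue_s by (simp add: Kw.a_comm[of "\<one>\<^bsub>Kw\<^esub>"] Kw.a_assoc Kw.r_neg)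
    ultimately show False using transcendental_s by simp
  qed
  let ?E = "generate_field K (insert \<tau> k)"
  have E: "subfield ?E K" using generate_field_is_subfield[OF k_insert_carrier[OF \<tau>(1)]] .
  note E' = subringE[OF subfieldE(1)[OF E]]
  have kE: "k \<subseteq> ?E" "\<tau> \<in> ?E" by (auto intro: generate_field.incl)
  have "y = \<tau> \<otimes> e" using y ec e by (simp add: \<tau>_def)
  then have yE: "y \<in> ?E" using E'(6) kE e by auto
  then have ypE: "y [^] n \<in> ?E" for n :: nat using E'(3,6) by (induction n) auto
  have "a \<otimes> x [^] p = \<ominus> b \<otimes> x \<oplus> (y [^] p \<oplus> \<ominus> c)"
  proof -
    define xp where "xp = x [^] p"
    have "xp \<in> carrier K" using x by (simp add: xp_def)
    then show ?thesis unfolding eq xp_def[symmetric] using abc_carrier x by algebra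
  qed
  moreover have "generate_field K (insert x ?E) = carrier K"
    using yE kE by (intro generate_field_eqI[OF E x]) (auto intro: generate_field.incl)
  ultimately show ?thesis
    using E'(5,7) kE(1) abc ypE by (intro ruled_if_ramified_over_transcendental[OF \<tau> \<tau>t, of a "\<ominus> b" "y [^] p \<oplus> \<ominus> c"] ram) auto
qed

text \<open>Case \<open>h - g \<in> H\<close>: the residue \<open>\<theta>\<close> of \<open>\<tau> = y / (e x)\<close> satisfies \<open>\<theta>\<^sup>p \<xi> = \<kappa> (1 + \<xi>)\<close>, which can be solved for \<open>\<xi>\<close>, so
  \<open>\<theta>\<close> is transcendental. As \<open>y = \<tau> e x\<close>, the element \<open>x\<close> is a root of a trinomial over \<open>k(\<tau>)\<close> as well.\<close>

lemma ruled_if_quotient: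
  assumes e: "e \<in> k" "e \<noteq> \<zero>" and wy: "w y = w (e \<otimes> x)"
    and ram: "\<And>j e. \<lbrakk>0 < j; j < p; e \<in> k - {\<zero>}\<rbrakk> \<Longrightarrow> w (x [^] (j::nat)) \<noteq> w e"
  shows "ruled Kw L"
proof -
  have ec: "e \<in> carrier K" using e k_carrier by blast
  define \<tau> where "\<tau> = y \<otimes> inv (e \<otimes> x)"
  have ex: "e \<otimes> x \<in> carrier K" "e \<otimes> x \<noteq> \<zero>" using ec e x x_nz by (auto simp: integral_iff)
  have "w y = w (e \<otimes> x [^] (1::nat))" using wy x by simp
  from residue_curve[OF e this] x residue_s obtain \<kappa> where \<kappa>: "\<kappa> \<in> L - {\<zero>\<^bsub>Kw\<^esub>}"
    "\<rho> \<tau> [^]\<^bsub>Kw\<^esub> p \<otimes>\<^bsub>Kw\<^esub> \<rho> s = \<kappa> \<otimes>\<^bsub>Kw\<^esub> (\<one>\<^bsub>Kw\<^esub> \<oplus>\<^bsub>Kw\<^esub> \<rho> s)" and \<tau>: "\<tau> \<in> carrier K" "w \<tau> = 0"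
    by (auto simp: \<tau>_def)
  have \<kappa>c: "\<kappa> \<in> carrier Kw" "\<kappa> \<in> algs" "\<kappa> \<noteq> \<zero>\<^bsub>Kw\<^esub>" using \<kappa>(1) L(2) algs(2) by auto
  note A = subringE[OF subfieldE(1)[OF algs(1)]]
  have \<tau>t: "\<rho> \<tau> \<notin> algs"
  proof
    assume al: "\<rho> \<tau> \<in> algs"
    define \<eta> where "\<eta> = \<rho> \<tau> [^]\<^bsub>Kw\<^esub> p \<oplus>\<^bsub>Kw\<^esub> \<ominus>\<^bsub>Kw\<^esub> \<kappa>"
    have pw: "\<rho> \<tau> [^]\<^bsub>Kw\<^esub> n \<in> algs" for n :: nat using al A(3,6) by (induction n) auto
    have pc: "\<rho> \<tau> [^]\<^bsub>Kw\<^esub> p \<in> carrier Kw" using \<tau> by simp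
    have \<eta>: "\<eta> \<in> algs" "\<eta> \<in> carrier Kw" using pw[of p] \<kappa>c A(1,5,7) by (auto simp: \<eta>_def)
    have "\<eta> \<otimes>\<^bsub>Kw\<^esub> \<rho> s = \<kappa> \<otimes>\<^bsub>Kw\<^esub> (\<one>\<^bsub>Kw\<^esub> \<oplus>\<^bsub>Kw\<^esub> \<rho> s) \<oplus>\<^bsub>Kw\<^esub> \<ominus>\<^bsub>Kw\<^esub> (\<kappa> \<otimes>\<^bsub>Kw\<^esub> \<rho> s)"
      unfolding \<eta>_def \<kappa>(2)[symmetric] using pc \<kappa>c residue_s by (simp add: Kw.l_distr Kw.l_minus)
    also have "\<dots> = \<kappa>"
      using \<kappa>c residue_s by (simp add: Kw.r_distr Kw.a_assoc Kw.r_neg)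
    finally have \<eta>s: "\<eta> \<otimes>\<^bsub>Kw\<^esub> \<rho> s = \<kappa>" .
    with \<kappa>c residue_s have \<eta>0: "\<eta> \<noteq> \<zero>\<^bsub>Kw\<^esub>" by auto
    have i: "inv\<^bsub>Kw\<^esub> \<eta> \<in> algs" "inv\<^bsub>Kw\<^esub> \<eta> \<in> carrier Kw" "inv\<^bsub>Kw\<^esub> \<eta> \<otimes>\<^bsub>Kw\<^esub> \<eta> = \<one>\<^bsub>Kw\<^esub>"
      using Kw.subfield_m_inv[OF algs(1), of \<eta>] \<eta> \<eta>0 A(1) by auto
    have "\<rho> s = inv\<^bsub>Kw\<^esub> \<eta> \<otimes>\<^bsub>Kw\<^esub> \<kappa>"
      unfolding \<eta>s[symmetric] using i \<eta> residue_s by (simp add: Kw.m_assoc[symmetric])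
    with A(6)[OF i(1) \<kappa>c(2)] transcendental_s show False by simp
  qed
  let ?E = "generate_field K (insert \<tau> k)"
  have E: "subfield ?E K" using generate_field_is_subfield[OF k_insert_carrier[OF \<tau>(1)]] .
  note E' = subringE[OF subfieldE(1)[OF E]]
  have kE: "k \<subseteq> ?E" "\<tau> \<in> ?E" by (auto intro: generate_field.incl)
  define v where "v = (\<tau> \<otimes> e) [^] p"
  have vE: "v \<in> ?E"
  proof -
    have "\<tau> \<otimes> e \<in> ?E" using E'(6) kE e by auto
    then have "(\<tau> \<otimes> e) [^] n \<in> ?E" for n :: nat using E'(3,6) by (induction n) auto
    then show ?thesis by (simp add: v_def)
  qed
  have vc: "v \<in> carrier K" using \<tau> ec by (simp add: v_def)
  have ytx: "y = \<tau> \<otimes> e \<otimes> x" using y ex \<tau> ec x by (simp add: \<tau>_def m_assoc)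
  have "v \<otimes> x [^] p = y [^] p" unfolding v_def ytx using \<tau> ec x by (simp add: nat_pow_distrib)
  moreover define xp where "xp = x [^] p"
  moreover have xpc: "xp \<in> carrier K" using x by (simp add: xp_def)
  ultimately have vX: "v \<otimes> xp = a \<otimes> xp \<oplus> b \<otimes> x \<oplus> c" using eq by simp
  have "(v \<oplus> \<ominus> a) \<otimes> xp = v \<otimes> xp \<oplus> \<ominus> (a \<otimes> xp)" using vc xpc abc_carrier by (simp add: l_distr l_minus)
  also have "\<dots> = b \<otimes> x \<oplus> c" unfolding vX using abc_carrier x xpc by algebra
  finally have eq': "(v \<oplus> \<ominus> a) \<otimes> xp = b \<otimes> x \<oplus> c" .
  \<comment> \<open>The leading coefficient of the trinomial is nonzero, because \<open>c\<close> dominates \<open>b x + c\<close>.\<close>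
  have "w (c \<oplus> b \<otimes> x) = w c" using wb abc_carrier x by (intro w_add_eq) auto
  then have "b \<otimes> x \<oplus> c \<noteq> \<zero>"
    using abc abc_carrier x w_eq_Infty_iff[of c] by (auto simp: a_comm)
  with eq' xpc have "v \<oplus> \<ominus> a \<noteq> \<zero>" by auto
  moreover have "generate_field K (insert x ?E) = carrier K"
  proof (rule generate_field_eqI[OF E x])
    have G: "subfield (generate_field K (insert x ?E)) K"
      using E'(1) x by (intro generate_field_is_subfield) auto
    have inc: "x \<in> generate_field K (insert x ?E)" "\<tau> \<in> generate_field K (insert x ?E)" "e \<in> generate_field K (insert x ?E)"
      using kE e by (auto intro: generate_field.incl)
    then show "y \<in> generate_field K (insert x ?E)"
      unfolding ytx by (intro subringE(6)[OF subfieldE(1)[OF G]])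
    show "x \<in> generate_field K (insert x ?E)" by (rule inc)
  qed (rule kE)
  ultimately show ?thesis
    using E'(5,7) kE(1) abc vE eq'
    by (intro ruled_if_ramified_over_transcendental[OF \<tau> \<tau>t, of "v \<oplus> \<ominus> a" b c] ram) (auto simp: xp_def)
qed

text \<open>If \<open>x\<close> has the value of a constant \<open>e\<close>, then \<open>k(x) = k(\<tau>)\<close> for \<open>\<tau> = x / e\<close>. Otherwise \<open>x\<close> is ramified over
  \<open>k(s) = k(x\<^sup>p)\<close>, and \<open>k(x)\<close> has the same residue field as \<open>k(s)\<close>.\<close>

lemma residue_rational_field:
  assumes "(\<exists>e\<in>k - {\<zero>}. w x = w e) \<or> (\<forall>j e. 0 < j \<longrightarrow> j < p \<longrightarrow> e \<in> k - {\<zero>} \<longrightarrow> w (x [^] (j::nat)) \<noteq> w e)"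
  obtains \<tau> where "\<tau> \<in> carrier K" "w \<tau> = 0" "\<rho> \<tau> \<notin> algs"
    "residue_subfield K w (generate_field K (insert x k)) \<subseteq> generate_field Kw (insert (\<rho> \<tau>) L)"
    "\<And>f. \<lbrakk>f \<in> generate_field K (insert x k); f \<noteq> \<zero>\<rbrakk> \<Longrightarrow> \<exists>e\<in>k - {\<zero>}. \<exists>i. w f = w (e \<otimes> x [^] (i::nat))"
  using assms
proof
  assume "\<exists>e\<in>k - {\<zero>}. w x = w e"
  then obtain e where e: "e \<in> k" "e \<noteq> \<zero>" "w x = w e" by blast
  then have ec: "e \<in> carrier K" using k_carrier by blast
  define \<tau> where "\<tau> = x \<otimes> inv e"
  have \<tau>: "\<tau> \<in> carrier K" "w \<tau> = 0" using x ec e w_mult_inv by (auto simp: \<tau>_def)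
  have tr: "Kw.transcendental L (\<rho> \<tau>)"
    using gauss_transcendental_residue[OF k x _ e(1,2) gauss, of 1] \<tau> x by (simp add: \<tau>_def)
  let ?E = "generate_field K (insert \<tau> k)"
  have E: "subfield ?E K" using generate_field_is_subfield[OF k_insert_carrier[OF \<tau>(1)]] .
  have kE: "k \<subseteq> ?E" "\<tau> \<in> ?E" by (auto intro: generate_field.incl)
  have "x = \<tau> \<otimes> e" using x ec e by (simp add: \<tau>_def)
  then have "x \<in> ?E" using subringE(6)[OF subfieldE(1)[OF E]] kE e by auto
  then have sub: "generate_field K (insert x k) \<subseteq> ?E"
    using kE by (intro generate_field_min_subfield1[OF k_insert_carrier[OF x] E]) auto
  show thesis
  proof (rule that[OF \<tau>])
    show "\<rho> \<tau> \<notin> algs" using tr by (simp add: algs_def)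
    show "residue_subfield K w (generate_field K (insert x k)) \<subseteq> generate_field Kw (insert (\<rho> \<tau>) L)"
      using residue_subfield_transcendental[OF k \<tau> tr] sub by (auto simp: residue_subfield_def)
    fix f assume "f \<in> generate_field K (insert x k)" "f \<noteq> \<zero>"
    then obtain d where "d \<in> k - {\<zero>}" "w f = w d"
      using transcendental_residue_field[OF k \<tau> tr, of f] sub by blast
    moreover from this have "d \<otimes> x [^] (0::nat) = d" using k_carrier by auto
    ultimately show "\<exists>e\<in>k - {\<zero>}. \<exists>i. w f = w (e \<otimes> x [^] (i::nat))" by metis
  qed
next
  assume ram: "\<forall>j e. 0 < j \<longrightarrow> j < p \<longrightarrow> e \<in> k - {\<zero>} \<longrightarrow> w (x [^] (j::nat)) \<noteq> w e"
  have tr: "Kw.transcendental L (\<rho> s)" using transcendental_s residue_s by (simp add: algs_def)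
  let ?E = "generate_field K (insert s k)"
  have E: "subfield ?E K" using generate_field_is_subfield[OF k_insert_carrier[OF s(1)]] .
  note E' = subringE[OF subfieldE(1)[OF E]]
  have kE: "k \<subseteq> ?E" "s \<in> ?E" by (auto intro: generate_field.incl)
  have sdE: "s \<otimes> d \<in> ?E" using E'(6) kE d by auto
  have eq1: "\<one> \<otimes> x [^] p = \<zero> \<otimes> x \<oplus> s \<otimes> d" using x s d by simp
  have ram': "w (x [^] j) \<noteq> w e" if j: "0 < j" "j < p" and e: "e \<in> ?E - {\<zero>}" for j :: nat and e
  proof -
    obtain e' where "e' \<in> k - {\<zero>}" "w e = w e'"
      using transcendental_residue_field[OF k s(1,2) tr, of e] e by blast
    with ram j show ?thesis by simp
  qed
  have "insert x k \<subseteq> generate_field K (insert x ?E)"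
    using kE by (auto intro: generate_field.incl)
  then have sub: "generate_field K (insert x k) \<subseteq> generate_field K (insert x ?E)"
    using E'(1) x by (intro generate_field_min_subfield1[OF k_insert_carrier[OF x]] generate_field_is_subfield) auto
  show thesis
  proof (rule that[OF s(1,2) transcendental_s])
    show "residue_subfield K w (generate_field K (insert x k)) \<subseteq> generate_field Kw (insert (\<rho> s) L)"
      using residue_subfield_transcendental[OF k s(1,2) tr] sub
        ramified_extension_residue[OF E x x_nz E'(3) E'(2) sdE one_not_zero eq1 p_pos(2) ram']
      by (auto simp: residue_subfield_def)
    fix f assume f: "f \<in> generate_field K (insert x k)" "f \<noteq> \<zero>"
    then have fE: "f \<in> generate_field K (insert x ?E)" using sub by blast
    have "\<exists>e\<in>?E - {\<zero>}. \<exists>i<p. w f < w (f \<ominus> e \<otimes> x [^] i)"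
      by (rule ramified_extension[OF E x x_nz E'(3) E'(2) sdE one_not_zero eq1 p_pos(2) _ fE f(2)])
        (rule ram')
    then obtain e and i :: nat where e: "e \<in> ?E" "e \<noteq> \<zero>" "w f < w (f \<ominus> e \<otimes> x [^] i)"
      by blast
    have ec: "e \<in> carrier K" "f \<in> carrier K"
      using e(1) E'(1) generate_field_in_carrier[OF k_insert_carrier[OF x] f(1)] by auto
    have wf: "w f = w (e \<otimes> x [^] i)" using w_eq_of_w_diff[OF ec(2) _ e(3)] ec x
      by (metis m_closed nat_pow_closed)
    obtain u where u: "u \<in> k - {\<zero>}" "w e = w u"
      using transcendental_residue_field[OF k s(1,2) tr e(1,2)] by blast
    have "w f = w (u \<otimes> x [^] i)" using wf u k_carrier ec x by (auto simp: w_mult)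
    with u(1) show "\<exists>e\<in>k - {\<zero>}. \<exists>i. w f = w (e \<otimes> x [^] (i::nat))" by blast
  qed
qed

lemma ruled_if_ramified:
  assumes x_alt: "(\<exists>e\<in>k - {\<zero>}. w x = w e) \<or> (\<forall>j e. 0 < j \<longrightarrow> j < p \<longrightarrow> e \<in> k - {\<zero>} \<longrightarrow> w (x [^] (j::nat)) \<noteq> w e)"
    and ram: "\<And>j i e. \<lbrakk>0 < j; j < p; e \<in> k - {\<zero>}\<rbrakk> \<Longrightarrow> w (y [^] (j::nat)) \<noteq> w (e \<otimes> x [^] (i::nat))"
  shows "ruled Kw L"
proof -
  obtain \<tau> where \<tau>: "\<tau> \<in> carrier K" "w \<tau> = 0" "\<rho> \<tau> \<notin> algs"
    and res: "residue_subfield K w (generate_field K (insert x k)) \<subseteq> generate_field Kw (insert (\<rho> \<tau>) L)"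
    and val: "\<And>f. \<lbrakk>f \<in> generate_field K (insert x k); f \<noteq> \<zero>\<rbrakk> \<Longrightarrow> \<exists>e\<in>k - {\<zero>}. \<exists>i. w f = w (e \<otimes> x [^] (i::nat))"
    using residue_rational_field[OF x_alt] by blast
  let ?E = "generate_field K (insert x k)"
  have E: "subfield ?E K" using generate_field_is_subfield[OF k_insert_carrier[OF x]] .
  note E' = subringE[OF subfieldE(1)[OF E]]
  have kE: "k \<subseteq> ?E" "x \<in> ?E" by (auto intro: generate_field.incl)
  have xpE: "x [^] n \<in> ?E" for n :: nat using E'(3,6) kE by (induction n) auto
  have ypE: "y [^] p \<in> ?E" unfolding eq by (intro E'(6,7) xpE kE(2)) (use kE(1) abc in auto)
  have eq1: "\<one> \<otimes> y [^] p = \<zero> \<otimes> y \<oplus> y [^] p" using y by simp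
  have "w (y [^] j) \<noteq> w f" if j: "0 < j" "j < p" and f: "f \<in> ?E - {\<zero>}" for j :: nat and f
  proof -
    obtain e i where "e \<in> k - {\<zero>}" "w f = w (e \<otimes> x [^] (i::nat))" using val[of f] f by blast
    with ram[OF j] show ?thesis by simp
  qed
  from ramified_extension_residue[OF E y y_nz E'(3) E'(2) ypE one_not_zero eq1 p_pos(2) this]
  have "carrier Kw \<subseteq> residue_subfield K w ?E" by (simp add: gen residue_subfield_carrier)
  with res show ?thesis by (intro ruledI[OF \<tau>]) auto
qed

text \<open>If \<open>x\<close> and \<open>y\<close> have values of constants, \<open>\<xi>\<close> is a constant times the \<open>p\<close>-th power of the residue \<open>u\<close> of \<open>x / e\<close>, and
  \<open>residue_curve\<close> with \<open>m = 0\<close> turns into \<open>\<zeta>\<^sup>p = \<alpha> u\<^sup>p + \<beta>\<close>.\<close>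

lemma residue_s_mem_if_no_parametrization:
  assumes char: "[p] \<cdot>\<^bsub>Kw\<^esub> \<one>\<^bsub>Kw\<^esub> \<noteq> \<zero>\<^bsub>Kw\<^esub>"
    and M: "subfield M Kw" "L \<subseteq> M" and t: "t \<in> carrier Kw" "Kw.transcendental M t"
    and gent: "generate_field Kw (insert t M) = carrier Kw"
    and vals: "(\<exists>e\<in>k - {\<zero>}. \<exists>f\<in>k - {\<zero>}. w x = w e \<and> w y = w f) \<or>
      (\<exists>e\<in>k - {\<zero>}. \<exists>m. 2 \<le> m \<and> m < p \<and> w y = w (e \<otimes> x [^] (m::nat)))"
  shows "\<rho> s \<in> M"
proof -
  have np: "no_parametrization Kw M" by (rule no_parametrization_subfield[OF field_Kw M(1)])
  note np' = np[unfolded no_parametrization_def, rule_format, OF t gent p char]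
  note M' = subringE[OF subfieldE(1)[OF M(1)]]
  from vals show ?thesis
  proof
    assume "\<exists>e\<in>k - {\<zero>}. \<exists>f\<in>k - {\<zero>}. w x = w e \<and> w y = w f"
    then obtain e f where e: "e \<in> k" "e \<noteq> \<zero>" "w x = w e" and f: "f \<in> k" "f \<noteq> \<zero>" "w y = w f" by blast
    have ec: "e \<in> carrier K" "f \<in> carrier K" using e f k_carrier by auto
    have "w y = w (f \<otimes> x [^] (0::nat))" using f ec by simp
    define z where "z = y \<otimes> inv f"
    from residue_curve[OF f(1,2) \<open>w y = w (f \<otimes> x [^] (0::nat))\<close>] ec obtain \<kappa> where \<kappa>: "\<kappa> \<in> L - {\<zero>\<^bsub>Kw\<^esub>}"
      "\<rho> z [^]\<^bsub>Kw\<^esub> p = \<kappa> \<otimes>\<^bsub>Kw\<^esub> (\<one>\<^bsub>Kw\<^esub> \<oplus>\<^bsub>Kw\<^esub> \<rho> s)" and z: "z \<in> carrier K" "w z = 0"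
      by (auto simp: z_def)
    have \<kappa>c: "\<kappa> \<in> carrier Kw" using \<kappa>(1) L(2) by blast
    define u where "u = x \<otimes> inv e"
    have u: "u \<in> carrier K" "w u = 0" "u \<otimes> e = x" using x ec e w_mult_inv by (auto simp: u_def)
    define l where "l = e [^] p \<otimes> inv d"
    have l: "l \<in> k" "l \<in> carrier K" using e d pow_k inv_k mult_k k_carrier by (auto simp: l_def)
    have "s = (u \<otimes> e) [^] p \<otimes> inv d" by (simp add: s_def u(3))
    also have "\<dots> = l \<otimes> u [^] p"
      using u(1) ec d by (simp add: l_def nat_pow_distrib m_ac)
    finally have sl: "s = l \<otimes> u [^] p" .
    have up: "w (u [^] p) = 0" using w_pow_zero u by blast
    have upc: "u [^] p \<in> carrier K" using u(1) by simp
    have "w l = 0" using w_mult[OF l(2) upc] up s(2) unfolding sl by simp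
    then have rl: "\<rho> l \<in> L - {\<zero>\<^bsub>Kw\<^esub>}" using residue_k l by blast
    then have rlc: "\<rho> l \<in> carrier Kw" using L(2) by blast
    have rs: "\<rho> s = \<rho> l \<otimes>\<^bsub>Kw\<^esub> \<rho> u [^]\<^bsub>Kw\<^esub> p"
      unfolding sl residue_pow[OF u(1,2), symmetric]
      using \<open>w l = 0\<close> up by (intro residue_mult l(2) upc) auto
    have zu: "\<rho> z \<in> carrier Kw" "\<rho> u \<in> carrier Kw" using z u by simp_all
    then have uc: "\<rho> u [^]\<^bsub>Kw\<^esub> p \<in> carrier Kw" by simp
    have "\<rho> z [^]\<^bsub>Kw\<^esub> p = (\<kappa> \<otimes>\<^bsub>Kw\<^esub> \<rho> l) \<otimes>\<^bsub>Kw\<^esub> \<rho> u [^]\<^bsub>Kw\<^esub> p \<oplus>\<^bsub>Kw\<^esub> \<kappa>"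
      unfolding \<kappa>(2) rs using \<kappa>c rlc uc by (simp add: Kw.r_distr Kw.m_assoc Kw.a_comm)
    moreover have "\<kappa> \<otimes>\<^bsub>Kw\<^esub> \<rho> l \<in> M - {\<zero>\<^bsub>Kw\<^esub>}"
      using \<kappa> rl \<kappa>c rlc M(2) M'(6)[of \<kappa> "\<rho> l"] by (auto simp: Kw.integral_iff)
    moreover have "\<kappa> \<in> M - {\<zero>\<^bsub>Kw\<^esub>}" using \<kappa>(1) M(2) by blast
    ultimately have uM: "\<rho> u \<in> M" using conjunct1[OF np'[OF _ _ zu]] by blast
    have "\<rho> u [^]\<^bsub>Kw\<^esub> n \<in> M" for n :: nat using M'(3,6) uM by (induction n) auto
    then show ?thesis unfolding rs using rl M(2) by (intro M'(6)) auto
  next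
    assume "\<exists>e\<in>k - {\<zero>}. \<exists>m. 2 \<le> m \<and> m < p \<and> w y = w (e \<otimes> x [^] (m::nat))"
    then obtain e m where e: "e \<in> k" "e \<noteq> \<zero>" "w y = w (e \<otimes> x [^] m)" and m: "2 \<le> m" "m < p" by blast
    from residue_curve[OF e] obtain \<kappa> z where \<kappa>: "\<kappa> \<in> L - {\<zero>\<^bsub>Kw\<^esub>}"
      "\<rho> z [^]\<^bsub>Kw\<^esub> p \<otimes>\<^bsub>Kw\<^esub> \<rho> s [^]\<^bsub>Kw\<^esub> m = \<kappa> \<otimes>\<^bsub>Kw\<^esub> (\<one>\<^bsub>Kw\<^esub> \<oplus>\<^bsub>Kw\<^esub> \<rho> s)"
      and z: "z \<in> carrier K" "w z = 0" by metis
    have \<kappa>M: "\<kappa> \<in> M - {\<zero>\<^bsub>Kw\<^esub>}" using \<kappa>(1) M(2) by blast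
    have "\<rho> z \<in> carrier Kw" using z by simp
    from conjunct2[OF np'[OF \<kappa>M \<kappa>M this residue_s(1)]] m \<kappa>(2) show ?thesis by blast
  qed
qed

lemma not_ruled:
  assumes char: "[p] \<cdot>\<^bsub>Kw\<^esub> \<one>\<^bsub>Kw\<^esub> \<noteq> \<zero>\<^bsub>Kw\<^esub>"
    and vals: "(\<exists>e\<in>k - {\<zero>}. \<exists>f\<in>k - {\<zero>}. w x = w e \<and> w y = w f) \<or>
      (\<exists>e\<in>k - {\<zero>}. \<exists>m. 2 \<le> m \<and> m < p \<and> w y = w (e \<otimes> x [^] (m::nat)))"
  shows "\<not> ruled Kw L"
proof
  assume "ruled Kw L"
  then obtain M t where M: "subfield M Kw" "L \<subseteq> M" "Kw.finite_dimension L M"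
    "t \<in> carrier Kw" "Kw.transcendental M t" "generate_field Kw (insert t M) = carrier Kw"
    unfolding ruled_def by blast
  have "\<rho> s \<in> M" using residue_s_mem_if_no_parametrization[OF char M(1,2,4-6) vals] .
  then have "Kw.algebraic L (\<rho> s)"
    using Kw.finite_dimension_imp_algebraic[OF L(1) subfieldE(1)[OF M(1)] M(3)] by (simp add: over_def)
  with transcendental_s residue_s show False by (simp add: algs_def)
qed

end

section \<open>The criterion\<close>

lemma (in valued_field) residue_nat:
  "0 \<le> w ([n] \<cdot> \<one>) \<and> \<rho> ([n] \<cdot> \<one>) = [n] \<cdot>\<^bsub>Kw\<^esub> \<one>\<^bsub>Kw\<^esub>" for n :: nat
proof (induction n)
  case 0
  show ?case using residue_eq_zero[of \<zero>] by (simp add: zero_vext_def)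
next
  case (Suc n)
  then show ?case
    using residue_add[of "[n] \<cdot> \<one>" \<one>] subringE(7)[OF subring_O, of "[n] \<cdot> \<one>" \<one>] by auto
qed

text \<open>If \<open>p\<close> vanishes in \<open>Kw\<close>, then \<open>p\<close> times \<open>1\<close> has positive value, also with respect to \<open>v\<close>. So \<open>p\<close> vanishes in
  the residue field of \<open>k\<close> and, being prime, is its characteristic.\<close>

lemma (in valued_field) residue_char_transfer:
  assumes k: "subfield k K" and v: "valuation (K\<lparr>carrier := k\<rparr>) v" "\<And>u. u \<in> k \<Longrightarrow> w u = v u"
    and p: "Factorial_Ring.prime p" "p \<noteq> ring_char (residue_field (K\<lparr>carrier := k\<rparr>) v)"
  shows "[p] \<cdot>\<^bsub>Kw\<^esub> \<one>\<^bsub>Kw\<^esub> \<noteq> \<zero>\<^bsub>Kw\<^esub>"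
proof
  assume "[p] \<cdot>\<^bsub>Kw\<^esub> \<one>\<^bsub>Kw\<^esub> = \<zero>\<^bsub>Kw\<^esub>"
  then have pos: "0 < w ([p] \<cdot> \<one>)" using residue_nat[of p] residue_eq_zero_iff[of "[p] \<cdot> \<one>"] by simp
  interpret V: valued_field "K\<lparr>carrier := k\<rparr>" v
    using subfield_iff(2)[OF k] v(1) by (simp add: valued_field_def valued_field_axioms_def)
  have nk: "[n] \<cdot> \<one> \<in> k" for n :: nat
    using subringE(2,3,7)[OF subfieldE(1)[OF k]] by (induction n) auto
  have same: "[n] \<cdot>\<^bsub>K\<lparr>carrier := k\<rparr>\<^esub> \<one>\<^bsub>K\<lparr>carrier := k\<rparr>\<^esub> = [n] \<cdot> \<one>" for n :: nat
    by (induction n) simp_all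
  have "0 < v ([p] \<cdot>\<^bsub>K\<lparr>carrier := k\<rparr>\<^esub> \<one>\<^bsub>K\<lparr>carrier := k\<rparr>\<^esub>)"
    unfolding same using pos v(2)[OF nk] by simp
  then have "[p] \<cdot>\<^bsub>V.Kw\<^esub> \<one>\<^bsub>V.Kw\<^esub> = \<zero>\<^bsub>V.Kw\<^esub>"
    using V.residue_nat[of p] V.residue_eq_zero[of "[p] \<cdot>\<^bsub>K\<lparr>carrier := k\<rparr>\<^esub> \<one>\<^bsub>K\<lparr>carrier := k\<rparr>\<^esub>"]
      V.add.nat_pow_closed[OF V.one_closed, of p] by simp
  then have "V.Kw.add.ord \<one>\<^bsub>V.Kw\<^esub> dvd p"
    using V.Kw.add.pow_eq_id[of "\<one>\<^bsub>V.Kw\<^esub>" p] by simp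
  then have "V.Kw.add.ord \<one>\<^bsub>V.Kw\<^esub> = 1 \<or> V.Kw.add.ord \<one>\<^bsub>V.Kw\<^esub> = p"
    using p(1) prime_nat_iff by blast
  moreover have "V.Kw.add.ord \<one>\<^bsub>V.Kw\<^esub> \<noteq> 1"
    using V.Kw.add.pow_eq_id[of "\<one>\<^bsub>V.Kw\<^esub>" 1] by auto
  ultimately show False using p(2) by (simp add: ring_char_def)
qed

lemma vhull_simps [simp]: "vhull (Fin g) = Fin (dh_of g)" "vhull Infty = Infty"
  by (simp_all add: vhull_def)

lemma vdiv_simps [simp]: "vdiv n (Fin g) = Fin (dh_frac g n)" "vdiv n Infty = Infty"
  by (simp_all add: vdiv_def)

lemma dh_of_eq_iff [simp]: "dh_of g = dh_of h \<longleftrightarrow> g = h"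
  using inj_dh_of by (auto dest: injD)

lemma vhull_le_iff: "vhull s \<le> vhull t \<longleftrightarrow> s \<le> t"
  by (cases s; cases t) auto

lemma gauss_extension_le:
  assumes g: "gauss_extension K k v x \<gamma> w" and f: "f \<in> {..n} \<rightarrow> k" and j: "j \<le> n"
  shows "vhull (w (\<Oplus>\<^bsub>K\<^esub>i\<in>{..n}. f i \<otimes>\<^bsub>K\<^esub> x [^]\<^bsub>K\<^esub> i)) \<le> vhull (v (f j)) + Fin (nmul j \<gamma>)"
proof -
  have "vhull (w (\<Oplus>\<^bsub>K\<^esub>i\<in>{..n}. f i \<otimes>\<^bsub>K\<^esub> x [^]\<^bsub>K\<^esub> i)) = (MIN i\<in>{..n}. vhull (v (f i)) + Fin (nmul i \<gamma>))"
    using g f unfolding gauss_extension_def by blast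
  also have "\<dots> \<le> vhull (v (f j)) + Fin (nmul j \<gamma>)"
    using j by (intro Min_le) auto
  finally show ?thesis .
qed

text \<open>The Gauss formula for the polynomial \<open>X\<close> itself.\<close>

lemma (in valued_field) gauss_extension_value:
  assumes g: "gauss_extension K k v x \<gamma> w" and k: "subfield k K" and x: "x \<in> carrier K"
  obtains g where "w x = Fin g" "\<gamma> = dh_of g"
proof -
  define f where "f i = (if i = 1 then \<one> else \<zero>)" for i :: nat
  have fk: "f \<in> {..n} \<rightarrow> k" for n
    using subringE(2,3)[OF subfieldE(1)[OF k]] by (auto simp: f_def)
  have at: "{..Suc 0} = {0, Suc 0}" by auto
  have "(\<Oplus>i\<in>{..Suc 0}. f i \<otimes> x [^] i) = x"
    unfolding at using x by (simp add: f_def)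
  moreover have "vhull (w (\<Oplus>i\<in>{..Suc 0}. f i \<otimes> x [^] i)) = (MIN i\<in>{..Suc 0}. vhull (v (f i)) + Fin (nmul i \<gamma>))"
    using g fk unfolding gauss_extension_def by blast
  moreover have "v \<one> = 0" "v \<zero> = Infty"
    using g subringE(2,3)[OF subfieldE(1)[OF k]] w_one w_zero unfolding gauss_extension_def by metis+
  ultimately have "vhull (w x) = Fin \<gamma>"
    unfolding at by (simp add: f_def zero_vext_def min_def)
  with that show thesis by (cases "w x") auto
qed

theorem proposition1p4:
  fixes K (structure)
    and k :: "'a set"
    and x y a b c :: 'a
    and p :: nat
    and v w :: "'a \<Rightarrow> 'g::linordered_ab_group_add vext"
    and \<gamma> \<delta> :: "'g divhull"
    and vk :: "'g divhull set"
  assumes "field K"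
    and "subfield k K"
    and "x \<in> carrier K" and "ring.transcendental K k x"
    and "Factorial_Ring.prime p" and "odd p" and "p \<noteq> ring_char (K\<lparr>carrier := k\<rparr>)"
    and "a \<in> k" and "b \<in> k" and "c \<in> k" and "a \<noteq> \<zero>"
    and "y \<in> carrier K"
    and "y [^] p = a \<otimes> x [^] p \<oplus> b \<otimes> x \<oplus> c"
    and "generate_field K (insert y (generate_field K (insert x k))) = carrier K"
    and "\<exists>\<zeta>\<in>k. \<zeta> [^] p = \<one> \<and> (\<forall>i. 0 < i \<and> i < p \<longrightarrow> \<zeta> [^] i \<noteq> \<one>)"
    and "valuation (K\<lparr>carrier := k\<rparr>) v"
    and "p \<noteq> ring_char (residue_field (K\<lparr>carrier := k\<rparr>) v)"
    and "vdiv (p - 1) (v (b \<otimes> inv a)) > vdiv p (v (c \<otimes> inv a))"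
    and "Fin \<gamma> = vdiv p (v (c \<otimes> inv a))"
    and "Fin \<delta> = vdiv p (v c)"
    and "vk = dh_of ` value_group (K\<lparr>carrier := k\<rparr>) v"
    and "gauss_extension K k v x \<gamma> w"
  shows "\<not> ruled (residue_field K w) (residue_subfield K w k) \<longleftrightarrow>
     add_multiples vk \<gamma> = add_multiples vk \<delta> \<and>
     (\<gamma> \<notin> vk \<longrightarrow> \<gamma> - \<delta> \<notin> vk)"
proof -
  note k = assms(2) and x = assms(3) and p = assms(5,6) and abc = assms(8-11) and y = assms(12)
    and eq = assms(13) and gen = assms(14) and v = assms(16) and gauss = assms(22)
  interpret valued_field K w
    using assms(1) gauss by (simp add: valued_field_def valued_field_axioms_def gauss_extension_def)
  have kc: "k \<subseteq> carrier K" using subringE(1)[OF subfieldE(1)[OF k]] .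
  have wv: "w u = v u" if "u \<in> k" for u using gauss that by (auto simp: gauss_extension_def)
  have abcc: "a \<in> carrier K" "b \<in> carrier K" "c \<in> carrier K" using abc kc by auto
  have p2: "2 \<le> p" using prime_ge_2_nat[OF p(1)] .
  then have pS: "nmul p g = g + nmul (p - 1) g" for g :: 'g by (cases p) auto
  have ia: "inv a \<in> k" using subfield_m_inv(1)[OF k, of a] abc by simp
  have ck: "c \<otimes> inv a \<in> k" "b \<otimes> inv a \<in> k" using abc ia subringE(6)[OF subfieldE(1)[OF k]] by auto
  have cb: "c \<otimes> inv a \<otimes> a = c" "b \<otimes> inv a \<otimes> a = b" "c \<otimes> inv a \<in> carrier K" "b \<otimes> inv a \<in> carrier K"
    using abc abcc by simp_all
  obtain gx where gx: "w x = Fin gx" "\<gamma> = dh_of gx" using gauss_extension_value[OF gauss k x] .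
  obtain gc' where gc': "v (c \<otimes> inv a) = Fin gc'" "\<gamma> = dh_frac gc' p"
    using assms(19) by (cases "v (c \<otimes> inv a)") auto
  have pgx: "nmul p gx = gc'"
  proof -
    have "dh_of (nmul p gx) = dh_of gc'"
      using nmul_dh_frac[of p gc'] p2 gx(2) gc'(2) by (simp add: dh_of_nmul)
    then show ?thesis by simp
  qed
  obtain gc where gc: "w c = Fin gc" "\<delta> = dh_frac gc p"
    using assms(20) wv[OF abc(3)] by (cases "v c") auto
  have c0: "c \<noteq> \<zero>" using gc(1) by auto
  have wcc: "w c = Fin gc' + w a" using w_mult[OF cb(3) abcc(1)] cb(1) gc'(1) wv[OF ck(1)] by simp
  have wa: "w a \<noteq> Infty" using w_eq_Infty_iff[OF abcc(1)] abc(4) by simp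
  have wb: "w c < w (b \<otimes> x)"
  proof -
    have "Fin gc' < w (b \<otimes> inv a) + w x"
    proof (cases "v (b \<otimes> inv a)")
      case (Fin gb)
      \<comment> \<open>Multiplied by \<open>p - 1\<close>, the hypothesis is an inequality in the value group.\<close>
      have "Fin \<gamma> < vdiv (p - 1) (v (b \<otimes> inv a))" using assms(18) unfolding assms(19)[symmetric] .
      then have "dh_of gx < dh_frac gb (p - 1)" unfolding Fin gx(2) by simp
      then have "nmul (p - 1) (dh_of gx) < nmul (p - 1) (dh_frac gb (p - 1))" using p2 by simp
      then have "nmul (p - 1) gx < gb" using p2 by (simp add: nmul_dh_frac flip: dh_of_nmul)
      then have "gc' < gb + gx" using pS[of gx] unfolding pgx by simp
      then show ?thesis using Fin wv[OF ck(2)] gx(1) by simp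
    next
      case Infty
      then show ?thesis using wv[OF ck(2)] by simp
    qed
    then have "Fin gc' + w a < w (b \<otimes> inv a) + w x + w a" using wa by (simp add: vext_add_less_cancel)
    also have "w (b \<otimes> inv a) + w x + w a = w (b \<otimes> inv a) + w a + w x" by (simp add: ac_simps)
    also have "w (b \<otimes> inv a) + w a + w x = w (b \<otimes> x)"
      using w_mult[OF cb(4) abcc(1)] w_mult[OF abcc(2) x] cb(2) by simp
    finally show ?thesis using wcc by simp
  qed
  have gauss': "w (\<Oplus>i\<in>{..N}. f i \<otimes> x [^] i) \<le> w (f j \<otimes> x [^] j)" if f: "f \<in> {..N} \<rightarrow> k" "j \<le> N" for N j :: nat and f
  proof -
    have fj: "f j \<in> k" using funcset_mem[OF f(1), of j] f(2) by simp
    then have fc: "f j \<in> carrier K" using kc by blast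
    have wf: "w (f j \<otimes> x [^] j) = w (f j) + Fin (nmul j gx)"
      using w_mult[OF fc nat_pow_closed[OF x], of j] unfolding w_pow[OF x gx(1)] .
    have "vhull (w (f j \<otimes> x [^] j)) = vhull (v (f j)) + Fin (nmul j \<gamma>)"
      unfolding wf wv[OF fj] gx(2) by (cases "v (f j)") (simp_all add: dh_of_add dh_of_nmul)
    then have "vhull (w (\<Oplus>i\<in>{..N}. f i \<otimes> x [^] i)) \<le> vhull (w (f j \<otimes> x [^] j))"
      using gauss_extension_le[OF gauss f] by simp
    then show ?thesis by (simp only: vhull_le_iff)
  qed
  have wx: "w (x [^] p) = w (c \<otimes> inv a)"
    using w_pow[OF x gx(1), of p] pgx gc'(1) wv[OF ck(1)] by simp
  have "valued_field K w" ..
  then interpret superelliptic K w k x y a b c p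
    by (intro superelliptic.intro superelliptic_axioms.intro k x y abc c0 p eq gen gauss' wx wb)
  obtain gy where gy: "w y = Fin gy" using w_eq_Infty_iff[OF y] y_nz by (cases "w y") auto
  have pgy: "nmul p gy = gc" using w_y_pow w_pow[OF y gy, of p] gc(1) by simp
  have \<delta>: "\<delta> = dh_of gy"
  proof -
    have "nmul p \<delta> = nmul p (dh_of gy)" using nmul_dh_frac[of p gc] p2 gc(2) pgy by (simp flip: dh_of_nmul)
    then show ?thesis using p2 by simp
  qed
  define H where "H = value_group (K\<lparr>carrier := k\<rparr>) v"
  have H: "g \<in> H \<longleftrightarrow> (\<exists>e\<in>k - {\<zero>}. w e = Fin g)" for g
  proof -
    have "v \<zero> = Infty" using wv[OF subringE(2)[OF subfieldE(1)[OF k]]] by simp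
    then show ?thesis using wv by (auto simp: H_def value_group_def)
  qed
  interpret add_subgroup H
  proof
    show "0 \<in> H" unfolding H using subringE(3)[OF subfieldE(1)[OF k]]
      by (intro bexI[of _ \<one>]) (auto simp: zero_vext_def[symmetric])
    fix g assume "g \<in> H"
    then obtain e where e: "e \<in> k" "e \<noteq> \<zero>" "w e = Fin g" unfolding H by blast
    then have ec: "e \<in> carrier K" using kc by blast
    have ie: "inv e \<in> k - {\<zero>}" using subfield_m_inv(1)[OF k, of e] e by simp
    have "w e + w (inv e) = 0" using w_mult[of e "inv e"] ec e(2) by simp
    then have "w (inv e) = Fin (- g)"
      using e(3) by (cases "w (inv e)") (auto simp: zero_vext_def eq_neg_iff_add_eq_0 add.commute)
    with ie show "- g \<in> H" unfolding H by blast
    fix h assume "h \<in> H"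
    then obtain f where f: "f \<in> k" "f \<noteq> \<zero>" "w f = Fin h" unfolding H by blast
    then have fc: "f \<in> carrier K" using kc by blast
    have "e \<otimes> f \<in> k - {\<zero>}" using mult_k[OF e(1) f(1)] e f ec fc by (simp add: integral_iff)
    moreover have "w (e \<otimes> f) = Fin (g + h)" using w_mult[OF ec fc] e f by simp
    ultimately show "g + h \<in> H" unfolding H by blast
  qed
  have gxH: "nmul p gx \<in> H"
    unfolding H pgx using d wv[OF d(1)] gc'(1) by (intro bexI[of _ d]) (auto simp: d_def)
  have gyH: "nmul p gy \<in> H"
    unfolding H pgy using abc c0 gc(1) by blast
  have vk: "vk = dh_of ` H" using assms(21) by (simp add: H_def)
  have crit: "add_multiples vk \<gamma> = add_multiples vk \<delta> \<and> (\<gamma> \<notin> vk \<longrightarrow> \<gamma> - \<delta> \<notin> vk) \<longleftrightarrow>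
      add_multiples H gx = add_multiples H gy \<and> (gx \<notin> H \<longrightarrow> gx - gy \<notin> H)"
    unfolding vk gx(2) \<delta> add_multiples_dh_of dh_of_diff[symmetric]
    by (simp only: inj_image_eq_iff[OF inj_dh_of] inj_image_mem_iff[OF inj_dh_of])
  have char: "[p] \<cdot>\<^bsub>Kw\<^esub> \<one>\<^bsub>Kw\<^esub> \<noteq> \<zero>\<^bsub>Kw\<^esub>"
    using residue_char_transfer[OF k v wv p(1) assms(17)] .
  have x_ram: "w (x [^] j) \<noteq> w e" if "gx \<notin> H" "0 < j" "j < p" "e \<in> k - {\<zero>}" for j :: nat and e
    using nmul_notin[OF p(1) gxH that(1-3)] w_pow[OF x gx(1), of j] that(4) unfolding H by auto
  have "\<not> ruled Kw L \<longleftrightarrow> add_multiples H gx = add_multiples H gy \<and> (gx \<notin> H \<longrightarrow> gx - gy \<notin> H)"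
    using p(1) gxH gyH
  proof (cases rule: value_cases)
    case ramified
    have "(\<exists>e\<in>k - {\<zero>}. w x = w e) \<or>
        (\<forall>j e. 0 < j \<longrightarrow> j < p \<longrightarrow> e \<in> k - {\<zero>} \<longrightarrow> w (x [^] (j::nat)) \<noteq> w e)"
    proof (cases "gx \<in> H")
      case True
      then show ?thesis unfolding H using gx(1) by metis
    next
      case False
      then show ?thesis using x_ram by blast
    qed
    moreover have "w (y [^] j) \<noteq> w (e \<otimes> x [^] i)" if j: "0 < j" "j < p" and e: "e \<in> k - {\<zero>}" for i j :: nat and e
    proof
      assume "w (y [^] j) = w (e \<otimes> x [^] i)"
      moreover obtain ge where ge: "w e = Fin ge" using e kc w_eq_Infty_iff[of e] by (cases "w e") auto
      ultimately have "nmul j gy = ge + nmul i gx"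
        using w_pow[OF y gy, of j] w_pow[OF x gx(1), of i] w_mult[of e "x [^] i"] e kc x by auto
      then have "nmul j gy - nmul i gx \<in> H" unfolding H using ge e by auto
      with ramified(2) j show False by blast
    qed
    ultimately have "ruled Kw L" by (rule ruled_if_ramified)
    moreover have "add_multiples H gx \<noteq> add_multiples H gy"
      using ramified(1) self_mem_add_multiples by blast
    ultimately show ?thesis by blast
  next
    case second
    then obtain e where e: "e \<in> k" "e \<noteq> \<zero>" "w e = Fin gy" unfolding H by blast
    then have "ruled Kw L" using x_ram[OF second(1)] gy by (intro ruled_if_second_coordinate[of e]) auto
    moreover have "add_multiples H gx \<noteq> add_multiples H gy"
      using second self_mem_add_multiples[of gx] add_multiples_eq_self[of gy] by blast
    ultimately show ?thesis by blast
  next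
    case quotient
    then obtain e where e: "e \<in> k" "e \<noteq> \<zero>" "w e = Fin (gy - gx)" unfolding H by blast
    then have "w y = w (e \<otimes> x)" using w_mult[of e x] kc x gx(1) gy by auto
    then have "ruled Kw L" using x_ram[OF quotient(1)] e by (intro ruled_if_quotient[of e]) auto
    moreover have "gx - gy \<in> H" using uminus[OF quotient(2)] by simp
    ultimately show ?thesis using quotient(1) by blast
  next
    case unramified
    then obtain e f where e: "e \<in> k - {\<zero>}" "w e = Fin gx" "f \<in> k - {\<zero>}" "w f = Fin gy" unfolding H by blast
    have "\<not> ruled Kw L" by (rule not_ruled[OF char]) (use e gx(1) gy in metis)
    with unramified show ?thesis by (simp add: add_multiples_eq_self)
  next
    case (mixed m)
    then obtain e where e: "e \<in> k - {\<zero>}" "w e = Fin (gy - nmul m gx)" unfolding H by blast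
    then have "w y = w (e \<otimes> x [^] m)"
      using w_mult[of e "x [^] m"] w_pow[OF x gx(1), of m] kc x gy by auto
    then have "\<not> ruled Kw L" by (intro not_ruled[OF char]) (use e mixed in blast)
    with mixed_criterion[OF p(1) gxH mixed] show ?thesis by blast
  qed
  then show ?thesis unfolding crit .
qed

end
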